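(* Let $\alpha$ be an automorphism of an exact $C^*$-algebra $A$. Suppose there exist a finite subset $\Omega\subset A$, a real number $D\geq 1$, and, for each $n\in\mathbb{N}$, a subset $I_n\subset\{0,\dots,n-1\}\times\Omega$, such that $\limsup_{n\to\infty}|I_n|/n>0$ and such that for each $n\in\mathbb{N}$ some (equivalently, any) bijection from the standard basis of $\ell_1^{I_n}$ to $\{\alpha^k(x) : (k,x)\in I_n\}$ extends linearly to a $D$-isomorphism from $\ell_1^{I_n}$ onto the linear span of $\{\alpha^k(x) : (k,x)\in I_n\}$ in $A$. Then $ht(\alpha)>0$, where $ht(\alpha)$ is the Voiculescu-Brown entropy of $\alpha$.
   Context: All Banach spaces are over $\mathbb{C}$. For a finite set $I$, $\ell_1^{I}$ is the space $\mathbb{C}^I$ with the $\ell_1$-norm. A $D$-isomorphism is an isomorphism $\Gamma:Y\to Z$ between Banach spaces with $\|\Gamma\|\,\|\Gamma^{-1}\|\leq D$. Voiculescu-Brown entropy: let $A$ be an exact $C^*$-algebra and $\pi:A\to\mathcal{B}(\mathcal{H})$ a faithful representation. For a finite set $\Omega\subset A$ and $\delta>0$, let $\mathrm{CPA}(\pi,\Omega,\delta)$ be the collection of triples $(\phi,\psi,B)$ where $B$ is a finite-dimensional $C^*$-algebra and $\phi:A\to B$ and $\psi:B\to\mathcal{B}(\mathcal{H})$ are completely positive contractive linear maps such that $\|(\psi\circ\phi)(x)-\pi(x)\|<\delta$ for all $x\in\Omega$. (This collection is nonempty because $A$ is exact.) Let $\mathrm{rcp}(\Omega,\delta)$ be the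 infimum of $\mathrm{rank}\,B$ over all $(\phi,\psi,B)\in\mathrm{CPA}(\pi,\Omega,\delta)$, where $\mathrm{rank}\,B$ is the dimension of a maximal commutative $C^*$-subalgebra of $B$; this quantity does not depend on the choice of $\pi$. For an automorphism $\alpha$ of $A$ set $$ht(\alpha,\Omega,\delta)=\limsup_{n\to\infty}\frac1n\log\mathrm{rcp}(\Omega\cup\alpha\Omega\cup\cdots\cup\alpha^{n-1}\Omega,\delta),$$ $$ht(\alpha,\Omega)=\sup_{\delta>0}ht(\alpha,\Omega,\delta),\qquad ht(\alpha)=\sup_{\Omega}ht(\alpha,\Omega),$$ the last supremum being over all finite sets $\Omega\subset A$. *)

theory Defs
  imports
    "HOL-Library.Extended_Real"
    "HOL-Library.Extended_Nat"
    "HOL-Library.Liminf_Limsup"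
    "Jordan_Normal_Form.VS_Connect"
begin

text \<open>
  All spaces and algebras are structures with an explicit carrier, because the entropy quantifies
  over finite-dimensional C*-algebras. The records extend the module record of HOL-Algebra, and the
  scalar field is \<^term>\<open>class_ring :: complex ring\<close>. Of the inherited ring fields,
  \<open>one\<close> is never constrained (C*-algebras need not be unital) and \<open>mult\<close> is
  constrained only for C*-algebras.
\<close>

section \<open>Normed spaces\<close>

record 'a cnormed = "(complex, 'a) module" +
  nrm :: "'a \<Rightarrow> real"

locale cnormed_space =
  vectorspace "class_ring :: complex ring" V for V :: "('a, 'm) cnormed_scheme" +
  assumes nrm_nonneg: "x \<in> carrier V \<Longrightarrow> 0 \<le> nrm V x"
    and nrm_eq_0: "x \<in> carrier V \<Longrightarrow> nrm V x = 0 \<longleftrightarrow> x = \<zero>\<^bsub>V\<^esub>"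
    and nrm_smult: "x \<in> carrier V \<Longrightarrow> nrm V (c \<odot>\<^bsub>V\<^esub> x) = cmod c * nrm V x"
    and nrm_triangle: "x \<in> carrier V \<Longrightarrow> y \<in> carrier V \<Longrightarrow> nrm V (x \<oplus>\<^bsub>V\<^esub> y) \<le> nrm V x + nrm V y"

locale cbanach_space = cnormed_space +
  assumes nrm_complete:
    "\<lbrakk>\<And>n. s n \<in> carrier V;
      \<And>e. e > 0 \<Longrightarrow> \<exists>N. \<forall>m\<ge>N. \<forall>n\<ge>N. nrm V (s m \<ominus>\<^bsub>V\<^esub> s n) < e\<rbrakk>
     \<Longrightarrow> \<exists>l\<in>carrier V. (\<lambda>n. nrm V (s n \<ominus>\<^bsub>V\<^esub> l)) \<longlonglongrightarrow> 0"

definition bounded_linear_map ::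
    "('a, 'm) cnormed_scheme \<Rightarrow> ('b, 'k) cnormed_scheme \<Rightarrow> ('a \<Rightarrow> 'b) \<Rightarrow> bool" where
  "bounded_linear_map V W f \<longleftrightarrow>
     linear_map (class_ring :: complex ring) V W f \<and>
     (\<exists>K. \<forall>x\<in>carrier V. nrm W (f x) \<le> K * nrm V x)"

definition op_norm ::
    "('a, 'm) cnormed_scheme \<Rightarrow> ('b, 'k) cnormed_scheme \<Rightarrow> ('a \<Rightarrow> 'b) \<Rightarrow> real" where
  "op_norm V W f = Sup {nrm W (f x) | x. x \<in> carrier V \<and> nrm V x \<le> 1}"

definition D_isomorphism ::
    "real \<Rightarrow> ('a, 'm) cnormed_scheme \<Rightarrow> ('b, 'k) cnormed_scheme \<Rightarrow> ('a \<Rightarrow> 'b) \<Rightarrow> bool" where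
  "D_isomorphism D V W f \<longleftrightarrow>
     bij_betw f (carrier V) (carrier W) \<and>
     bounded_linear_map V W f \<and>
     bounded_linear_map W V (inv_into (carrier V) f) \<and>
     op_norm V W f * op_norm W V (inv_into (carrier V) f) \<le> D"

text \<open>
  \<open>l1_space I\<close> is used for finite \<open>I\<close>; vectors indexed by \<open>I\<close> are functions
  vanishing outside \<open>I\<close>.
\<close>

definition l1_space :: "'i set \<Rightarrow> ('i \<Rightarrow> complex) cnormed" where
  "l1_space I =
     \<lparr>carrier = {f. \<forall>i. i \<notin> I \<longrightarrow> f i = 0},
      mult = undefined, one = undefined,
      zero = (\<lambda>i. 0), add = (\<lambda>f g i. f i + g i),
      smult = (\<lambda>c f i. c * f i),
      nrm = (\<lambda>f. \<Sum>i\<in>I. cmod (f i))\<rparr>"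

definition std_basis :: "'i set \<Rightarrow> ('i \<Rightarrow> complex) set" where
  "std_basis I = (\<lambda>i j. if j = i then 1 else 0) ` I"

definition span_space :: "('a, 'm) cnormed_scheme \<Rightarrow> 'a set \<Rightarrow> ('a, 'm) cnormed_scheme" where
  "span_space V S = V\<lparr>carrier := LinearCombinations.module.span (class_ring :: complex ring) V S\<rparr>"

section \<open>C*-algebras\<close>

record 'a cstar = "'a cnormed" +
  star :: "'a \<Rightarrow> 'a"

locale cstar_algebra =
  cbanach_space A for A :: "('a, 'm) cstar_scheme" +
  assumes alg_mult_closed: "x \<in> carrier A \<Longrightarrow> y \<in> carrier A \<Longrightarrow> x \<otimes>\<^bsub>A\<^esub> y \<in> carrier A"
    and alg_mult_assoc: "\<lbrakk>x \<in> carrier A; y \<in> carrier A; z \<in> carrier A\<rbrakk>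
      \<Longrightarrow> (x \<otimes>\<^bsub>A\<^esub> y) \<otimes>\<^bsub>A\<^esub> z = x \<otimes>\<^bsub>A\<^esub> (y \<otimes>\<^bsub>A\<^esub> z)"
    and alg_distr_left: "\<lbrakk>x \<in> carrier A; y \<in> carrier A; z \<in> carrier A\<rbrakk>
      \<Longrightarrow> (x \<oplus>\<^bsub>A\<^esub> y) \<otimes>\<^bsub>A\<^esub> z = x \<otimes>\<^bsub>A\<^esub> z \<oplus>\<^bsub>A\<^esub> y \<otimes>\<^bsub>A\<^esub> z"
    and alg_distr_right: "\<lbrakk>x \<in> carrier A; y \<in> carrier A; z \<in> carrier A\<rbrakk>
      \<Longrightarrow> z \<otimes>\<^bsub>A\<^esub> (x \<oplus>\<^bsub>A\<^esub> y) = z \<otimes>\<^bsub>A\<^esub> x \<oplus>\<^bsub>A\<^esub> z \<otimes>\<^bsub>A\<^esub> y"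
    and alg_smult_left: "\<lbrakk>x \<in> carrier A; y \<in> carrier A\<rbrakk>
      \<Longrightarrow> (c \<odot>\<^bsub>A\<^esub> x) \<otimes>\<^bsub>A\<^esub> y = c \<odot>\<^bsub>A\<^esub> (x \<otimes>\<^bsub>A\<^esub> y)"
    and alg_smult_right: "\<lbrakk>x \<in> carrier A; y \<in> carrier A\<rbrakk>
      \<Longrightarrow> x \<otimes>\<^bsub>A\<^esub> (c \<odot>\<^bsub>A\<^esub> y) = c \<odot>\<^bsub>A\<^esub> (x \<otimes>\<^bsub>A\<^esub> y)"
    and nrm_mult: "\<lbrakk>x \<in> carrier A; y \<in> carrier A\<rbrakk> \<Longrightarrow> nrm A (x \<otimes>\<^bsub>A\<^esub> y) \<le> nrm A x * nrm A y"
    and star_closed: "x \<in> carrier A \<Longrightarrow> star A x \<in> carrier A"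
    and star_star: "x \<in> carrier A \<Longrightarrow> star A (star A x) = x"
    and star_add: "\<lbrakk>x \<in> carrier A; y \<in> carrier A\<rbrakk>
      \<Longrightarrow> star A (x \<oplus>\<^bsub>A\<^esub> y) = star A x \<oplus>\<^bsub>A\<^esub> star A y"
    and star_smult: "x \<in> carrier A \<Longrightarrow> star A (c \<odot>\<^bsub>A\<^esub> x) = cnj c \<odot>\<^bsub>A\<^esub> star A x"
    and star_mult: "\<lbrakk>x \<in> carrier A; y \<in> carrier A\<rbrakk>
      \<Longrightarrow> star A (x \<otimes>\<^bsub>A\<^esub> y) = star A y \<otimes>\<^bsub>A\<^esub> star A x"
    and cstar_identity: "x \<in> carrier A \<Longrightarrow> nrm A (star A x \<otimes>\<^bsub>A\<^esub> x) = (nrm A x)\<^sup>2"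

definition star_hom :: "('a, 'm) cstar_scheme \<Rightarrow> ('b, 'k) cstar_scheme \<Rightarrow> ('a \<Rightarrow> 'b) \<Rightarrow> bool" where
  "star_hom A B f \<longleftrightarrow>
     linear_map (class_ring :: complex ring) A B f \<and>
     (\<forall>x\<in>carrier A. \<forall>y\<in>carrier A. f (x \<otimes>\<^bsub>A\<^esub> y) = f x \<otimes>\<^bsub>B\<^esub> f y) \<and>
     (\<forall>x\<in>carrier A. f (star A x) = star B (f x))"

definition cstar_automorphism :: "('a, 'm) cstar_scheme \<Rightarrow> ('a \<Rightarrow> 'a) \<Rightarrow> bool" where
  "cstar_automorphism A \<alpha> \<longleftrightarrow> star_hom A A \<alpha> \<and> bij_betw \<alpha> (carrier A) (carrier A)"

text \<open>
  A C*-subalgebra is a norm-closed *-subalgebra; inside a C*-algebra, norm-closed is the same as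
  complete.
\<close>

definition cstar_subalgebra :: "'a set \<Rightarrow> ('a, 'm) cstar_scheme \<Rightarrow> bool" where
  "cstar_subalgebra C A \<longleftrightarrow> C \<subseteq> carrier A \<and> cstar_algebra (A\<lparr>carrier := C\<rparr>)"

definition commutative_subalgebra :: "'a set \<Rightarrow> ('a, 'm) cstar_scheme \<Rightarrow> bool" where
  "commutative_subalgebra C A \<longleftrightarrow>
     cstar_subalgebra C A \<and> (\<forall>x\<in>C. \<forall>y\<in>C. x \<otimes>\<^bsub>A\<^esub> y = y \<otimes>\<^bsub>A\<^esub> x)"

definition maximal_commutative_subalgebra :: "'a set \<Rightarrow> ('a, 'm) cstar_scheme \<Rightarrow> bool" where
  "maximal_commutative_subalgebra C A \<longleftrightarrow>
     commutative_subalgebra C A \<and>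
     (\<forall>C'. commutative_subalgebra C' A \<and> C \<subseteq> C' \<longrightarrow> C' = C)"

definition finite_dim_cstar_algebra :: "('a, 'm) cstar_scheme \<Rightarrow> bool" where
  "finite_dim_cstar_algebra B \<longleftrightarrow>
     cstar_algebra B \<and> vectorspace.fin_dim (class_ring :: complex ring) B"

text \<open>
  In a finite-dimensional C*-algebra all maximal commutative C*-subalgebras have the same dimension,
  so the choice below is immaterial.
\<close>

definition cstar_rank :: "('a, 'm) cstar_scheme \<Rightarrow> nat" where
  "cstar_rank B =
     vectorspace.dim (class_ring :: complex ring)
       (B\<lparr>carrier := (SOME C. maximal_commutative_subalgebra C B)\<rparr>)"

section \<open>Completely positive maps\<close>

text \<open>
  \<open>X\<close> is a positive element of the C*-algebra of \<open>n\<close> by \<open>n\<close> matrices over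
  \<open>A\<close>, that is, \<open>X = Y* Y\<close> for such a matrix \<open>Y\<close>. Only the entries with
  indices below \<open>n\<close> matter.
\<close>

definition mat_positive :: "('a, 'm) cstar_scheme \<Rightarrow> nat \<Rightarrow> (nat \<Rightarrow> nat \<Rightarrow> 'a) \<Rightarrow> bool" where
  "mat_positive A n X \<longleftrightarrow>
     (\<exists>Y. (\<forall>i<n. \<forall>j<n. Y i j \<in> carrier A) \<and>
          (\<forall>i<n. \<forall>j<n. X i j = (\<Oplus>\<^bsub>A\<^esub>k\<in>{..<n}. star A (Y k i) \<otimes>\<^bsub>A\<^esub> Y k j)))"

definition completely_positive ::
    "('a, 'm) cstar_scheme \<Rightarrow> ('b, 'k) cstar_scheme \<Rightarrow> ('a \<Rightarrow> 'b) \<Rightarrow> bool" where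
  "completely_positive A B f \<longleftrightarrow>
     linear_map (class_ring :: complex ring) A B f \<and>
     (\<forall>n X. mat_positive A n X \<longrightarrow> mat_positive B n (\<lambda>i j. f (X i j)))"

definition cp_contraction ::
    "('a, 'm) cstar_scheme \<Rightarrow> ('b, 'k) cstar_scheme \<Rightarrow> ('a \<Rightarrow> 'b) \<Rightarrow> bool" where
  "cp_contraction A B f \<longleftrightarrow>
     completely_positive A B f \<and> (\<forall>x\<in>carrier A. nrm B (f x) \<le> nrm A x)"

section \<open>Hilbert spaces and representations\<close>

record 'h chilbert = "'h cnormed" +
  ip :: "'h \<Rightarrow> 'h \<Rightarrow> complex"

locale chilbert_space =
  cbanach_space H for H :: "('h, 'm) chilbert_scheme" +
  assumes ip_add_left: "\<lbrakk>x \<in> carrier H; y \<in> carrier H; z \<in> carrier H\<rbrakk>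
      \<Longrightarrow> ip H (x \<oplus>\<^bsub>H\<^esub> y) z = ip H x z + ip H y z"
    and ip_smult_left: "\<lbrakk>x \<in> carrier H; y \<in> carrier H\<rbrakk>
      \<Longrightarrow> ip H (c \<odot>\<^bsub>H\<^esub> x) y = c * ip H x y"
    and ip_cnj: "\<lbrakk>x \<in> carrier H; y \<in> carrier H\<rbrakk> \<Longrightarrow> ip H y x = cnj (ip H x y)"
    and ip_self: "x \<in> carrier H \<Longrightarrow> ip H x x = complex_of_real ((nrm H x)\<^sup>2)"

text \<open>
  The C*-algebra of bounded operators. Operators are made extensional (\<open>undefined\<close> off the
  carrier of \<open>H\<close>) so that equality of operators is equality of functions.
\<close>

definition bounded_ops :: "('h, 'm) chilbert_scheme \<Rightarrow> ('h \<Rightarrow> 'h) set" where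
  "bounded_ops H = {T \<in> extensional (carrier H). bounded_linear_map H H T}"

definition op_adjoint :: "('h, 'm) chilbert_scheme \<Rightarrow> ('h \<Rightarrow> 'h) \<Rightarrow> 'h \<Rightarrow> 'h" where
  "op_adjoint H T =
     (THE S. S \<in> bounded_ops H \<and>
             (\<forall>x\<in>carrier H. \<forall>y\<in>carrier H. ip H (S x) y = ip H x (T y)))"

definition op_algebra :: "('h, 'm) chilbert_scheme \<Rightarrow> ('h \<Rightarrow> 'h) cstar" where
  "op_algebra H =
     \<lparr>carrier = bounded_ops H,
      mult = compose (carrier H),
      one = (\<lambda>x\<in>carrier H. x),
      zero = (\<lambda>x\<in>carrier H. \<zero>\<^bsub>H\<^esub>),
      add = (\<lambda>S T. \<lambda>x\<in>carrier H. S x \<oplus>\<^bsub>H\<^esub> T x),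
      smult = (\<lambda>c T. \<lambda>x\<in>carrier H. c \<odot>\<^bsub>H\<^esub> T x),
      nrm = op_norm H H,
      star = op_adjoint H\<rparr>"

definition faithful_rep ::
    "('a, 'm) cstar_scheme \<Rightarrow> ('h, 'k) chilbert_scheme \<Rightarrow> ('a \<Rightarrow> 'h \<Rightarrow> 'h) \<Rightarrow> bool" where
  "faithful_rep A H \<pi> \<longleftrightarrow>
     chilbert_space H \<and> star_hom A (op_algebra H) \<pi> \<and> inj_on \<pi> (carrier A)"

section \<open>Completely positive approximation and exactness\<close>

text \<open>
  Every finite-dimensional C*-algebra has at most as many elements as \<^typ>\<open>nat \<Rightarrow> complex\<close>,
  so up to isomorphism it occurs with a carrier in that type.
\<close>

definition CPA ::
    "('a, 'm) cstar_scheme \<Rightarrow> ('h, 'k) chilbert_scheme \<Rightarrow> ('a \<Rightarrow> 'h \<Rightarrow> 'h) \<Rightarrow> 'a set \<Rightarrow> real \<Rightarrow>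
     (('a \<Rightarrow> nat \<Rightarrow> complex) \<times> ((nat \<Rightarrow> complex) \<Rightarrow> 'h \<Rightarrow> 'h) \<times> (nat \<Rightarrow> complex) cstar) set" where
  "CPA A H \<pi> \<Omega> \<delta> =
     {(\<phi>, \<psi>, B).
        finite_dim_cstar_algebra B \<and>
        cp_contraction A B \<phi> \<and>
        cp_contraction B (op_algebra H) \<psi> \<and>
        (\<forall>x\<in>\<Omega>. nrm (op_algebra H) (\<psi> (\<phi> x) \<ominus>\<^bsub>op_algebra H\<^esub> \<pi> x) < \<delta>)}"

text \<open>
  Exactness in the form of Brown and Ozawa (Definition 2.3.2): some faithful representation is
  nuclear. By Kirchberg this agrees with exactness of the functor given by the minimal tensor
  product with \<open>A\<close>. Restricting the Hilbert space to carriers in \<open>'a \<Rightarrow> complex\<close> is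
  no loss: \<open>A\<close> has a faithful representation on a Hilbert space with an orthonormal basis of
  cardinality at most that of the carrier of \<open>A\<close>, and, by Arveson's extension theorem, nuclearity
  does not depend on the faithful representation.
\<close>

definition exact_cstar_algebra :: "('a, 'm) cstar_scheme \<Rightarrow> bool" where
  "exact_cstar_algebra A \<longleftrightarrow>
     cstar_algebra A \<and>
     (\<exists>(H :: ('a \<Rightarrow> complex) chilbert) \<pi>. faithful_rep A H \<pi> \<and>
        (\<forall>\<Omega> \<delta>. finite \<Omega> \<and> \<Omega> \<subseteq> carrier A \<and> \<delta> > 0 \<longrightarrow> CPA A H \<pi> \<Omega> \<delta> \<noteq> {}))"

section \<open>Voiculescu-Brown entropy\<close>

definition rcp ::
    "('a, 'm) cstar_scheme \<Rightarrow> ('h, 'k) chilbert_scheme \<Rightarrow> ('a \<Rightarrow> 'h \<Rightarrow> 'h) \<Rightarrow> 'a set \<Rightarrow> real \<Rightarrow> enat"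
  where
  "rcp A H \<pi> \<Omega> \<delta> = (INF (\<phi>, \<psi>, B)\<in>CPA A H \<pi> \<Omega> \<delta>. enat (cstar_rank B))"

text \<open>
  The value 0 of \<^const>\<open>rcp\<close> occurs: the zero algebra is allowed as \<open>B\<close> and has rank 0.
\<close>

definition eln :: "enat \<Rightarrow> ereal" where
  "eln r = (case r of enat n \<Rightarrow> if n = 0 then -\<infinity> else ereal (ln (real n)) | \<infinity> \<Rightarrow> \<infinity>)"

definition ht_at ::
    "('a, 'm) cstar_scheme \<Rightarrow> ('h, 'k) chilbert_scheme \<Rightarrow> ('a \<Rightarrow> 'h \<Rightarrow> 'h) \<Rightarrow> ('a \<Rightarrow> 'a) \<Rightarrow>
     'a set \<Rightarrow> real \<Rightarrow> ereal" where
  "ht_at A H \<pi> \<alpha> \<Omega> \<delta> =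
     limsup (\<lambda>n. eln (rcp A H \<pi> (\<Union>k<n. (\<alpha> ^^ k) ` \<Omega>) \<delta>) / ereal (real n))"

definition ht_on ::
    "('a, 'm) cstar_scheme \<Rightarrow> ('h, 'k) chilbert_scheme \<Rightarrow> ('a \<Rightarrow> 'h \<Rightarrow> 'h) \<Rightarrow> ('a \<Rightarrow> 'a) \<Rightarrow>
     'a set \<Rightarrow> ereal" where
  "ht_on A H \<pi> \<alpha> \<Omega> = (SUP \<delta>\<in>{0<..}. ht_at A H \<pi> \<alpha> \<Omega> \<delta>)"

definition ht ::
    "('a, 'm) cstar_scheme \<Rightarrow> ('h, 'k) chilbert_scheme \<Rightarrow> ('a \<Rightarrow> 'h \<Rightarrow> 'h) \<Rightarrow> ('a \<Rightarrow> 'a) \<Rightarrow> ereal"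
  where
  "ht A H \<pi> \<alpha> = (SUP \<Omega>\<in>{\<Omega>. finite \<Omega> \<and> \<Omega> \<subseteq> carrier A}. ht_on A H \<pi> \<alpha> \<Omega>)"

end

theory Submission
  imports Defs "HOL-Library.FuncSet" "HOL-Computational_Algebra.Fundamental_Theorem_Algebra"
begin

text \<open>
  Fix \<open>n\<close>, put \<open>N = |I n|\<close>, and let \<open>(\<phi>, \<psi>, B)\<close> be a completely positive approximation of the
  elements \<open>\<alpha>^k(x)\<close> with tolerance \<open>\<delta>\<close>. By hypothesis the sums \<open>\<Sum> \<plusminus> \<alpha>^k(x)\<close> over \<open>I n\<close> have
  norm at least a fixed multiple of \<open>N\<close>, whatever the signs. If \<open>\<delta>\<close> is small compared with that
  multiple, which can be arranged independently of \<open>n\<close>, the images under the contraction \<open>\<phi>\<close> keep half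
  of the bound (\<open>CPA_lower_bound\<close>). So \<open>B\<close> contains \<open>N\<close> elements \<open>b\<^sub>i\<close> of norm at most \<open>K\<close> such that
  \<open>\<parallel>\<Sum> \<plusminus> b\<^sub>i\<parallel> \<ge> \<gamma> N\<close> for all signs, where \<open>K / \<gamma> \<le> 2 D\<close>. The heart of the matter is that this
  forces the rank \<open>r\<close> of \<open>B\<close> to be exponentially large in \<open>N\<close>.

  For commutative \<open>B\<close> this is the fact that \<open>l\<^sub>1\<close> of dimension \<open>N\<close> embeds into \<open>l\<^sub>\<infinity>\<close> of dimension \<open>r\<close>
  only if \<open>log r\<close> is at least of order \<open>N\<close>. In general two ingredients replace the points of a finite space.
  First, \<open>B\<close> has at most \<open>r\<^sup>2\<close> linear functionals of norm at most one, its matrix coefficients,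
  whose absolute values add up to at least the norm (\<open>rank_many_functionals\<close>). Secondly, the method of
  moments: for \<open>Y = \<Sum> \<plusminus> b\<^sub>i\<close> with independent random signs the element \<open>(Y* Y)^m\<close> is a sum over words
  of length \<open>2 m\<close>, and since all mixed moments of signs are nonnegative, the mean square of one
  matrix coefficient is at most \<open>K^(4m)\<close> times the moment of order \<open>4 m\<close> of \<open>\<Sum> \<plusminus> 1\<close>, hence at most
  \<open>2 K^(4m) (4 e\<^sup>2 m N)^(2m)\<close>. For \<open>m\<close> a power of two the C*-identity gives \<open>\<parallel>(Y* Y)^m\<parallel> = \<parallel>Y\<parallel>^(2m)\<close>,
  which is at least \<open>(\<gamma> N)^(2m)\<close> for every choice of signs. Comparing the two bounds
  (\<open>l1_lower_bound_imp_many_functionals\<close>) with \<open>m\<close> a suitable small multiple of \<open>N\<close> gives \<open>2^m \<le> r^4\<close>. So \<open>log r\<close>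
  is at least a constant times \<open>|I n|\<close> (\<open>ln_rank_lower_bound\<close>), and as \<open>|I n| / n\<close> exceeds a positive constant
  for infinitely many \<open>n\<close>, the entropy is positive.

  Two facts of C*-algebra theory enter. Faithful representations, hence also automorphisms, are
  isometric (\<open>faithful_rep_isometric\<close>); this links the norm of \<open>A\<close> to the operator norm, in which
  the approximation is measured, and it makes \<open>\<delta>\<close> independent of \<open>n\<close>. The proof below avoids spectral theory: it
  needs only square roots \<open>s = sqrt (1 - z)\<close>, where \<open>1 - s\<close> is obtained as a limit of polynomials in \<open>z\<close> with nonnegative
  coefficients (\<open>op_sqrt\<close>), and it never adjoins a unit, because everything happens among self-adjoint
  operators on the vector space \<open>A\<close>. Secondly, a finite-dimensional C*-algebra \<open>B\<close> is
  analysed by the minimal projections of a maximal commutative subalgebra \<open>C\<close>. They come from common eigenvectors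
  of \<open>C\<close>, there are at most \<open>dim C\<close> of them, and maximality of \<open>C\<close> makes the corners \<open>p B q\<close> at most
  one-dimensional.
\<close>

section \<open>Normed spaces and limits\<close>

lemma null_comparison:
  fixes f g :: "nat \<Rightarrow> real"
  assumes "\<And>n. \<bar>f n\<bar> \<le> g n" "g \<longlonglongrightarrow> 0" shows "f \<longlonglongrightarrow> 0"
  by (rule tendsto_0_le[OF assms(2), where K = 1]) (use assms(1) in \<open>auto intro!: always_eventually order_trans[OF _ abs_ge_self]\<close>)

context cnormed_space begin
abbreviation vadd (infixl \<open>\<boxplus>\<close> 65) where "x \<boxplus> y \<equiv> x \<oplus>\<^bsub>V\<^esub> y"
abbreviation vsub (infixl \<open>\<boxminus>\<close> 65) where "x \<boxminus> y \<equiv> x \<ominus>\<^bsub>V\<^esub> y"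
abbreviation vsmult (infixr \<open>\<cdot>\<close> 75) where "c \<cdot> x \<equiv> c \<odot>\<^bsub>V\<^esub> x"

lemma smult_in [simp]: "x \<in> carrier V \<Longrightarrow> c \<cdot> x \<in> carrier V" by simp

lemma sub_in [simp]: "x \<in> carrier V \<Longrightarrow> y \<in> carrier V \<Longrightarrow> x \<boxminus> y \<in> carrier V" by (rule M.minus_closed)

lemma smult_add_left: "x \<in> carrier V \<Longrightarrow> (c + d) \<cdot> x = c \<cdot> x \<boxplus> d \<cdot> x"
  using smult_l_distr[of c d x] by simp

lemma smult_add_right: "x \<in> carrier V \<Longrightarrow> y \<in> carrier V \<Longrightarrow> c \<cdot> (x \<boxplus> y) = c \<cdot> x \<boxplus> c \<cdot> y"
  using smult_r_distr[of c x y] by simp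

lemma smult_smult: "x \<in> carrier V \<Longrightarrow> c \<cdot> d \<cdot> x = (c * d) \<cdot> x"
  using smult_assoc1[of c d x] by simp

lemma smult_1 [simp]: "x \<in> carrier V \<Longrightarrow> 1 \<cdot> x = x"
  using smult_one[of x] by simp

lemma smult_0 [simp]: "x \<in> carrier V \<Longrightarrow> 0 \<cdot> x = \<zero>\<^bsub>V\<^esub>"
  using smult_l_null[of x] by simp

lemma smult_zero [simp]: "c \<cdot> \<zero>\<^bsub>V\<^esub> = \<zero>\<^bsub>V\<^esub>"
  by (rule smult_r_null) simp

lemma neg_eq_smult: "x \<in> carrier V \<Longrightarrow> \<ominus>\<^bsub>V\<^esub> x = (-1) \<cdot> x"
proof -
  assume x: "x \<in> carrier V"
  have "(-1) \<cdot> x \<boxplus> x = (-1 + 1) \<cdot> x"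
    using x by (simp only: smult_add_left smult_1)
  also have "\<dots> = \<zero>\<^bsub>V\<^esub>" using x by simp
  finally show ?thesis using x by (intro M.minus_equality) auto
qed

lemma sub_eq: "x \<in> carrier V \<Longrightarrow> y \<in> carrier V \<Longrightarrow> x \<boxminus> y = x \<boxplus> (-1) \<cdot> y"
  by (simp add: a_minus_def neg_eq_smult)

lemma nrm_zero [simp]: "nrm V \<zero>\<^bsub>V\<^esub> = 0" using nrm_eq_0 by auto

lemma nrm_sub_commute: "x \<in> carrier V \<Longrightarrow> y \<in> carrier V \<Longrightarrow> nrm V (x \<boxminus> y) = nrm V (y \<boxminus> x)"
proof -
  assume x: "x \<in> carrier V" and y: "y \<in> carrier V"
  have "x \<boxminus> y = (-1) \<cdot> (y \<boxminus> x)"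
    using x y by (simp add: sub_eq smult_add_right smult_smult M.a_comm)
  then show ?thesis using x y by (simp add: nrm_smult)
qed

lemma sub_eq_0_iff: "x \<in> carrier V \<Longrightarrow> y \<in> carrier V \<Longrightarrow> x \<boxminus> y = \<zero>\<^bsub>V\<^esub> \<longleftrightarrow> x = y"
proof -
  assume c: "x \<in> carrier V" "y \<in> carrier V"
  have "x = (x \<boxminus> y) \<boxplus> y" using c by (simp add: a_minus_def M.a_ac M.r_neg1 M.r_neg2 M.l_neg M.r_neg)
  moreover have "x \<boxminus> x = \<zero>\<^bsub>V\<^esub>" using c by (simp add: a_minus_def M.r_neg)
  ultimately show ?thesis using c by (metis M.l_zero)
qed

lemma sub_add_sub:
  "x \<in> carrier V \<Longrightarrow> y \<in> carrier V \<Longrightarrow> z \<in> carrier V \<Longrightarrow> (x \<boxminus> y) \<boxplus> (y \<boxminus> z) = x \<boxminus> z"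
  by (simp add: a_minus_def M.a_ac M.r_neg1 M.r_neg2)

lemma add_sub_add_left:
  assumes "a \<in> carrier V" "b \<in> carrier V" "c \<in> carrier V"
  shows "(a \<boxplus> b) \<boxminus> (a \<boxplus> c) = b \<boxminus> c"
proof -
  have "(a \<boxplus> b) \<boxminus> (a \<boxplus> c) = a \<boxplus> (b \<boxplus> (\<ominus>\<^bsub>V\<^esub> a \<boxplus> \<ominus>\<^bsub>V\<^esub> c))"
    using assms by (simp add: a_minus_def M.minus_add M.a_assoc)
  also have "b \<boxplus> (\<ominus>\<^bsub>V\<^esub> a \<boxplus> \<ominus>\<^bsub>V\<^esub> c) = \<ominus>\<^bsub>V\<^esub> a \<boxplus> (b \<boxplus> \<ominus>\<^bsub>V\<^esub> c)"
    using assms by (intro M.a_lcomm) auto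
  finally show ?thesis using assms by (simp add: M.r_neg2 a_minus_def)
qed

lemma add_sub_add_right:
  assumes "a \<in> carrier V" "b \<in> carrier V" "c \<in> carrier V"
  shows "(b \<boxplus> a) \<boxminus> (c \<boxplus> a) = b \<boxminus> c"
  using add_sub_add_left[OF assms] assms by (simp add: M.a_comm)

lemma sub_self: "x \<in> carrier V \<Longrightarrow> x \<boxminus> x = \<zero>\<^bsub>V\<^esub>"
  by (simp add: sub_eq_0_iff)

lemma nrm_sub_triangle:
  assumes "x \<in> carrier V" "y \<in> carrier V" "z \<in> carrier V"
  shows "nrm V (x \<boxminus> z) \<le> nrm V (x \<boxminus> y) + nrm V (y \<boxminus> z)"
  using nrm_triangle[of "x \<boxminus> y" "y \<boxminus> z"] assms by (simp add: sub_add_sub)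

lemma nrm_diff_le: "x \<in> carrier V \<Longrightarrow> y \<in> carrier V \<Longrightarrow> \<bar>nrm V x - nrm V y\<bar> \<le> nrm V (x \<boxminus> y)"
proof -
  assume x: "x \<in> carrier V" and y: "y \<in> carrier V"
  have 1: "nrm V a \<le> nrm V b + nrm V (a \<boxminus> b)" if "a \<in> carrier V" "b \<in> carrier V" for a b
  proof -
    have "a = b \<boxplus> (a \<boxminus> b)" using that by (simp add: a_minus_def M.a_ac M.r_neg1 M.r_neg2 M.r_neg)
    then show ?thesis using nrm_triangle[of b "a \<boxminus> b"] that by simp
  qed
  from 1[OF x y] 1[OF y x] show ?thesis using nrm_sub_commute[OF x y] by linarith
qed

lemma smult_sub: "x \<in> carrier V \<Longrightarrow> y \<in> carrier V \<Longrightarrow> c \<cdot> (x \<boxminus> y) = c \<cdot> x \<boxminus> c \<cdot> y"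
  by (simp add: sub_eq smult_add_right smult_smult)

lemma nrm_finsum_le:
  assumes "finite I" "f \<in> I \<rightarrow> carrier V"
  shows "nrm V (\<Oplus>\<^bsub>V\<^esub>i\<in>I. f i) \<le> (\<Sum>i\<in>I. nrm V (f i))"
  using assms
proof (induction I)
  case (insert i I)
  then have "nrm V (\<Oplus>\<^bsub>V\<^esub>i\<in>insert i I. f i) = nrm V (f i \<boxplus> (\<Oplus>\<^bsub>V\<^esub>i\<in>I. f i))"
    by (subst M.finsum_insert) auto
  also have "\<dots> \<le> nrm V (f i) + nrm V (\<Oplus>\<^bsub>V\<^esub>i\<in>I. f i)"
    using insert by (intro nrm_triangle M.finsum_closed) auto
  finally show ?case using insert by auto
qed simp

definition vlim :: "(nat \<Rightarrow> 'a) \<Rightarrow> 'a \<Rightarrow> bool" where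
  "vlim s l \<longleftrightarrow> (\<forall>n. s n \<in> carrier V) \<and> l \<in> carrier V \<and> (\<lambda>n. nrm V (s n \<boxminus> l)) \<longlonglongrightarrow> 0"

lemma vlim_unique: assumes "vlim s l" "vlim s l'" shows "l = l'"
proof -
  have c: "l \<in> carrier V" "l' \<in> carrier V" "\<And>n. s n \<in> carrier V" using assms by (auto simp: vlim_def)
  have "(\<lambda>n. nrm V (s n \<boxminus> l) + nrm V (s n \<boxminus> l')) \<longlonglongrightarrow> 0 + 0"
    using assms by (intro tendsto_add) (auto simp: vlim_def)
  moreover have "nrm V (l \<boxminus> l') \<le> nrm V (s n \<boxminus> l) + nrm V (s n \<boxminus> l')" for n
    using nrm_sub_triangle[of l "s n" l'] nrm_sub_commute[of l "s n"] c by simp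
  ultimately have "nrm V (l \<boxminus> l') \<le> 0 + 0"
    by (intro LIMSEQ_le_const) auto
  then have "nrm V (l \<boxminus> l') = 0" using nrm_nonneg[of "l \<boxminus> l'"] c by simp
  then show ?thesis using nrm_eq_0[of "l \<boxminus> l'"] c sub_eq_0_iff by simp
qed

lemma vlim_nrm: assumes "vlim s l" shows "(\<lambda>n. nrm V (s n)) \<longlonglongrightarrow> nrm V l"
proof -
  have "(\<lambda>n. nrm V (s n) - nrm V l) \<longlonglongrightarrow> 0"
  proof (rule null_comparison)
    show "\<And>n. \<bar>nrm V (s n) - nrm V l\<bar> \<le> nrm V (s n \<boxminus> l)"
      using assms nrm_diff_le by (auto simp: vlim_def)
  qed (use assms in \<open>auto simp: vlim_def\<close>)
  then show ?thesis by (simp add: LIM_zero_iff)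
qed

lemma vlim_add: assumes "vlim s l" "vlim t m" shows "vlim (\<lambda>n. s n \<boxplus> t n) (l \<boxplus> m)"
proof -
  have c: "l \<in> carrier V" "m \<in> carrier V" "\<And>n. s n \<in> carrier V" "\<And>n. t n \<in> carrier V"
    using assms by (auto simp: vlim_def)
  have e: "(s n \<boxplus> t n) \<boxminus> (l \<boxplus> m) = (s n \<boxminus> l) \<boxplus> (t n \<boxminus> m)" for n
    using c by (simp add: a_minus_def M.a_ac M.minus_add)
  have "(\<lambda>n. nrm V ((s n \<boxplus> t n) \<boxminus> (l \<boxplus> m))) \<longlonglongrightarrow> 0"
  proof (rule null_comparison)
    show "\<And>n. \<bar>nrm V ((s n \<boxplus> t n) \<boxminus> (l \<boxplus> m))\<bar>
       \<le> nrm V (s n \<boxminus> l) + nrm V (t n \<boxminus> m)"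
      unfolding e using c by (auto intro!: nrm_triangle simp: nrm_nonneg)
    show "(\<lambda>n. nrm V (s n \<boxminus> l) + nrm V (t n \<boxminus> m)) \<longlonglongrightarrow> 0"
      using tendsto_add[of _ 0 _ _ 0] assms by (force simp: vlim_def)
  qed
  then show ?thesis using c by (auto simp: vlim_def)
qed

lemma vlim_bounded_map:
  assumes "vlim s l" "\<And>x. x \<in> carrier V \<Longrightarrow> T x \<in> carrier V"
    and "\<And>x y. x \<in> carrier V \<Longrightarrow> y \<in> carrier V \<Longrightarrow> T (x \<boxminus> y) = T x \<boxminus> T y"
    and "\<And>x. x \<in> carrier V \<Longrightarrow> nrm V (T x) \<le> K * nrm V x"
  shows "vlim (\<lambda>n. T (s n)) (T l)"
proof -
  have c: "l \<in> carrier V" "\<And>n. s n \<in> carrier V" using assms by (auto simp: vlim_def)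
  have "(\<lambda>n. nrm V (T (s n) \<boxminus> T l)) \<longlonglongrightarrow> 0"
  proof (rule null_comparison)
    show "\<And>n. \<bar>nrm V (T (s n) \<boxminus> T l)\<bar> \<le> K * nrm V (s n \<boxminus> l)"
      using c assms(2,4) by (auto simp: nrm_nonneg assms(3)[symmetric])
    show "(\<lambda>n. K * nrm V (s n \<boxminus> l)) \<longlonglongrightarrow> 0"
      using tendsto_mult[of "\<lambda>n. K" K _ _ 0] assms(1) by (force simp: vlim_def)
  qed
  then show ?thesis using c assms(2) by (auto simp: vlim_def)
qed

lemma vlim_smult: assumes "vlim s l" shows "vlim (\<lambda>n. c \<cdot> s n) (c \<cdot> l)"
  by (rule vlim_bounded_map[OF assms, where K = "cmod c"]) (auto simp: smult_sub nrm_smult)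

lemma vlim_const: "l \<in> carrier V \<Longrightarrow> vlim (\<lambda>n. l) l"
  by (simp add: vlim_def a_minus_def M.r_neg)

lemma vlim_Suc: "vlim s l \<Longrightarrow> vlim (\<lambda>n. s (Suc n)) l"
  using LIMSEQ_Suc[of "\<lambda>n. nrm V (s n \<boxminus> l)" 0] by (auto simp: vlim_def)
end

context cbanach_space begin
text \<open>
  The form in which completeness is used: the distances are dominated by those of a real
  Cauchy sequence.
\<close>

lemma Cauchy_vlim:
  assumes "\<And>n. s n \<in> carrier V" "Cauchy r"
    and "\<And>m n. m \<le> n \<Longrightarrow> nrm V (s n \<boxminus> s m) \<le> r n - (r m :: real)"
  shows "\<exists>l. vlim s l"
proof -
  have "\<exists>l\<in>carrier V. (\<lambda>n. nrm V (s n \<boxminus> l)) \<longlonglongrightarrow> 0"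
  proof (rule nrm_complete)
    fix e :: real assume "e > 0"
    from CauchyD[OF assms(2) this] obtain N where N: "\<And>m n. m \<ge> N \<Longrightarrow> n \<ge> N \<Longrightarrow> norm (r m - r n) < e" by blast
    have "nrm V (s m \<boxminus> s n) < e" if "m \<ge> N" "n \<ge> N" for m n
    proof (cases "m \<le> n")
      case True
      have "nrm V (s m \<boxminus> s n) \<le> r n - r m" using assms(3)[OF True] nrm_sub_commute[of "s m" "s n"] assms(1) by simp
      then show ?thesis using N[OF that] by (simp add: abs_if split: if_splits)
    next
      case False
      then have "nrm V (s m \<boxminus> s n) \<le> r m - r n" using assms(3)[of n m] by simp
      then show ?thesis using N[OF that] by (simp add: abs_if split: if_splits)
    qed
    then show "\<exists>N. \<forall>m\<ge>N. \<forall>n\<ge>N. nrm V (s m \<boxminus> s n) < e" by blast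
  qed (rule assms(1))
  then show ?thesis using assms(1) by (auto simp: vlim_def)
qed
end

context cstar_algebra begin
text \<open>
  The notation introduced for normed spaces is tied to their record type, so it is set up anew for algebras,
  and for Hilbert spaces below.
\<close>

abbreviation aadd (infixl \<open>\<boxplus>\<close> 65) where "x \<boxplus> y \<equiv> x \<oplus>\<^bsub>A\<^esub> y"
abbreviation asub (infixl \<open>\<boxminus>\<close> 65) where "x \<boxminus> y \<equiv> x \<ominus>\<^bsub>A\<^esub> y"
abbreviation asmult (infixr \<open>\<cdot>\<close> 75) where "c \<cdot> x \<equiv> c \<odot>\<^bsub>A\<^esub> x"
abbreviation amul (infixl \<open>\<star>\<close> 70) where "x \<star> y \<equiv> x \<otimes>\<^bsub>A\<^esub> y"
abbreviation adj where "adj x \<equiv> star A x"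

lemmas alg_closed [simp] = alg_mult_closed star_closed

lemma mul_zero_left [simp]: "x \<in> carrier A \<Longrightarrow> \<zero>\<^bsub>A\<^esub> \<star> x = \<zero>\<^bsub>A\<^esub>"
  using alg_smult_left[of "\<zero>\<^bsub>A\<^esub>" x 0] by simp

lemma mul_zero_right [simp]: "x \<in> carrier A \<Longrightarrow> x \<star> \<zero>\<^bsub>A\<^esub> = \<zero>\<^bsub>A\<^esub>"
  using alg_smult_right[of x "\<zero>\<^bsub>A\<^esub>" 0] by simp

lemma star_zero [simp]: "adj \<zero>\<^bsub>A\<^esub> = \<zero>\<^bsub>A\<^esub>"
  using star_smult[of "\<zero>\<^bsub>A\<^esub>" 0] by simp

lemma star_sub: "x \<in> carrier A \<Longrightarrow> y \<in> carrier A \<Longrightarrow> adj (x \<boxminus> y) = adj x \<boxminus> adj y"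
  by (simp add: sub_eq star_add star_smult)

lemma mul_sub_left: "x \<in> carrier A \<Longrightarrow> y \<in> carrier A \<Longrightarrow> z \<in> carrier A \<Longrightarrow> (x \<boxminus> y) \<star> z = x \<star> z \<boxminus> y \<star> z"
  by (simp add: sub_eq alg_distr_left alg_smult_left)

lemma mul_sub_right: "x \<in> carrier A \<Longrightarrow> y \<in> carrier A \<Longrightarrow> z \<in> carrier A \<Longrightarrow> z \<star> (x \<boxminus> y) = z \<star> x \<boxminus> z \<star> y"
  by (simp add: sub_eq alg_distr_right alg_smult_right)

lemma star_mul_self_eq_0: "x \<in> carrier A \<Longrightarrow> adj x \<star> x = \<zero>\<^bsub>A\<^esub> \<Longrightarrow> x = \<zero>\<^bsub>A\<^esub>"
  using cstar_identity[of x] nrm_eq_0[of x] by simp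

lemma nrm_star [simp]: "x \<in> carrier A \<Longrightarrow> nrm A (adj x) = nrm A x"
proof -
  have le: "nrm A x \<le> nrm A (adj x)" if x: "x \<in> carrier A" for x
  proof (cases "nrm A x = 0")
    case False
    then have pos: "nrm A x > 0" using nrm_nonneg[OF x] by simp
    have "nrm A x * nrm A x \<le> nrm A (adj x) * nrm A x"
      using cstar_identity[OF x] nrm_mult[of "adj x" x] x by (simp add: power2_eq_square)
    then show ?thesis using pos by simp
  qed (use x in \<open>simp add: nrm_nonneg\<close>)
  assume "x \<in> carrier A"
  then show ?thesis using le[of x] le[of "adj x"] by (simp add: star_star)
qed

text \<open>
  Pairing with \<open>adj u \<star> y\<close> is nondegenerate by the C*-identity, applied to \<open>y = u \<boxminus> v\<close>. This
  makes \<open>A\<close> behave like an inner product space with values in itself.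
\<close>

lemma star_mul_cancel:
  assumes "u \<in> carrier A" "v \<in> carrier A" "\<And>y. y \<in> carrier A \<Longrightarrow> adj u \<star> y = adj v \<star> y"
  shows "u = v"
proof -
  have "adj (u \<boxminus> v) \<star> (u \<boxminus> v) = \<zero>\<^bsub>A\<^esub>"
    using assms by (simp add: star_sub mul_sub_left sub_eq_0_iff)
  then show ?thesis using star_mul_self_eq_0[of "u \<boxminus> v"] assms sub_eq_0_iff by simp
qed

text \<open>
  Self-adjointness for the \<open>A\<close>-valued inner product \<open>adj x \<star> y\<close>. Working with operators on \<open>A\<close>
  instead of elements of \<open>A\<close> makes the identity operator available even if \<open>A\<close> has no unit. Linearity follows from the nondegeneracy of the inner product.
\<close>

definition op_sa :: "('a \<Rightarrow> 'a) \<Rightarrow> bool" where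
  "op_sa T \<longleftrightarrow> (\<forall>x\<in>carrier A. T x \<in> carrier A) \<and>
     (\<forall>x\<in>carrier A. \<forall>y\<in>carrier A. adj (T x) \<star> y = adj x \<star> T y)"

definition op_contr :: "('a \<Rightarrow> 'a) \<Rightarrow> bool" where
  "op_contr T \<longleftrightarrow> (\<forall>x\<in>carrier A. nrm A (T x) \<le> nrm A x)"

lemma op_sa_in: "op_sa T \<Longrightarrow> x \<in> carrier A \<Longrightarrow> T x \<in> carrier A" by (simp add: op_sa_def)

lemma op_sa_swap: "op_sa T \<Longrightarrow> x \<in> carrier A \<Longrightarrow> y \<in> carrier A \<Longrightarrow> adj (T x) \<star> y = adj x \<star> T y"
  by (simp add: op_sa_def)

text \<open>
  Additivity and homogeneity come from moving the operator to the other side of the inner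
  product, where it no longer meets the sum.
\<close>

lemma op_sa_add:
  assumes "op_sa T" "x \<in> carrier A" "y \<in> carrier A" shows "T (x \<boxplus> y) = T x \<boxplus> T y"
  by (rule star_mul_cancel) (use assms in \<open>auto simp: op_sa_in op_sa_swap star_add alg_distr_left\<close>)

lemma op_sa_smult:
  assumes "op_sa T" "x \<in> carrier A" shows "T (c \<cdot> x) = c \<cdot> T x"
  by (rule star_mul_cancel) (use assms in \<open>auto simp: op_sa_in op_sa_swap star_smult alg_smult_left\<close>)

lemma op_sa_sub:
  assumes "op_sa T" "x \<in> carrier A" "y \<in> carrier A" shows "T (x \<boxminus> y) = T x \<boxminus> T y"
  using assms by (simp add: sub_eq op_sa_add op_sa_smult op_sa_in)

lemma op_sa_comp:
  assumes "op_sa S" "op_sa T" "\<And>x. x \<in> carrier A \<Longrightarrow> S (T x) = T (S x)" shows "op_sa (\<lambda>x. S (T x))"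
  using assms by (auto simp: op_sa_def)

lemma op_sa_lincomb:
  assumes "op_sa S" "op_sa T" shows "op_sa (\<lambda>x. complex_of_real a \<cdot> S x \<boxplus> complex_of_real b \<cdot> T x)"
  using assms by (auto simp: op_sa_def star_add star_smult alg_distr_left alg_distr_right alg_smult_left alg_smult_right)

lemma op_sa_id: "op_sa (\<lambda>x. x)" by (simp add: op_sa_def)

lemma op_sa_minus: assumes "op_sa S" "op_sa T" shows "op_sa (\<lambda>x. S x \<boxminus> T x)"
  using assms by (auto simp: op_sa_def star_sub mul_sub_left mul_sub_right)

lemma op_sa_scale: assumes "op_sa T" shows "op_sa (\<lambda>x. complex_of_real a \<cdot> T x)"
  using assms by (auto simp: op_sa_def star_smult alg_smult_left alg_smult_right)

lemma op_sa_mul_left: assumes "a \<in> carrier A" "adj a = a" shows "op_sa (\<lambda>x. a \<star> x)"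
  using assms by (auto simp: op_sa_def star_mult alg_mult_assoc)
end

section \<open>Square roots of self-adjoint operators\<close>

text \<open>
  The iteration \<open>q \<mapsto> (z + q\<^sup>2) / 2\<close> started at zero converges to \<open>1 - sqrt (1 - z)\<close>. Its iterates are polynomials
  in \<open>z\<close> with nonnegative coefficients, so for a contraction \<open>z\<close> all norms are dominated by the values at \<open>z = 1\<close>,
  which form this sequence.
\<close>

primrec sq_majorant :: "nat \<Rightarrow> real" where
  "sq_majorant 0 = 0"
| "sq_majorant (Suc n) = (1 + (sq_majorant n)\<^sup>2) / 2"

lemma sq_majorant_bounds: "0 \<le> sq_majorant n \<and> sq_majorant n \<le> 1"
  by (induction n) (auto simp: power_le_one)

lemma sq_majorant_Cauchy: "Cauchy sq_majorant"
proof -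
  have "sq_majorant n \<le> sq_majorant (Suc n)" for n
    using zero_le_power2[of "sq_majorant n - 1"] by (simp add: power2_eq_square algebra_simps)
  then have "incseq sq_majorant" by (rule incseq_SucI)
  from incseq_convergent[OF this, of 1] sq_majorant_bounds obtain L where "sq_majorant \<longlonglongrightarrow> L" by blast
  then show ?thesis by (rule LIMSEQ_imp_Cauchy)
qed

context cstar_algebra begin
primrec sq_iter :: "('a \<Rightarrow> 'a) \<Rightarrow> nat \<Rightarrow> 'a \<Rightarrow> 'a" where
  "sq_iter z 0 = (\<lambda>x. \<zero>\<^bsub>A\<^esub>)"
| "sq_iter z (Suc n) = (\<lambda>x. (1/2) \<cdot> z x \<boxplus> (1/2) \<cdot> sq_iter z n (sq_iter z n x))"

lemma op_sa_sq_iter: assumes "op_sa z" shows "op_sa (sq_iter z n)"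
proof (induction n)
  case (Suc n)
  then show ?case
    using op_sa_lincomb[OF assms op_sa_comp[OF Suc Suc], of "1/2" "1/2"] by simp
qed (simp add: op_sa_def)

lemma nrm_sq_iter:
  assumes "op_sa z" "op_contr z" "x \<in> carrier A"
  shows "nrm A (sq_iter z n x) \<le> sq_majorant n * nrm A x"
  using assms(3)
proof (induction n arbitrary: x)
  case (Suc n)
  let ?Q = "sq_iter z n"
  have Q: "?Q y \<in> carrier A" if "y \<in> carrier A" for y using that op_sa_sq_iter[OF assms(1)] op_sa_in by blast
  have z: "z x \<in> carrier A" using Suc.prems assms(1) op_sa_in by blast
  have "nrm A (?Q (?Q x)) \<le> sq_majorant n * nrm A (?Q x)" using Suc Q by blast
  also have "\<dots> \<le> sq_majorant n * (sq_majorant n * nrm A x)"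
    using Suc sq_majorant_bounds by (intro mult_left_mono) auto
  finally have 1: "nrm A (?Q (?Q x)) \<le> (sq_majorant n)\<^sup>2 * nrm A x" by (simp add: power2_eq_square)
  have 2: "nrm A (z x) \<le> nrm A x" using assms Suc.prems by (simp add: op_contr_def)
  have "nrm A (sq_iter z (Suc n) x) \<le> (1/2) * nrm A (z x) + (1/2) * nrm A (?Q (?Q x))"
    using nrm_triangle[of "(1/2) \<cdot> z x" "(1/2) \<cdot> ?Q (?Q x)"] z Q Suc.prems by (simp add: nrm_smult)
  also have "\<dots> \<le> (1/2) * nrm A x + (1/2) * ((sq_majorant n)\<^sup>2 * nrm A x)" using 1 2 by simp
  finally show ?case by (simp add: algebra_simps add_divide_distrib)
qed simp

lemma sq_iter_commute:
  assumes "op_sa z" "op_sa R" "\<And>x. x \<in> carrier A \<Longrightarrow> R (z x) = z (R x)" "x \<in> carrier A"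
  shows "R (sq_iter z n x) = sq_iter z n (R x)"
  using assms(4)
proof (induction n arbitrary: x)
  case 0
  then show ?case using op_sa_smult[OF assms(2), of "\<zero>\<^bsub>A\<^esub>" 0] op_sa_in[OF assms(2), of "\<zero>\<^bsub>A\<^esub>"] by simp
next
  case (Suc n)
  have Q: "sq_iter z n y \<in> carrier A" if "y \<in> carrier A" for y using that op_sa_sq_iter[OF assms(1)] op_sa_in by blast
  have z: "z x \<in> carrier A" using Suc.prems assms(1) op_sa_in by blast
  show ?case using Suc Q z assms(2,3) by (simp add: op_sa_add op_sa_smult)
qed

text \<open>
  Consecutive differences are polynomials with nonnegative coefficients as well, so the
  majorant controls them too: write \<open>P\<^sup>2 - Q\<^sup>2\<close> as \<open>P (P - Q) + (P - Q) Q\<close>.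
\<close>

lemma sq_iter_step:
  assumes "op_sa z" "op_contr z" "x \<in> carrier A"
  shows "nrm A (sq_iter z (Suc n) x \<boxminus> sq_iter z n x) \<le> (sq_majorant (Suc n) - sq_majorant n) * nrm A x"
  using assms(3)
proof (induction n arbitrary: x)
  case 0
  then show ?case using assms nrm_sq_iter[OF assms(1,2), of x "Suc 0"] op_sa_in[OF op_sa_sq_iter[OF assms(1)], of x "Suc 0"]
    by (simp add: sub_eq)
next
  case (Suc n)
  let ?P = "sq_iter z (Suc n)" and ?Q = "sq_iter z n" and ?r = "sq_majorant (Suc n)" and ?s = "sq_majorant n"
  have Q: "?Q y \<in> carrier A" if "y \<in> carrier A" for y using that op_sa_sq_iter[OF assms(1)] op_sa_in by blast
  have P: "?P y \<in> carrier A" if "y \<in> carrier A" for y using that op_sa_sq_iter[OF assms(1)] op_sa_in by blast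
  have z: "z x \<in> carrier A" using Suc.prems assms(1) op_sa_in by blast
  note x = Suc.prems
  have rs: "0 \<le> ?s" "0 \<le> ?r" using sq_majorant_bounds by blast+
  have srd: "0 \<le> ?r - ?s"
    using zero_le_power2[of "?s - 1"] by (simp add: power2_eq_square algebra_simps)
  have gen: "((1/2) \<cdot> a \<boxplus> (1/2) \<cdot> b) \<boxminus> ((1/2) \<cdot> a \<boxplus> (1/2) \<cdot> c) = (1/2) \<cdot> ((b \<boxminus> d) \<boxplus> (d \<boxminus> c))"
    if "a \<in> carrier A" "b \<in> carrier A" "c \<in> carrier A" "d \<in> carrier A" for a b c d
    using that by (simp add: add_sub_add_left sub_add_sub smult_sub)
  have "sq_iter z (Suc (Suc n)) x \<boxminus> ?P x = ((1/2) \<cdot> z x \<boxplus> (1/2) \<cdot> ?P (?P x)) \<boxminus> ((1/2) \<cdot> z x \<boxplus> (1/2) \<cdot> ?Q (?Q x))"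
    by simp
  also have "\<dots> = (1/2) \<cdot> ((?P (?P x) \<boxminus> ?P (?Q x)) \<boxplus> (?P (?Q x) \<boxminus> ?Q (?Q x)))"
    using x P Q z by (intro gen) blast+
  also have "?P (?P x) \<boxminus> ?P (?Q x) = ?P (?P x \<boxminus> ?Q x)"
    using op_sa_sub[OF op_sa_sq_iter[OF assms(1)]] P Q x by metis
  finally have eq: "sq_iter z (Suc (Suc n)) x \<boxminus> ?P x = (1/2) \<cdot> (?P (?P x \<boxminus> ?Q x) \<boxplus> (?P (?Q x) \<boxminus> ?Q (?Q x)))" .
  have IH: "nrm A (?P y \<boxminus> ?Q y) \<le> (?r - ?s) * nrm A y" if "y \<in> carrier A" for y using Suc.IH that by blast
  have c: "?P x \<boxminus> ?Q x \<in> carrier A" using P Q x by (intro sub_in)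
  have "nrm A (?P (?P x \<boxminus> ?Q x)) \<le> ?r * nrm A (?P x \<boxminus> ?Q x)" by (rule nrm_sq_iter[OF assms(1,2) c])
  also have "\<dots> \<le> ?r * ((?r - ?s) * nrm A x)" using IH[OF x] rs by (intro mult_left_mono)
  finally have 1: "nrm A (?P (?P x \<boxminus> ?Q x)) \<le> ?r * ((?r - ?s) * nrm A x)" .
  have "nrm A (?P (?Q x) \<boxminus> ?Q (?Q x)) \<le> (?r - ?s) * nrm A (?Q x)" by (rule IH[OF Q[OF x]])
  also have "\<dots> \<le> (?r - ?s) * (?s * nrm A x)" using nrm_sq_iter[OF assms(1,2) x] srd by (intro mult_left_mono)
  finally have 2: "nrm A (?P (?Q x) \<boxminus> ?Q (?Q x)) \<le> (?r - ?s) * (?s * nrm A x)" .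
  have "nrm A (?P (?P x \<boxminus> ?Q x) \<boxplus> (?P (?Q x) \<boxminus> ?Q (?Q x))) \<le> nrm A (?P (?P x \<boxminus> ?Q x)) + nrm A (?P (?Q x) \<boxminus> ?Q (?Q x))"
    by (rule nrm_triangle[OF P[OF c] sub_in[OF P[OF Q[OF x]] Q[OF Q[OF x]]]])
  then have "nrm A (sq_iter z (Suc (Suc n)) x \<boxminus> ?P x) \<le> (1/2) * (?r * ((?r - ?s) * nrm A x) + (?r - ?s) * (?s * nrm A x))"
    unfolding eq using 1 2 P[OF c] sub_in[OF P[OF Q[OF x]] Q[OF Q[OF x]]]
    by (subst nrm_smult) (blast intro: M.add.m_closed, simp del: sq_iter.simps sq_majorant.simps)
  also have "\<dots> = ((1 + ?r\<^sup>2)/2 - (1 + ?s\<^sup>2)/2) * nrm A x"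
    by (simp add: power2_eq_square algebra_simps add_divide_distrib diff_divide_distrib del: sq_majorant.simps)
  also have "\<dots> = (sq_majorant (Suc (Suc n)) - sq_majorant (Suc n)) * nrm A x" by simp
  finally show ?case .
qed

lemma sq_iter_diff:
  assumes "op_sa z" "op_contr z" "x \<in> carrier A" "m \<le> n"
  shows "nrm A (sq_iter z n x \<boxminus> sq_iter z m x) \<le> sq_majorant n * nrm A x - sq_majorant m * nrm A x"
  using assms(4)
proof (induction n rule: dec_induct)
  case base
  then show ?case using op_sa_in[OF op_sa_sq_iter[OF assms(1)] assms(3)] by (simp add: a_minus_def M.r_neg)
next
  case (step n)
  have Q: "sq_iter z n x \<in> carrier A" for n using assms(3) op_sa_sq_iter[OF assms(1)] op_sa_in by blast
  have "nrm A (sq_iter z (Suc n) x \<boxminus> sq_iter z m x) \<le> nrm A (sq_iter z (Suc n) x \<boxminus> sq_iter z n x) + nrm A (sq_iter z n x \<boxminus> sq_iter z m x)"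
    by (rule nrm_sub_triangle[OF Q Q Q])
  then show ?case using step.IH sq_iter_step[OF assms(1-3), of n] by (simp only: left_diff_distrib)
qed

lemma sq_iter_converges:
  assumes "op_sa z" "op_contr z" "x \<in> carrier A"
  shows "\<exists>l. vlim (\<lambda>n. sq_iter z n x) l"
proof (rule Cauchy_vlim)
  show "Cauchy (\<lambda>n. sq_majorant n * nrm A x)"
    using sq_majorant_Cauchy by (simp add: Cauchy_convergent_iff convergent_mult convergent_const)
  show "sq_iter z n x \<in> carrier A" for n using assms(3) op_sa_sq_iter[OF assms(1)] op_sa_in by blast
qed (rule sq_iter_diff[OF assms])

lemma vlim_adj_mul:
  assumes "vlim s l" "y \<in> carrier A" shows "vlim (\<lambda>n. adj (s n) \<star> y) (adj l \<star> y)"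
  by (rule vlim_bounded_map[OF assms(1), where K = "nrm A y"])
     (use assms(2) nrm_mult[OF star_closed] in \<open>auto simp: star_sub mul_sub_left mult.commute\<close>)

lemma vlim_mul_left:
  assumes "vlim s l" "y \<in> carrier A" shows "vlim (\<lambda>n. y \<star> s n) (y \<star> l)"
  by (rule vlim_bounded_map[OF assms(1), where K = "nrm A y"])
     (use assms(2) nrm_mult[of y] in \<open>auto simp: mul_sub_right\<close>)

text \<open>
  The limit \<open>q = 1 - sqrt (1 - z)\<close> of the iteration. It commutes with every self-adjoint \<open>R\<close> that commutes
  with \<open>z\<close>, because the iterates do; as \<open>R\<close> need not be continuous a priori, the limit is taken after \<open>R\<close> has been
  moved to the other side of the inner product.
\<close>

lemma op_half_square:
  assumes z: "op_sa z" "op_contr z"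
  obtains q where "op_sa q" "op_contr q"
    "\<And>x. x \<in> carrier A \<Longrightarrow> q x = (1/2) \<cdot> z x \<boxplus> (1/2) \<cdot> q (q x)"
    "\<And>R x. op_sa R \<Longrightarrow> (\<And>y. y \<in> carrier A \<Longrightarrow> R (z y) = z (R y)) \<Longrightarrow> x \<in> carrier A \<Longrightarrow> R (q x) = q (R x)"
proof -
  define q where "q x = (SOME l. vlim (\<lambda>n. sq_iter z n x) l)" for x
  let ?Q = "sq_iter z"
  have Qin: "?Q n x \<in> carrier A" if "x \<in> carrier A" for n x using that op_sa_sq_iter[OF assms(1)] op_sa_in by blast
  have lim: "vlim (\<lambda>n. ?Q n x) (q x)" if "x \<in> carrier A" for x
    unfolding q_def by (rule someI_ex[OF sq_iter_converges[OF z that]])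
  have qin: "q x \<in> carrier A" if "x \<in> carrier A" for x using lim[OF that] by (simp add: vlim_def)
  have contr: "nrm A (?Q n x) \<le> nrm A x" if "x \<in> carrier A" for n x
    using nrm_sq_iter[OF z that, of n] mult_right_mono[OF conjunct2[OF sq_majorant_bounds[of n]], of "nrm A x"] nrm_nonneg[OF that] by simp
  have sa: "adj (q x) \<star> y = adj x \<star> q y" if "x \<in> carrier A" "y \<in> carrier A" for x y
  proof (rule vlim_unique)
    show "vlim (\<lambda>n. adj (?Q n x) \<star> y) (adj (q x) \<star> y)" by (rule vlim_adj_mul[OF lim]) fact+
    show "vlim (\<lambda>n. adj (?Q n x) \<star> y) (adj x \<star> q y)"
      unfolding op_sa_swap[OF op_sa_sq_iter[OF z(1)] that] using that by (intro vlim_mul_left lim) auto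
  qed
  have "op_sa q" using qin sa by (simp add: op_sa_def)
  moreover have "op_contr q" unfolding op_contr_def
  proof
    fix x assume x: "x \<in> carrier A"
    show "nrm A (q x) \<le> nrm A x"
      by (rule LIMSEQ_le_const2[OF vlim_nrm[OF lim[OF x]]]) (use contr[OF x] in blast)
  qed
  moreover have "q x = (1/2) \<cdot> z x \<boxplus> (1/2) \<cdot> q (q x)" if x: "x \<in> carrier A" for x
  proof (rule vlim_unique)
    show "vlim (\<lambda>n. ?Q (Suc n) x) (q x)" by (rule vlim_Suc[OF lim[OF x]])
    have "vlim (\<lambda>n. ?Q n (?Q n x)) (q (q x))"
    proof -
      have b: "nrm A (?Q n (?Q n x) \<boxminus> q (q x)) \<le> nrm A (?Q n x \<boxminus> q x) + nrm A (?Q n (q x) \<boxminus> q (q x))" for n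
      proof -
        have "nrm A (?Q n (?Q n x) \<boxminus> q (q x)) \<le> nrm A (?Q n (?Q n x) \<boxminus> ?Q n (q x)) + nrm A (?Q n (q x) \<boxminus> q (q x))"
          using Qin qin x by (intro nrm_sub_triangle) auto
        also have "?Q n (?Q n x) \<boxminus> ?Q n (q x) = ?Q n (?Q n x \<boxminus> q x)"
          using op_sa_sub[OF op_sa_sq_iter[OF z(1)]] Qin qin x by metis
        finally show ?thesis using contr[of "?Q n x \<boxminus> q x" n] Qin qin x by (smt (verit) sub_in)
      qed
      have "(\<lambda>n. nrm A (?Q n (?Q n x) \<boxminus> q (q x))) \<longlonglongrightarrow> 0"
      proof (rule null_comparison)
        show "\<bar>nrm A (?Q n (?Q n x) \<boxminus> q (q x))\<bar> \<le> nrm A (?Q n x \<boxminus> q x) + nrm A (?Q n (q x) \<boxminus> q (q x))" for n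
          using b[of n] nrm_nonneg[OF sub_in[OF Qin[OF Qin[OF x]] qin[OF qin[OF x]]], of n n] by simp
        have "(\<lambda>n. nrm A (?Q n x \<boxminus> q x)) \<longlonglongrightarrow> 0" "(\<lambda>n. nrm A (?Q n (q x) \<boxminus> q (q x))) \<longlonglongrightarrow> 0"
          using lim[OF x] lim[OF qin[OF x]] by (simp_all add: vlim_def)
        from tendsto_add[OF this]
        show "(\<lambda>n. nrm A (?Q n x \<boxminus> q x) + nrm A (?Q n (q x) \<boxminus> q (q x))) \<longlonglongrightarrow> 0" by simp
      qed
      then show ?thesis using Qin qin x by (simp add: vlim_def)
    qed
    then have "vlim (\<lambda>n. (1/2) \<cdot> z x \<boxplus> (1/2) \<cdot> ?Q n (?Q n x)) ((1/2) \<cdot> z x \<boxplus> (1/2) \<cdot> q (q x))"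
      by (intro vlim_add vlim_smult vlim_const op_sa_in[OF z(1) x])
    then show "vlim (\<lambda>n. ?Q (Suc n) x) ((1/2) \<cdot> z x \<boxplus> (1/2) \<cdot> q (q x))" by simp
  qed
  moreover have "R (q x) = q (R x)"
    if R: "op_sa R" "\<And>y. y \<in> carrier A \<Longrightarrow> R (z y) = z (R y)" and x: "x \<in> carrier A" for R x
  proof (rule star_mul_cancel)
    have Rin: "R y \<in> carrier A" if "y \<in> carrier A" for y using that R op_sa_in by blast
    show "R (q x) \<in> carrier A" "q (R x) \<in> carrier A" using Rin qin x by auto
    fix y assume y: "y \<in> carrier A"
    show "adj (R (q x)) \<star> y = adj (q (R x)) \<star> y"
    proof (rule vlim_unique)
      show "vlim (\<lambda>n. adj (?Q n (R x)) \<star> y) (adj (q (R x)) \<star> y)" by (intro vlim_adj_mul lim Rin x y)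
      have "vlim (\<lambda>n. adj (?Q n x) \<star> R y) (adj (q x) \<star> R y)" by (intro vlim_adj_mul lim Rin x y)
      moreover have "adj (?Q n (R x)) \<star> y = adj (?Q n x) \<star> R y" for n
        using sq_iter_commute[OF z(1) R x, of n] op_sa_swap[OF R(1) Qin[OF x] y, of n] by simp
      moreover have "adj (R (q x)) \<star> y = adj (q x) \<star> R y" by (rule op_sa_swap[OF R(1) qin[OF x] y])
      ultimately show "vlim (\<lambda>n. adj (?Q n (R x)) \<star> y) (adj (R (q x)) \<star> y)" by simp
    qed
  qed
  ultimately show ?thesis by (rule that)
qed

text \<open>
  The square root \<open>s\<close> of \<open>1 - z\<close>. That \<open>1 - s\<close> is again a contraction allows a second square root to be taken,
  of \<open>s\<close> itself.
\<close>

lemma op_sqrt: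
  assumes z: "op_sa z" "op_contr z"
  obtains s where "op_sa s" "op_contr (\<lambda>x. x \<boxminus> s x)"
    "\<And>x. x \<in> carrier A \<Longrightarrow> s (s x) = x \<boxminus> z x"
    "\<And>R x. op_sa R \<Longrightarrow> (\<And>y. y \<in> carrier A \<Longrightarrow> R (z y) = z (R y)) \<Longrightarrow> x \<in> carrier A \<Longrightarrow> R (s x) = s (R x)"
proof -
  from op_half_square[OF z] obtain q where q: "op_sa q" "op_contr q"
    "\<And>x. x \<in> carrier A \<Longrightarrow> q x = (1/2) \<cdot> z x \<boxplus> (1/2) \<cdot> q (q x)"
    "\<And>R x. op_sa R \<Longrightarrow> (\<And>y. y \<in> carrier A \<Longrightarrow> R (z y) = z (R y)) \<Longrightarrow> x \<in> carrier A \<Longrightarrow> R (q x) = q (R x)"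
    by blast
  let ?s = "\<lambda>x. x \<boxminus> q x"
  have qin: "q x \<in> carrier A" and zin: "z x \<in> carrier A" if "x \<in> carrier A" for x using that q(1) z(1) op_sa_in by blast+
  have 1: "op_sa ?s" using op_sa_minus[OF op_sa_id q(1)] .
  have i: "x \<boxminus> (x \<boxminus> y) = y" if "x \<in> carrier A" "y \<in> carrier A" for x y
    using that by (simp add: a_minus_def M.minus_add M.r_neg2)
  have 2: "op_contr (\<lambda>x. x \<boxminus> ?s x)" using q(2) qin by (simp add: op_contr_def i)
  have 3: "?s (?s x) = x \<boxminus> z x" if x: "x \<in> carrier A" for x
  proof -
    have e: "q x \<boxplus> q x = z x \<boxplus> q (q x)"
    proof -
      have "q x \<boxplus> q x = 2 \<cdot> q x" using smult_add_left[of "q x" 1 1] qin[OF x] by simp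
      also have "\<dots> = 2 \<cdot> ((1/2) \<cdot> z x \<boxplus> (1/2) \<cdot> q (q x))" using q(3)[OF x] by simp
      also have "\<dots> = z x \<boxplus> q (q x)" using zin qin x by (simp add: smult_add_right smult_smult)
      finally show ?thesis .
    qed
    have "?s (?s x) = (x \<boxminus> q x) \<boxminus> (q x \<boxminus> q (q x))" using op_sa_sub[OF q(1) x qin[OF x]] by simp
    also have "\<dots> = (x \<boxplus> q (q x)) \<boxminus> (q x \<boxplus> q x)"
      using x qin by (simp add: a_minus_def M.minus_add M.a_ac)
    also have "\<dots> = x \<boxminus> z x" unfolding e using x qin zin by (simp add: add_sub_add_right)
    finally show ?thesis .
  qed
  have 4: "R (?s x) = ?s (R x)" if R: "op_sa R" "\<And>y. y \<in> carrier A \<Longrightarrow> R (z y) = z (R y)" and x: "x \<in> carrier A" for R x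
    using op_sa_sub[OF R(1) x qin[OF x]] q(4)[OF R x] by simp
  show ?thesis by (rule that[OF 1 2 3 4])
qed

text \<open>
  The operators \<open>T \<plusminus> i K\<close> are \<open>c\<close> times an isometry, because the mixed terms cancel, and \<open>T\<close> is their mean.
\<close>

lemma op_pythagoras:
  assumes T: "op_sa T" and K: "op_sa K" and comm: "\<And>x. x \<in> carrier A \<Longrightarrow> T (K x) = K (T x)"
    and c: "c \<ge> 0" and sum: "\<And>x. x \<in> carrier A \<Longrightarrow> T (T x) \<boxplus> K (K x) = complex_of_real (c\<^sup>2) \<cdot> x"
    and x: "x \<in> carrier A"
  shows "nrm A (T x) \<le> c * nrm A x"
proof -
  have Tin: "T y \<in> carrier A" and Kin: "K y \<in> carrier A" if "y \<in> carrier A" for y using that T K op_sa_in by blast+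
  have n: "nrm A (T x \<boxplus> \<sigma> \<cdot> K x) = c * nrm A x" if s: "\<sigma> = \<i> \<or> \<sigma> = - \<i>" for \<sigma>
  proof -
    let ?N = "T x \<boxplus> \<sigma> \<cdot> K x" and ?m = "adj x \<star> T (K x)"
    have sig: "cnj \<sigma> = - \<sigma>" "\<sigma> * \<sigma> = - 1" using s by auto
    have m: "?m \<in> carrier A" using Tin Kin x by simp
    have "adj ?N \<star> ?N = (adj x \<star> T (T x) \<boxplus> \<sigma> \<cdot> ?m) \<boxplus> ((- \<sigma>) \<cdot> ?m \<boxplus> adj x \<star> K (K x))"
    proof -
      have "adj ?N \<star> ?N = (adj (T x) \<star> T x \<boxplus> \<sigma> \<cdot> (adj (T x) \<star> K x)) \<boxplus> ((- \<sigma>) \<cdot> (adj (K x) \<star> T x) \<boxplus> adj (K x) \<star> K x)"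
        using x Tin Kin by (simp add: star_add star_smult sig alg_distr_left alg_distr_right alg_smult_left alg_smult_right smult_smult smult_add_right M.a_ac)
      then show ?thesis using x Tin Kin sig(2) by (simp add: op_sa_swap[OF T] op_sa_swap[OF K] comm)
    qed
    also have "\<dots> = adj x \<star> T (T x) \<boxplus> adj x \<star> K (K x)"
    proof -
      have z: "\<sigma> \<cdot> ?m \<boxplus> (- \<sigma>) \<cdot> ?m = \<zero>\<^bsub>A\<^esub>" using smult_add_left[OF m, of \<sigma> "- \<sigma>"] m by simp
      have "(adj x \<star> T (T x) \<boxplus> \<sigma> \<cdot> ?m) \<boxplus> ((- \<sigma>) \<cdot> ?m \<boxplus> adj x \<star> K (K x)) = adj x \<star> T (T x) \<boxplus> ((\<sigma> \<cdot> ?m \<boxplus> (- \<sigma>) \<cdot> ?m) \<boxplus> adj x \<star> K (K x))"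
        using x Tin Kin m by (simp add: M.a_assoc)
      then show ?thesis using x Tin Kin by (simp add: z)
    qed
    also have "\<dots> = complex_of_real (c\<^sup>2) \<cdot> (adj x \<star> x)"
      using x Tin Kin by (simp add: sum alg_smult_right flip: alg_distr_right)
    finally have "(nrm A ?N)\<^sup>2 = c\<^sup>2 * (nrm A x)\<^sup>2"
      using cstar_identity[of ?N] cstar_identity[OF x] x Tin Kin by (simp add: nrm_smult norm_power)
    then have "(nrm A ?N)\<^sup>2 = (c * nrm A x)\<^sup>2" by (simp add: power_mult_distrib)
    moreover have "?N \<in> carrier A" using x Tin Kin by (intro M.add.m_closed smult_in) auto
    ultimately show ?thesis
      using c nrm_nonneg[OF x] nrm_nonneg[of ?N] by (meson power2_eq_imp_eq mult_nonneg_nonneg)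
  qed
  have "2 \<cdot> T x = (T x \<boxplus> \<i> \<cdot> K x) \<boxplus> (T x \<boxplus> (- \<i>) \<cdot> K x)"
  proof -
    have "(T x \<boxplus> \<i> \<cdot> K x) \<boxplus> (T x \<boxplus> (- \<i>) \<cdot> K x) = (T x \<boxplus> T x) \<boxplus> (\<i> \<cdot> K x \<boxplus> (- \<i>) \<cdot> K x)"
      using x Tin Kin by (simp add: M.a_assoc M.a_lcomm[of "\<i> \<cdot> K x" "T x"])
    then show ?thesis using x Tin Kin smult_add_left[of "T x" 1 1] smult_add_left[of "K x" \<i> "- \<i>"] by simp
  qed
  then have "2 * nrm A (T x) \<le> nrm A (T x \<boxplus> \<i> \<cdot> K x) + nrm A (T x \<boxplus> (- \<i>) \<cdot> K x)"
    using nrm_triangle[of "T x \<boxplus> \<i> \<cdot> K x" "T x \<boxplus> (- \<i>) \<cdot> K x"] x Tin Kin nrm_smult[of "T x" 2] by simp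
  also have "\<dots> = 2 * (c * nrm A x)" using n[of "\<i>"] n[of "- \<i>"] by simp
  finally show ?thesis by simp
qed

text \<open>
  If \<open>s\<^sup>2 = 1 - T\<^sup>2\<close>, then \<open>op_pythagoras\<close>, with \<open>s\<close> in the place of \<open>T\<close> and \<open>T\<close> in that of \<open>K\<close>, shows that \<open>s\<close> is a
  contraction.
\<close>

lemma op_contr_one_minus_square:
  assumes T: "op_sa T" "op_contr T" shows "op_contr (\<lambda>x. x \<boxminus> T (T x))"
proof -
  have Tin: "T y \<in> carrier A" if "y \<in> carrier A" for y using that T op_sa_in by blast
  have "op_sa (\<lambda>x. T (T x))" by (rule op_sa_comp[OF T(1) T(1)]) simp
  moreover have "op_contr (\<lambda>x. T (T x))" using T(2) Tin unfolding op_contr_def by (meson order_trans)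
  ultimately obtain s where s: "op_sa s" "\<And>x. x \<in> carrier A \<Longrightarrow> s (s x) = x \<boxminus> T (T x)"
    and sc: "\<And>R x. op_sa R \<Longrightarrow> (\<And>y. y \<in> carrier A \<Longrightarrow> R (T (T y)) = T (T (R y))) \<Longrightarrow> x \<in> carrier A \<Longrightarrow> R (s x) = s (R x)"
    by (rule op_sqrt) blast
  have sin: "s y \<in> carrier A" if "y \<in> carrier A" for y using that s op_sa_in by blast
  have "nrm A (s x) \<le> 1 * nrm A x" if x: "x \<in> carrier A" for x
  proof (rule op_pythagoras[OF s(1) T(1)])
    show "s (T x) = T (s x)" if "x \<in> carrier A" for x using sc[OF T(1) _ that] by simp
    show "s (s x) \<boxplus> T (T x) = complex_of_real (1\<^sup>2) \<cdot> x" if "x \<in> carrier A" for x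
      using that Tin s(2)[OF that] by (simp add: a_minus_def M.a_assoc M.l_neg)
  qed (use x in auto)
  then have "nrm A (s (s x)) \<le> nrm A x" if "x \<in> carrier A" for x using that sin by (smt (verit) mult_1)
  then show ?thesis using s(2) by (simp add: op_contr_def)
qed
end

section \<open>Positive functionals and the norm\<close>

context cstar_algebra begin
definition pos_fun :: "('a \<Rightarrow> real) \<Rightarrow> bool" where
  "pos_fun f \<longleftrightarrow> (\<forall>x\<in>carrier A. \<forall>y\<in>carrier A. f (x \<boxplus> y) = f x + f y) \<and>
     (\<forall>x\<in>carrier A. \<forall>c. f (complex_of_real c \<cdot> x) = c * f x) \<and>
     (\<forall>x\<in>carrier A. 0 \<le> f (adj x \<star> x))"

lemma pos_fun_add: "pos_fun f \<Longrightarrow> x \<in> carrier A \<Longrightarrow> y \<in> carrier A \<Longrightarrow> f (x \<boxplus> y) = f x + f y"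
  by (simp add: pos_fun_def)

lemma pos_fun_smult: "pos_fun f \<Longrightarrow> x \<in> carrier A \<Longrightarrow> f (complex_of_real c \<cdot> x) = c * f x"
  by (simp add: pos_fun_def)

lemma pos_fun_pos: "pos_fun f \<Longrightarrow> x \<in> carrier A \<Longrightarrow> 0 \<le> f (adj x \<star> x)"
  by (simp add: pos_fun_def)

lemma pos_fun_sub: "pos_fun f \<Longrightarrow> x \<in> carrier A \<Longrightarrow> y \<in> carrier A \<Longrightarrow> f (x \<boxminus> y) = f x - f y"
  using pos_fun_add[of f x "(-1) \<cdot> y"] pos_fun_smult[of f y "-1"] by (simp add: sub_eq)

text \<open>
  The difference of both sides is the value of \<open>f\<close> at \<open>adj (s x) \<star> s x\<close>, where \<open>s\<^sup>2 = 1 - a\<^sup>2\<close>.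
\<close>

lemma pos_fun_contr:
  assumes f: "pos_fun f" and a: "a \<in> carrier A" "adj a = a" "nrm A a \<le> 1" and x: "x \<in> carrier A"
  shows "f (adj (a \<star> x) \<star> (a \<star> x)) \<le> f (adj x \<star> x)"
proof -
  let ?T = "\<lambda>x. a \<star> x"
  have T: "op_sa ?T" by (rule op_sa_mul_left[OF a(1,2)])
  have Tc: "nrm A (?T y) \<le> nrm A y" if "y \<in> carrier A" for y
    using nrm_mult[OF a(1) that] mult_right_mono[OF a(3) nrm_nonneg[OF that]] by simp
  have "op_sa (\<lambda>x. ?T (?T x))" by (rule op_sa_comp[OF T T]) simp
  moreover have "op_contr (\<lambda>x. ?T (?T x))" unfolding op_contr_def
    using Tc a by (meson alg_mult_closed order_trans)
  ultimately obtain s where s: "op_sa s" "\<And>x. x \<in> carrier A \<Longrightarrow> s (s x) = x \<boxminus> ?T (?T x)"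
    by (rule op_sqrt) blast
  have sx: "s x \<in> carrier A" by (rule op_sa_in[OF s(1) x])
  have "adj (s x) \<star> s x = adj x \<star> x \<boxminus> adj (?T x) \<star> ?T x"
    using x a by (simp add: op_sa_swap[OF s(1)] op_sa_swap[OF T] sx s(2) mul_sub_right)
  then have "f (adj (s x) \<star> s x) = f (adj x \<star> x) - f (adj (?T x) \<star> ?T x)"
    using pos_fun_sub[OF f] x a by simp
  then show ?thesis using pos_fun_pos[OF f sx] by simp
qed

text \<open>
  A faithful family of positive functionals detects the order of \<open>A\<close>, hence the norm of a self-adjoint
  element. Put \<open>X = (s\<^sup>2 - a\<^sup>2) / 2\<close>, which is a contraction, and let \<open>H = sqrt (X\<^sup>2)\<close> be its absolute value and
  \<open>K = sqrt H\<close>. Twice the negative part of \<open>X\<close>, \<open>W = H - X\<close>, satisfies \<open>H W = - X W\<close>. The hypothesis says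
  that every \<open>f\<close> is nonnegative at \<open>adj w \<star> X w\<close>; for \<open>w = W z\<close> this value is \<open>- f (adj (K w) \<star> K w)\<close>, so \<open>K W\<close> vanishes,
  and then \<open>W\<^sup>2\<close> and \<open>W\<close> vanish. Therefore \<open>X = H = K\<^sup>2\<close>, which means \<open>a\<^sup>2 + 2 K\<^sup>2 = s\<^sup>2\<close>, and
  \<open>op_pythagoras\<close> bounds multiplication by \<open>a\<close>.
\<close>

lemma nrm_le_if_pos_fun_unit:
  assumes a: "a \<in> carrier A" "adj a = a" "nrm A a \<le> 1" and s: "0 \<le> s" "s \<le> 1"
    and F: "\<And>f. f \<in> F \<Longrightarrow> pos_fun f"
    and faithful: "\<And>z. z \<in> carrier A \<Longrightarrow> (\<And>f. f \<in> F \<Longrightarrow> f (adj z \<star> z) = 0) \<Longrightarrow> z = \<zero>\<^bsub>A\<^esub>"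
    and bound: "\<And>f z. f \<in> F \<Longrightarrow> z \<in> carrier A \<Longrightarrow> f (adj (a \<star> z) \<star> (a \<star> z)) \<le> s\<^sup>2 * f (adj z \<star> z)"
  shows "nrm A a \<le> s"
proof -
  define T where "T = (\<lambda>x. a \<star> x)"
  \<comment> \<open>the factor one half makes \<open>X\<close> a contraction\<close>
  define X where "X = (\<lambda>x. complex_of_real (s\<^sup>2/2) \<cdot> x \<boxplus> complex_of_real (-1/2) \<cdot> T (T x))"
  have T: "op_sa T" unfolding T_def by (rule op_sa_mul_left[OF a(1,2)])
  note Tin = op_sa_in[OF T]
  have TT: "op_sa (\<lambda>x. T (T x))" by (rule op_sa_comp[OF T T]) simp
  have X: "op_sa X" unfolding X_def by (rule op_sa_lincomb[OF op_sa_id TT])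
  note Xin = op_sa_in[OF X]
  have Tc: "nrm A (T y) \<le> nrm A y" if "y \<in> carrier A" for y
    using nrm_mult[OF a(1) that] mult_right_mono[OF a(3) nrm_nonneg[OF that]] by (simp add: T_def)
  have Xc: "op_contr X" unfolding op_contr_def
  proof
    fix y assume y: "y \<in> carrier A"
    have "nrm A (X y) \<le> s\<^sup>2/2 * nrm A y + 1/2 * nrm A (T (T y))"
      using nrm_triangle[of "complex_of_real (s\<^sup>2/2) \<cdot> y" "complex_of_real (-1/2) \<cdot> T (T y)"] y Tin
      by (simp add: X_def nrm_smult norm_divide norm_power del: of_real_divide of_real_minus)
    also have "\<dots> \<le> 1/2 * nrm A y + 1/2 * nrm A y"
      using Tc[OF y] Tc[OF Tin[OF y]] s nrm_nonneg[OF y] by (intro add_mono mult_right_mono) (auto simp: power_le_one)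
    finally show "nrm A (X y) \<le> nrm A y" by simp
  qed
  define Z where "Z = (\<lambda>x. x \<boxminus> X (X x))"
  have XX: "op_sa (\<lambda>x. X (X x))" by (rule op_sa_comp[OF X X]) simp
  have Z: "op_sa Z" unfolding Z_def by (rule op_sa_minus[OF op_sa_id XX])
  have Zc: "op_contr Z" unfolding Z_def by (rule op_contr_one_minus_square[OF X Xc])
  obtain H where H: "op_sa H" "op_contr (\<lambda>x. x \<boxminus> H x)" "\<And>x. x \<in> carrier A \<Longrightarrow> H (H x) = x \<boxminus> Z x"
    and Hcomm: "\<And>R x. op_sa R \<Longrightarrow> (\<And>y. y \<in> carrier A \<Longrightarrow> R (Z y) = Z (R y)) \<Longrightarrow> x \<in> carrier A \<Longrightarrow> R (H x) = H (R x)"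
    by (rule op_sqrt[OF Z Zc]) blast
  note Hin = op_sa_in[OF H(1)]
  have minus_minus: "x \<boxminus> (x \<boxminus> y) = y" if "x \<in> carrier A" "y \<in> carrier A" for x y
    using that by (simp add: a_minus_def M.minus_add M.r_neg2)
  have HH: "H (H x) = X (X x)" if "x \<in> carrier A" for x
    using H(3)[OF that] that by (simp add: Z_def minus_minus Xin)
  obtain K where K: "op_sa K" "\<And>x. x \<in> carrier A \<Longrightarrow> K (K x) = x \<boxminus> (x \<boxminus> H x)"
    and Kcomm: "\<And>R x. op_sa R \<Longrightarrow> (\<And>y. y \<in> carrier A \<Longrightarrow> R (y \<boxminus> H y) = R y \<boxminus> H (R y)) \<Longrightarrow> x \<in> carrier A \<Longrightarrow> R (K x) = K (R x)"
    by (rule op_sqrt[OF op_sa_minus[OF op_sa_id H(1)] H(2)]) blast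
  note Kin = op_sa_in[OF K(1)]
  have KK: "K (K x) = H x" if "x \<in> carrier A" for x
    using K(2)[OF that] that by (simp add: minus_minus Hin)
  have XZ: "X (Z y) = Z (X y)" if "y \<in> carrier A" for y
    using that by (simp add: Z_def op_sa_sub[OF X] Xin)
  have XH: "X (H x) = H (X x)" if "x \<in> carrier A" for x by (rule Hcomm[OF X XZ that])
  have TX: "T (X y) = X (T y)" if "y \<in> carrier A" for y
    using that by (simp add: X_def op_sa_add[OF T] op_sa_smult[OF T] Tin)
  have TH: "T (H x) = H (T x)" if "x \<in> carrier A" for x
    by (rule Hcomm[OF T _ that]) (simp add: Z_def op_sa_sub[OF T] TX Xin)
  have TK: "T (K x) = K (T x)" if "x \<in> carrier A" for x
    by (rule Kcomm[OF T _ that]) (simp add: op_sa_sub[OF T] TH Hin)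
  define W where "W = (\<lambda>x. H x \<boxminus> X x)"
  have W: "op_sa W" unfolding W_def by (rule op_sa_minus[OF H(1) X])
  note Win = op_sa_in[OF W]
  have HW: "H (W z) = (-1) \<cdot> X (W z)" if "z \<in> carrier A" for z
  proof -
    have 1: "H (W z) = X (X z) \<boxminus> H (X z)" using that by (simp add: W_def op_sa_sub[OF H(1)] HH Xin Hin)
    have 2: "X (W z) = H (X z) \<boxminus> X (X z)" using that by (simp add: W_def op_sa_sub[OF X] XH Xin Hin)
    show ?thesis unfolding 1 2 using that Xin Hin by (simp add: sub_eq smult_add_right smult_smult M.a_comm)
  qed
  have KW: "K (W z) = \<zero>\<^bsub>A\<^esub>" if z: "z \<in> carrier A" for z
  proof (rule faithful[OF Kin[OF Win[OF z]]])
    fix f assume f: "f \<in> F"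
    let ?w = "W z"
    have w: "?w \<in> carrier A" by (rule Win[OF z])
    have "adj ?w \<star> X ?w = complex_of_real (s\<^sup>2/2) \<cdot> (adj ?w \<star> ?w) \<boxplus> complex_of_real (-1/2) \<cdot> (adj (T ?w) \<star> T ?w)"
      unfolding op_sa_swap[OF T w Tin[OF w]]
      using w Tin by (simp add: X_def alg_distr_right alg_smult_right)
    then have "f (adj ?w \<star> X ?w) = s\<^sup>2/2 * f (adj ?w \<star> ?w) + (-1/2) * f (adj (T ?w) \<star> T ?w)"
      using w Tin by (simp add: pos_fun_add[OF F[OF f]] pos_fun_smult[OF F[OF f]] del: of_real_divide of_real_minus of_real_power)
    then have 1: "f (adj ?w \<star> X ?w) \<ge> 0" using bound[OF f w] by (simp add: T_def)
    have "adj (K ?w) \<star> K ?w = complex_of_real (-1) \<cdot> (adj ?w \<star> X ?w)"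
      unfolding op_sa_swap[OF K(1) w Kin[OF w]] KK[OF w] HW[OF z] using w Xin by (simp add: alg_smult_right)
    then have "f (adj (K ?w) \<star> K ?w) = - f (adj ?w \<star> X ?w)"
      using w Xin by (simp add: pos_fun_smult[OF F[OF f], of _ "-1", simplified])
    then show "f (adj (K ?w) \<star> K ?w) = 0" using 1 pos_fun_pos[OF F[OF f] Kin[OF w]] by simp
  qed
  have K0: "K \<zero>\<^bsub>A\<^esub> = \<zero>\<^bsub>A\<^esub>" using op_sa_smult[OF K(1), of "\<zero>\<^bsub>A\<^esub>" 0] Kin by simp
  have W0: "W z = \<zero>\<^bsub>A\<^esub>" if z: "z \<in> carrier A" for z
  proof -
    have w: "W z \<in> carrier A" by (rule Win[OF z])
    have h: "H (W z) = \<zero>\<^bsub>A\<^esub>" using KK[OF w] KW[OF z] K0 by simp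
    have "X (W z) = (-1) \<cdot> H (W z)" unfolding HW[OF z] using Xin[OF w] by (simp add: smult_smult)
    then have "W (W z) = \<zero>\<^bsub>A\<^esub>" using h by (simp add: W_def sub_self)
    then have "adj (W z) \<star> W z = \<zero>\<^bsub>A\<^esub>" using op_sa_swap[OF W z w] z by simp
    then show ?thesis using star_mul_self_eq_0[OF w] by simp
  qed
  have HX: "H z = X z" if "z \<in> carrier A" for z
    using W0[OF that] sub_eq_0_iff[of "H z" "X z"] Hin[OF that] Xin[OF that] by (simp add: W_def)
  define K2 where "K2 = (\<lambda>x. complex_of_real (sqrt 2) \<cdot> K x)"
  have K2: "op_sa K2" unfolding K2_def by (rule op_sa_scale[OF K(1)])
  have "nrm A (T a) \<le> s * nrm A a"
  proof (rule op_pythagoras[OF T K2 _ s(1) _ a(1)])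
    fix x assume x: "x \<in> carrier A"
    show "T (K2 x) = K2 (T x)" using x by (simp add: K2_def op_sa_smult[OF T] TK Kin)
    have "K2 (K2 x) = (complex_of_real (sqrt 2) * complex_of_real (sqrt 2)) \<cdot> K (K x)"
      using x by (simp add: K2_def op_sa_smult[OF K(1)] Kin smult_smult)
    also have "\<dots> = 2 \<cdot> X x"
      using x by (simp add: KK HX flip: of_real_mult)
    also have "\<dots> = complex_of_real (s\<^sup>2) \<cdot> x \<boxplus> (-1) \<cdot> T (T x)"
      using x Tin by (simp add: X_def smult_add_right smult_smult)
    finally show "T (T x) \<boxplus> K2 (K2 x) = complex_of_real (s\<^sup>2) \<cdot> x"
      using x Tin smult_add_left[of "T (T x)" 1 "-1"]
      by (simp add: M.a_lcomm[of "T (T x)"])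
  qed
  moreover have "nrm A (T a) = nrm A a * nrm A a"
    using cstar_identity[OF a(1)] a by (simp add: T_def power2_eq_square)
  ultimately show ?thesis using nrm_nonneg[OF a(1)] s by (cases "nrm A a = 0") auto
qed

lemma nrm_le_if_pos_fun:
  assumes a: "a \<in> carrier A" "adj a = a" and s: "0 \<le> s"
    and F: "\<And>f. f \<in> F \<Longrightarrow> pos_fun f"
    and faithful: "\<And>z. z \<in> carrier A \<Longrightarrow> (\<And>f. f \<in> F \<Longrightarrow> f (adj z \<star> z) = 0) \<Longrightarrow> z = \<zero>\<^bsub>A\<^esub>"
    and bound: "\<And>f z. f \<in> F \<Longrightarrow> z \<in> carrier A \<Longrightarrow> f (adj (a \<star> z) \<star> (a \<star> z)) \<le> s\<^sup>2 * f (adj z \<star> z)"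
  shows "nrm A a \<le> s"
proof (rule ccontr)
  assume "\<not> nrm A a \<le> s"
  then have less: "s < nrm A a" by simp
  define t where "t = nrm A a"
  have t: "t > 0" using less s by (simp add: t_def)
  let ?b = "complex_of_real (1/t) \<cdot> a"
  have b: "?b \<in> carrier A" "adj ?b = ?b" using a by (simp_all add: star_smult)
  have nb: "nrm A ?b = 1" using t a by (simp add: nrm_smult norm_divide t_def)
  have "nrm A ?b \<le> s / t"
  proof (rule nrm_le_if_pos_fun_unit[OF b _ _ _ F faithful])
    fix f z assume f: "f \<in> F" and z: "z \<in> carrier A"
    have "adj (?b \<star> z) \<star> (?b \<star> z) = complex_of_real ((1/t)\<^sup>2) \<cdot> (adj (a \<star> z) \<star> (a \<star> z))"
      using a z by (simp add: alg_smult_left alg_smult_right star_smult smult_smult power2_eq_square)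
    then have "f (adj (?b \<star> z) \<star> (?b \<star> z)) = (1/t)\<^sup>2 * f (adj (a \<star> z) \<star> (a \<star> z))"
      using a z by (simp only: pos_fun_smult[OF F[OF f]] alg_closed)
    also have "\<dots> \<le> (1/t)\<^sup>2 * (s\<^sup>2 * f (adj z \<star> z))" using bound[OF f z] by (intro mult_left_mono) auto
    finally show "f (adj (?b \<star> z) \<star> (?b \<star> z)) \<le> (s/t)\<^sup>2 * f (adj z \<star> z)" by (simp add: power_divide)
  qed (use nb s t less in \<open>auto simp: t_def\<close>)
  then show False using nb t less by (simp add: t_def)
qed
end

section \<open>Hilbert spaces and adjoints\<close>

lemma quadratic_nonneg_imp_zero:
  fixes a b :: real
  assumes "a \<ge> 0" "\<And>t. 0 \<le> t\<^sup>2 * a + 2 * t * b" shows "b = 0"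
proof (rule ccontr)
  assume b: "b \<noteq> 0"
  \<comment> \<open>near the minimiser; adding one avoids a division by zero\<close>
  define t where "t = - b / (a + 1)"
  have ts: "t * (a + 1) = - b" using assms(1) by (simp add: t_def)
  have "(t\<^sup>2 * a + 2 * t * b) * (a + 1)\<^sup>2 = (t * (a + 1))\<^sup>2 * a + 2 * (t * (a + 1)) * b * (a + 1)"
    by (simp add: power2_eq_square algebra_simps)
  also have "\<dots> = - (b\<^sup>2 * (a + 2))" unfolding ts by (simp add: power2_eq_square algebra_simps)
  also have "\<dots> < 0" using b assms(1) by simp
  finally show False using assms(2)[of t] assms(1) by (simp add: mult_less_0_iff)
qed

context chilbert_space begin
abbreviation hadd (infixl \<open>\<boxplus>\<close> 65) where "x \<boxplus> y \<equiv> x \<oplus>\<^bsub>H\<^esub> y"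
abbreviation hsub (infixl \<open>\<boxminus>\<close> 65) where "x \<boxminus> y \<equiv> x \<ominus>\<^bsub>H\<^esub> y"
abbreviation hsmult (infixr \<open>\<cdot>\<close> 75) where "c \<cdot> x \<equiv> c \<odot>\<^bsub>H\<^esub> x"

lemma ip_add_right:
  "\<lbrakk>x \<in> carrier H; y \<in> carrier H; z \<in> carrier H\<rbrakk> \<Longrightarrow> ip H x (y \<boxplus> z) = ip H x y + ip H x z"
  using ip_cnj[of "y \<boxplus> z" x] ip_cnj[of y x] ip_cnj[of z x] by (simp add: ip_add_left)

lemma ip_smult_right:
  "\<lbrakk>x \<in> carrier H; y \<in> carrier H\<rbrakk> \<Longrightarrow> ip H x (c \<cdot> y) = cnj c * ip H x y"
  using ip_cnj[of "c \<cdot> y" x] ip_cnj[of y x] by (simp add: ip_smult_left)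

lemma ip_sub_right:
  "\<lbrakk>x \<in> carrier H; y \<in> carrier H; z \<in> carrier H\<rbrakk> \<Longrightarrow> ip H x (y \<boxminus> z) = ip H x y - ip H x z"
  by (simp add: sub_eq ip_add_right ip_smult_right)

lemma nrm_sq: "x \<in> carrier H \<Longrightarrow> (nrm H x)\<^sup>2 = Re (ip H x x)"
  by (simp add: ip_self del: of_real_power)

lemma nrm_add_sq:
  assumes "x \<in> carrier H" "y \<in> carrier H"
  shows "(nrm H (x \<boxplus> y))\<^sup>2 = (nrm H x)\<^sup>2 + (nrm H y)\<^sup>2 + 2 * Re (ip H x y)"
  using assms ip_cnj[OF assms] by (simp add: nrm_sq ip_add_left ip_add_right)

lemma ip_right_eqI:
  assumes "u \<in> carrier H" "v \<in> carrier H" "\<And>x. x \<in> carrier H \<Longrightarrow> ip H x u = ip H x v" shows "u = v"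
proof -
  have "(nrm H (u \<boxminus> v))\<^sup>2 = 0" using assms by (simp add: nrm_sq ip_sub_right)
  then show ?thesis using assms nrm_eq_0[of "u \<boxminus> v"] sub_eq_0_iff[of u v] by simp
qed

lemma cauchy_schwarz:
  assumes x: "x \<in> carrier H" and y: "y \<in> carrier H" shows "cmod (ip H x y) \<le> nrm H x * nrm H y"
proof (cases "nrm H y = 0")
  case True
  then have "y = \<zero>\<^bsub>H\<^esub>" using nrm_eq_0[OF y] by simp
  then have "ip H x y = 0" using ip_smult_right[OF x y, of 0] y by simp
  then show ?thesis using True by simp
next
  case False
  then have ny: "nrm H y > 0" using nrm_nonneg[OF y] by simp
  define p where "p = ip H x y"
  \<comment> \<open>the choice for which \<open>x + c y\<close> is orthogonal to \<open>y\<close>\<close>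
  define c where "c = - p / complex_of_real ((nrm H y)\<^sup>2)"
  have cy: "c \<cdot> y \<in> carrier H" using y by simp
  have "Re (cnj c * p) = - (cmod p)\<^sup>2 / (nrm H y)\<^sup>2"
  proof -
    have pp: "p * cnj p = complex_of_real ((cmod p)\<^sup>2)" by (rule complex_norm_square[symmetric])
    have "cnj c * p = - (p * cnj p) / complex_of_real ((nrm H y)\<^sup>2)" by (simp add: c_def mult.commute)
    also have "\<dots> = complex_of_real (- (cmod p)\<^sup>2 / (nrm H y)\<^sup>2)" by (simp add: pp)
    finally show ?thesis by (simp only: Re_complex_of_real)
  qed
  moreover have "(cmod c * nrm H y)\<^sup>2 = (cmod p)\<^sup>2 / (nrm H y)\<^sup>2"
    using ny by (simp add: c_def norm_divide norm_mult field_simps power2_eq_square)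
  ultimately have "(nrm H (x \<boxplus> c \<cdot> y))\<^sup>2 = (nrm H x)\<^sup>2 - (cmod p)\<^sup>2 / (nrm H y)\<^sup>2"
    using nrm_add_sq[OF x cy] x y by (simp add: ip_smult_right nrm_smult p_def)
  then have "(cmod p)\<^sup>2 / (nrm H y)\<^sup>2 \<le> (nrm H x)\<^sup>2" using zero_le_power2[of "nrm H (x \<boxplus> c \<cdot> y)"] by linarith
  then have "(cmod p)\<^sup>2 \<le> (nrm H x * nrm H y)\<^sup>2" using ny by (simp add: field_simps)
  then show ?thesis unfolding p_def using x y by (meson power2_le_imp_le mult_nonneg_nonneg nrm_nonneg)
qed

lemma parallelogram:
  assumes "x \<in> carrier H" "y \<in> carrier H"
  shows "(nrm H (x \<boxminus> y))\<^sup>2 = 2 * (nrm H x)\<^sup>2 + 2 * (nrm H y)\<^sup>2 - (nrm H (x \<boxplus> y))\<^sup>2"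
  using nrm_add_sq[of x "(-1) \<cdot> y"] nrm_add_sq[of x y] assms by (simp add: sub_eq nrm_smult ip_smult_right)

text \<open>
  The representing vector minimises \<open>J x = \<parallel>x\<parallel>\<^sup>2 - 2 Re (\<phi> x)\<close>. By the parallelogram law a minimising
  sequence is Cauchy, and the first variation of \<open>J\<close> at its limit vanishes. Minimising \<open>J\<close>
  rather than a distance treats the zero functional on the same footing as the others.
\<close>

lemma riesz:
  assumes add: "\<And>x y. x \<in> carrier H \<Longrightarrow> y \<in> carrier H \<Longrightarrow> \<phi> (x \<boxplus> y) = \<phi> x + \<phi> y"
    and smult: "\<And>x c. x \<in> carrier H \<Longrightarrow> \<phi> (c \<cdot> x) = c * \<phi> x"
    and bound: "\<And>x. x \<in> carrier H \<Longrightarrow> cmod (\<phi> x) \<le> K * nrm H x"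
  shows "\<exists>y\<in>carrier H. \<forall>x\<in>carrier H. \<phi> x = ip H x y"
proof -
  define J where "J x = (nrm H x)\<^sup>2 - 2 * Re (\<phi> x)" for x
  have lower: "- K\<^sup>2 \<le> J x" if x: "x \<in> carrier H" for x
  proof -
    have "Re (\<phi> x) \<le> K * nrm H x" using bound[OF x] complex_Re_le_cmod[of "\<phi> x"] by simp
    then show ?thesis unfolding J_def using zero_le_power2[of "nrm H x - K"] by (simp add: power2_eq_square algebra_simps)
  qed
  define m where "m = (INF x\<in>carrier H. J x)"
  have bdd: "bdd_below (J ` carrier H)" using lower by (intro bdd_belowI2) auto
  have m_le: "m \<le> J x" if "x \<in> carrier H" for x unfolding m_def by (rule cINF_lower[OF bdd that])
  have "\<exists>x\<in>carrier H. J x < m + 1 / Suc n" for n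
  proof (rule ccontr)
    assume "\<not> ?thesis"
    then have "m + 1 / Suc n \<le> (INF x\<in>carrier H. J x)"
      by (intro cINF_greatest) (auto simp: not_less)
    then have "m + 1 / Suc n \<le> m" by (simp add: m_def)
    then show False by simp
  qed
  then obtain s where s: "\<And>n. s n \<in> carrier H" and Js: "\<And>n. J (s n) < m + 1 / Suc n" by metis
  have par: "(nrm H (x \<boxminus> y))\<^sup>2 \<le> 2 * (J x - m) + 2 * (J y - m)" if x: "x \<in> carrier H" and y: "y \<in> carrier H" for x y
  proof -
    let ?z = "(1/2) \<cdot> (x \<boxplus> y)"
    have "4 * J ?z = (nrm H (x \<boxplus> y))\<^sup>2 - 4 * Re (\<phi> x) - 4 * Re (\<phi> y)"
      using x y by (simp add: J_def nrm_smult norm_divide smult add power_divide algebra_simps)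
    then show ?thesis using parallelogram[OF x y] m_le[of ?z] x y by (simp add: J_def algebra_simps)
  qed
  have cau: "nrm H (s i \<boxminus> s j) < e" if e: "e > 0" and ij: "real (Suc i) > 4 / e\<^sup>2" "real (Suc j) > 4 / e\<^sup>2" for i j e
  proof -
    have *: "1 / real (Suc k) < e\<^sup>2 / 4" if "real (Suc k) > 4 / e\<^sup>2" for k
      using that e by (simp add: field_simps)
    have J2: "J (s k) < m + e\<^sup>2 / 4" if "real (Suc k) > 4 / e\<^sup>2" for k
      by (rule order.strict_trans[OF Js add_strict_left_mono[OF *[OF that]]])
    have "(nrm H (s i \<boxminus> s j))\<^sup>2 \<le> 2 * (J (s i) - m) + 2 * (J (s j) - m)" by (rule par[OF s s])
    also have "\<dots> < 2 * (e\<^sup>2 / 4) + 2 * (e\<^sup>2 / 4)"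
      using J2[OF ij(1)] J2[OF ij(2)] by (intro add_strict_mono mult_strict_left_mono) auto
    also have "\<dots> = e\<^sup>2" by simp
    finally have "(nrm H (s i \<boxminus> s j))\<^sup>2 < e\<^sup>2" .
    then show ?thesis using e by (meson power2_less_imp_less less_imp_le)
  qed
  have "\<exists>l\<in>carrier H. (\<lambda>n. nrm H (s n \<boxminus> l)) \<longlonglongrightarrow> 0"
  proof (rule nrm_complete[OF s])
    fix e :: real assume e: "e > 0"
    obtain N where N: "real N > 4 / e\<^sup>2" using reals_Archimedean2 by blast
    have "real (Suc i) > 4 / e\<^sup>2" if "i \<ge> N" for i using that N by simp
    then show "\<exists>N. \<forall>m\<ge>N. \<forall>n\<ge>N. nrm H (s m \<boxminus> s n) < e" using cau[OF e] by blast
  qed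
  then obtain y where y: "y \<in> carrier H" and lim: "vlim s y" using s by (auto simp: vlim_def)
  have diff: "\<phi> (a \<boxminus> b) = \<phi> a - \<phi> b" if "a \<in> carrier H" "b \<in> carrier H" for a b
    using that by (simp add: sub_eq add smult)
  have "(\<lambda>n. Re (\<phi> (s n)) - Re (\<phi> y)) \<longlonglongrightarrow> 0"
  proof (rule null_comparison)
    show "\<bar>Re (\<phi> (s n)) - Re (\<phi> y)\<bar> \<le> K * nrm H (s n \<boxminus> y)" for n
      using bound[of "s n \<boxminus> y"] abs_Re_le_cmod[of "\<phi> (s n \<boxminus> y)"] s[of n] y diff[OF s y, of n] by simp
    show "(\<lambda>n. K * nrm H (s n \<boxminus> y)) \<longlonglongrightarrow> 0"
      using tendsto_mult[of "\<lambda>n. K" K _ _ 0] lim by (force simp: vlim_def)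
  qed
  then have limRe: "(\<lambda>n. Re (\<phi> (s n))) \<longlonglongrightarrow> Re (\<phi> y)" by (simp add: LIM_zero_iff)
  then have lim1: "(\<lambda>n. J (s n)) \<longlonglongrightarrow> J y" unfolding J_def by (intro tendsto_diff tendsto_power tendsto_mult tendsto_const vlim_nrm[OF lim] limRe)
  have "(\<lambda>n. m + 1 / Suc n) \<longlonglongrightarrow> m + 0"
    by (intro tendsto_add tendsto_const) (rule LIMSEQ_Suc[OF lim_1_over_n])
  from LIMSEQ_le[OF lim1 this] have "J y \<le> m" using Js less_imp_le by auto
  then have Jmin: "J y \<le> J z" if "z \<in> carrier H" for z using m_le[OF that] by simp
  have re: "Re (\<phi> h) = Re (ip H h y)" if h: "h \<in> carrier H" for h
  proof -
    have "0 \<le> t\<^sup>2 * (nrm H h)\<^sup>2 + 2 * t * (Re (ip H y h) - Re (\<phi> h))" for t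
    proof -
      let ?h = "complex_of_real t \<cdot> h"
      have "J (y \<boxplus> ?h) = J y + (t\<^sup>2 * (nrm H h)\<^sup>2 + 2 * t * (Re (ip H y h) - Re (\<phi> h)))"
        using nrm_add_sq[of y ?h] y h by (simp add: J_def add smult nrm_smult ip_smult_right power_mult_distrib algebra_simps)
      then show ?thesis using Jmin[of "y \<boxplus> ?h"] y h by simp
    qed
    from quadratic_nonneg_imp_zero[OF _ this] have "Re (ip H y h) = Re (\<phi> h)" by simp
    then show ?thesis using ip_cnj[OF h y] by simp
  qed
  have "\<phi> x = ip H x y" if x: "x \<in> carrier H" for x
  proof (rule complex_eqI)
    show "Im (\<phi> x) = Im (ip H x y)"
      using re[of "(- \<i>) \<cdot> x"] x y by (simp add: smult ip_smult_left)
  qed (rule re[OF x])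
  then show ?thesis using y by blast
qed

text \<open>
  The definite description in \<^const>\<open>op_adjoint\<close> denotes the adjoint: existence is the representation
  theorem for the functionals \<open>y \<mapsto> ip H (T y) x\<close>.
\<close>

lemma op_adjoint:
  assumes T: "T \<in> bounded_ops H"
  shows "op_adjoint H T \<in> bounded_ops H"
    and "\<And>x y. x \<in> carrier H \<Longrightarrow> y \<in> carrier H \<Longrightarrow> ip H (op_adjoint H T x) y = ip H x (T y)"
proof -
  have lin: "linear_map class_ring H H T" and "\<exists>K. \<forall>x\<in>carrier H. nrm H (T x) \<le> K * nrm H x"
    using T by (auto simp: bounded_ops_def bounded_linear_map_def)
  then obtain K0 where K0: "\<And>x. x \<in> carrier H \<Longrightarrow> nrm H (T x) \<le> K0 * nrm H x" by blast
  define K where "K = max K0 0"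
  have K: "nrm H (T x) \<le> K * nrm H x" if "x \<in> carrier H" for x
    using K0[OF that] mult_right_mono[of K0 K, OF _ nrm_nonneg[OF that]] by (simp add: K_def)
  have Kpos: "K \<ge> 0" by (simp add: K_def)
  interpret T: linear_map class_ring H H T by (rule lin)
  have Tin: "T x \<in> carrier H" if "x \<in> carrier H" for x using that by (rule T.f_im)
  have Tadd: "T (x \<boxplus> y) = T x \<boxplus> T y" if "x \<in> carrier H" "y \<in> carrier H" for x y using that by (rule T.f_add)
  have Tsm: "T (c \<cdot> x) = c \<cdot> T x" if "x \<in> carrier H" for x c using that by (intro T.f_smult) auto
  have "\<exists>w\<in>carrier H. \<forall>y\<in>carrier H. ip H (T y) x = ip H y w" if x: "x \<in> carrier H" for x
  proof (rule riesz)
    fix y assume y: "y \<in> carrier H"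
    have "cmod (ip H (T y) x) \<le> nrm H (T y) * nrm H x" by (rule cauchy_schwarz[OF Tin[OF y] x])
    also have "\<dots> \<le> (K * nrm H y) * nrm H x" by (intro mult_right_mono K y nrm_nonneg x)
    finally show "cmod (ip H (T y) x) \<le> (K * nrm H x) * nrm H y" by (simp add: mult_ac)
  qed (use x in \<open>simp_all add: Tin Tadd Tsm ip_add_left ip_smult_left\<close>)
  then obtain S0 where S0: "\<And>x. x \<in> carrier H \<Longrightarrow> S0 x \<in> carrier H"
    "\<And>x y. x \<in> carrier H \<Longrightarrow> y \<in> carrier H \<Longrightarrow> ip H (T y) x = ip H y (S0 x)" by metis
  define S where "S = restrict S0 (carrier H)"
  have Sin: "S x \<in> carrier H" if "x \<in> carrier H" for x using that S0 by (simp add: S_def)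
  have S: "ip H y (S x) = ip H (T y) x" if "x \<in> carrier H" "y \<in> carrier H" for x y using that S0 by (simp add: S_def)
  have Sadd: "S (x \<boxplus> y) = S x \<boxplus> S y" if "x \<in> carrier H" "y \<in> carrier H" for x y
    by (rule ip_right_eqI) (use that in \<open>simp_all add: Sin S Tin ip_add_right\<close>)
  have Ssm: "S (c \<cdot> x) = c \<cdot> S x" if "x \<in> carrier H" for x c
    by (rule ip_right_eqI) (use that in \<open>simp_all add: Sin S Tin ip_smult_right\<close>)
  have Sb: "nrm H (S x) \<le> K * nrm H x" if x: "x \<in> carrier H" for x
  proof (cases "nrm H (S x) = 0")
    case False
    then have pos: "nrm H (S x) > 0" using nrm_nonneg[OF Sin[OF x]] by simp
    have "(nrm H (S x))\<^sup>2 = Re (ip H (T (S x)) x)" using nrm_sq[OF Sin[OF x]] S[OF x Sin[OF x]] by simp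
    also have "\<dots> \<le> nrm H (T (S x)) * nrm H x"
      using cauchy_schwarz[OF Tin[OF Sin[OF x]] x] complex_Re_le_cmod order_trans by blast
    also have "\<dots> \<le> (K * nrm H (S x)) * nrm H x" by (intro mult_right_mono K Sin x nrm_nonneg)
    finally show ?thesis using pos by (simp add: power2_eq_square mult_ac)
  qed (use Kpos nrm_nonneg[OF x] in simp)
  have Slin: "linear_map class_ring H H S"
    by (intro linear_map.intro mod_hom.intro mod_hom_axioms.intro vectorspace_axioms module_axioms)
       (auto simp: module_hom_def Sin Sadd Ssm)
  have Sops: "S \<in> bounded_ops H"
    using Slin Sb by (auto simp: bounded_ops_def bounded_linear_map_def S_def)
  have Sip: "ip H (S x) y = ip H x (T y)" if "x \<in> carrier H" "y \<in> carrier H" for x y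
    using S[OF that] ip_cnj[of y "S x"] ip_cnj[of "T y" x] that Sin Tin by simp
  have "op_adjoint H T = S" unfolding op_adjoint_def
  proof (rule the_equality)
    fix R assume R: "R \<in> bounded_ops H \<and> (\<forall>x\<in>carrier H. \<forall>y\<in>carrier H. ip H (R x) y = ip H x (T y))"
    then have lR: "linear_map class_ring H H R" by (auto simp: bounded_ops_def bounded_linear_map_def)
    interpret R: linear_map class_ring H H R by (rule lR)
    show "R = S"
    proof (rule extensionalityI)
      fix x assume x: "x \<in> carrier H"
      have Rx: "R x \<in> carrier H" using x by (rule R.f_im)
      show "R x = S x"
        by (rule ip_right_eqI) (use R x Rx Sin[OF x] Sip[OF x] ip_cnj[of "R x"] ip_cnj[of "S x"] in auto)
    qed (use R Sops in \<open>auto simp: bounded_ops_def\<close>)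
  qed (use Sops Sip in blast)
  then show "op_adjoint H T \<in> bounded_ops H"
    "\<And>x y. x \<in> carrier H \<Longrightarrow> y \<in> carrier H \<Longrightarrow> ip H (op_adjoint H T x) y = ip H x (T y)"
    using Sops Sip by auto
qed
end

lemma bounded_linear_map_op_norm:
  assumes V: "cnormed_space V" and W: "cnormed_space W" and f: "bounded_linear_map V W f"
  shows "x \<in> carrier V \<Longrightarrow> nrm W (f x) \<le> op_norm V W f * nrm V x" "0 \<le> op_norm V W f"
proof -
  interpret V: cnormed_space V by (rule V)
  interpret W: cnormed_space W by (rule W)
  from f obtain K where lin: "linear_map class_ring V W f" and K: "\<And>x. x \<in> carrier V \<Longrightarrow> nrm W (f x) \<le> K * nrm V x"
    by (auto simp: bounded_linear_map_def)
  interpret f: linear_map class_ring V W f by (rule lin)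
  let ?S = "{nrm W (f x) | x. x \<in> carrier V \<and> nrm V x \<le> 1}"
  have bdd: "bdd_above ?S"
  proof (rule bdd_aboveI)
    fix t assume "t \<in> ?S"
    then obtain x where x: "t = nrm W (f x)" "x \<in> carrier V" "nrm V x \<le> 1" by blast
    have "t \<le> \<bar>K\<bar> * nrm V x"
      using K[OF x(2)] x(1) mult_right_mono[OF abs_ge_self[of K] V.nrm_nonneg[OF x(2)]] by linarith
    also have "\<dots> \<le> \<bar>K\<bar> * 1" by (rule mult_left_mono) (use x in auto)
    finally show "t \<le> \<bar>K\<bar>" by simp
  qed
  have unit: "nrm W (f x) \<le> op_norm V W f" if "x \<in> carrier V" "nrm V x \<le> 1" for x
    unfolding op_norm_def by (rule cSup_upper[OF _ bdd]) (use that in blast)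
  show nn: "0 \<le> op_norm V W f"
    using unit[of "\<zero>\<^bsub>V\<^esub>"] by (simp add: f.f0_is_0)
  assume x: "x \<in> carrier V"
  show "nrm W (f x) \<le> op_norm V W f * nrm V x"
  proof (cases "nrm V x = 0")
    case True
    then have "x = \<zero>\<^bsub>V\<^esub>" using V.nrm_eq_0[OF x] by simp
    then show ?thesis by (simp add: f.f0_is_0)
  next
    case False
    then have pos: "nrm V x > 0" using V.nrm_nonneg[OF x] by simp
    let ?c = "complex_of_real (1 / nrm V x)"
    have fx: "f x \<in> carrier W" using x by (rule f.f_im)
    have "nrm W (f (?c \<odot>\<^bsub>V\<^esub> x)) \<le> op_norm V W f"
      using pos x by (intro unit) (auto simp: V.nrm_smult norm_divide)
    also have "f (?c \<odot>\<^bsub>V\<^esub> x) = ?c \<odot>\<^bsub>W\<^esub> f x" by (rule f.f_smult) (use x in auto)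
    finally show ?thesis using pos fx by (simp add: W.nrm_smult norm_divide field_simps)
  qed
qed

lemma op_norm_le:
  assumes V: "cnormed_space V" and "c \<ge> 0" "\<And>x. x \<in> carrier V \<Longrightarrow> nrm W (f x) \<le> c * nrm V x"
  shows "op_norm V W f \<le> c"
  unfolding op_norm_def
proof (rule cSup_least)
  interpret V: cnormed_space V by (rule V)
  show "{nrm W (f x) |x. x \<in> carrier V \<and> nrm V x \<le> 1} \<noteq> {}" using V.nrm_zero by force
  fix t assume "t \<in> {nrm W (f x) |x. x \<in> carrier V \<and> nrm V x \<le> 1}"
  then obtain x where "t = nrm W (f x)" "x \<in> carrier V" "nrm V x \<le> 1" by blast
  then show "t \<le> c" using assms(3)[of x] mult_left_mono[of "nrm V x" 1 c] assms(2) by simp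
qed

section \<open>Faithful representations are isometric\<close>

locale cstar_rep = A: cstar_algebra A + H: chilbert_space H
  for A :: "('a, 'm) cstar_scheme" and H :: "('h, 'k) chilbert_scheme" and \<pi> :: "'a \<Rightarrow> 'h \<Rightarrow> 'h" +
  assumes hom: "star_hom A (op_algebra H) \<pi>"
begin

lemma rep_bounded: "x \<in> carrier A \<Longrightarrow> \<pi> x \<in> bounded_ops H"
proof -
  interpret p: linear_map class_ring A "op_algebra H" \<pi> using hom by (simp add: star_hom_def)
  assume "x \<in> carrier A"
  then show ?thesis using p.f_im[of x] by (simp add: op_algebra_def)
qed

lemma rep_linear: "x \<in> carrier A \<Longrightarrow> bounded_linear_map H H (\<pi> x)"
  using rep_bounded by (simp add: bounded_ops_def)

lemma rep_in: "x \<in> carrier A \<Longrightarrow> \<xi> \<in> carrier H \<Longrightarrow> \<pi> x \<xi> \<in> carrier H"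
proof -
  assume x: "x \<in> carrier A" and \<xi>: "\<xi> \<in> carrier H"
  interpret p: linear_map class_ring H H "\<pi> x" using rep_linear[OF x] by (simp add: bounded_linear_map_def)
  show ?thesis using \<xi> by (rule p.f_im)
qed

lemma rep_add:
  assumes "x \<in> carrier A" "y \<in> carrier A" "\<xi> \<in> carrier H"
  shows "\<pi> (x \<oplus>\<^bsub>A\<^esub> y) \<xi> = \<pi> x \<xi> \<oplus>\<^bsub>H\<^esub> \<pi> y \<xi>"
proof -
  interpret p: linear_map class_ring A "op_algebra H" \<pi> using hom by (simp add: star_hom_def)
  show ?thesis using p.f_add[of x y] assms by (simp add: op_algebra_def)
qed

lemma rep_smult:
  assumes "x \<in> carrier A" "\<xi> \<in> carrier H"
  shows "\<pi> (c \<odot>\<^bsub>A\<^esub> x) \<xi> = c \<odot>\<^bsub>H\<^esub> \<pi> x \<xi>"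
proof -
  interpret p: linear_map class_ring A "op_algebra H" \<pi> using hom by (simp add: star_hom_def)
  show ?thesis using p.f_smult[of c x] assms by (simp add: op_algebra_def)
qed

lemma rep_mult:
  assumes "x \<in> carrier A" "y \<in> carrier A" "\<xi> \<in> carrier H"
  shows "\<pi> (x \<otimes>\<^bsub>A\<^esub> y) \<xi> = \<pi> x (\<pi> y \<xi>)"
proof -
  have "\<pi> (x \<otimes>\<^bsub>A\<^esub> y) = \<pi> x \<otimes>\<^bsub>op_algebra H\<^esub> \<pi> y" using hom assms by (simp add: star_hom_def)
  then show ?thesis using assms by (simp add: op_algebra_def compose_def)
qed

lemma rep_star:
  assumes "x \<in> carrier A" "\<xi> \<in> carrier H" "\<eta> \<in> carrier H"
  shows "ip H (\<pi> (star A x) \<xi>) \<eta> = ip H \<xi> (\<pi> x \<eta>)"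
proof -
  have "\<pi> (star A x) = op_adjoint H (\<pi> x)" using hom assms by (simp add: star_hom_def op_algebra_def)
  then show ?thesis using H.op_adjoint(2)[OF rep_bounded] assms by simp
qed

text \<open>
  The positive functional attached to the vector \<open>\<xi>\<close>; the real part makes it real-valued on all of \<open>A\<close>.
\<close>

definition vector_fun :: "'h \<Rightarrow> 'a \<Rightarrow> real" where "vector_fun \<xi> z = Re (ip H (\<pi> z \<xi>) \<xi>)"

lemma vector_fun_sq:
  assumes "z \<in> carrier A" "\<xi> \<in> carrier H"
  shows "vector_fun \<xi> (star A z \<otimes>\<^bsub>A\<^esub> z) = (nrm H (\<pi> z \<xi>))\<^sup>2"
  using assms by (simp add: vector_fun_def rep_mult rep_star rep_in H.nrm_sq)

lemma pos_fun_vector_fun: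
  assumes "\<xi> \<in> carrier H" shows "A.pos_fun (vector_fun \<xi>)"
  unfolding A.pos_fun_def
proof (intro conjI ballI allI)
  fix x assume x: "x \<in> carrier A"
  show "0 \<le> vector_fun \<xi> (star A x \<otimes>\<^bsub>A\<^esub> x)" using vector_fun_sq[OF x assms] by simp
  show "vector_fun \<xi> (complex_of_real c \<odot>\<^bsub>A\<^esub> x) = c * vector_fun \<xi> x" for c
    using x assms by (simp add: vector_fun_def rep_smult H.ip_smult_left rep_in)
  show "vector_fun \<xi> (x \<oplus>\<^bsub>A\<^esub> y) = vector_fun \<xi> x + vector_fun \<xi> y" if "y \<in> carrier A" for y
    using x that assms by (simp add: vector_fun_def rep_add H.ip_add_left rep_in)
qed

text \<open>
  For \<open>a = adj x \<star> x / \<parallel>x\<parallel>\<^sup>2\<close>, \<open>pos_fun_contr\<close> applied to \<open>a\<close> itself gives \<open>\<parallel>\<pi>(a)\<^sup>2 \<xi>\<parallel> \<le> \<parallel>\<pi>(a) \<xi>\<parallel>\<close>, and the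
  Cauchy-Schwarz inequality turns this into \<open>\<parallel>\<pi>(a) \<xi>\<parallel> \<le> \<parallel>\<xi>\<parallel>\<close>.
\<close>

lemma rep_contractive_vec:
  assumes x: "x \<in> carrier A" and \<xi>: "\<xi> \<in> carrier H"
  shows "nrm H (\<pi> x \<xi>) \<le> nrm A x * nrm H \<xi>"
proof (cases "nrm A x = 0")
  case True
  then have "x = 0 \<odot>\<^bsub>A\<^esub> x" using A.nrm_eq_0[OF x] x by simp
  then have "\<pi> x \<xi> = \<zero>\<^bsub>H\<^esub>" using rep_smult[OF x \<xi>, of 0] rep_in[OF x \<xi>] by simp
  then show ?thesis using True by simp
next
  case False
  define t where "t = nrm A x"
  have t: "t > 0" using False A.nrm_nonneg[OF x] by (simp add: t_def)
  define a where "a = complex_of_real (1 / t\<^sup>2) \<odot>\<^bsub>A\<^esub> (star A x \<otimes>\<^bsub>A\<^esub> x)"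
  have a: "a \<in> carrier A" "star A a = a" "nrm A a \<le> 1"
    using x t by (simp_all add: a_def A.star_smult A.star_mult A.star_star A.nrm_smult norm_divide norm_power A.cstar_identity flip: t_def)
  have *: "nrm H (\<pi> a \<xi>) \<le> nrm H \<xi>"
  proof (cases "nrm H (\<pi> a \<xi>) = 0")
    case False
    then have pos: "nrm H (\<pi> a \<xi>) > 0" using H.nrm_nonneg[OF rep_in[OF a(1) \<xi>]] by simp
    have "(nrm H (\<pi> (a \<otimes>\<^bsub>A\<^esub> a) \<xi>))\<^sup>2 \<le> (nrm H (\<pi> a \<xi>))\<^sup>2"
      using A.pos_fun_contr[OF pos_fun_vector_fun[OF \<xi>] a a(1)]
      unfolding vector_fun_sq[OF a(1) \<xi>] vector_fun_sq[OF A.alg_mult_closed[OF a(1) a(1)] \<xi>] .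
    then have le: "nrm H (\<pi> a (\<pi> a \<xi>)) \<le> nrm H (\<pi> a \<xi>)"
      using rep_mult[OF a(1) a(1) \<xi>] H.nrm_nonneg[OF rep_in[OF a(1) \<xi>]] power2_le_imp_le by metis
    have "(nrm H (\<pi> a \<xi>))\<^sup>2 = Re (ip H (\<pi> a (\<pi> a \<xi>)) \<xi>)"
      using rep_star[OF a(1) rep_in[OF a(1) \<xi>] \<xi>] a \<xi> by (simp add: H.nrm_sq rep_in)
    also have "\<dots> \<le> nrm H (\<pi> a (\<pi> a \<xi>)) * nrm H \<xi>"
      using H.cauchy_schwarz[OF rep_in[OF a(1) rep_in[OF a(1) \<xi>]] \<xi>] complex_Re_le_cmod order_trans by blast
    also have "\<dots> \<le> nrm H (\<pi> a \<xi>) * nrm H \<xi>" by (intro mult_right_mono le H.nrm_nonneg \<xi>)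
    finally show ?thesis using pos by (simp add: power2_eq_square)
  qed (use H.nrm_nonneg[OF \<xi>] in simp)
  have "star A x \<otimes>\<^bsub>A\<^esub> x = complex_of_real (t\<^sup>2) \<odot>\<^bsub>A\<^esub> a"
    using x t by (simp add: a_def A.smult_smult)
  then have eq: "(nrm H (\<pi> x \<xi>))\<^sup>2 = t\<^sup>2 * vector_fun \<xi> a"
    using vector_fun_sq[OF x \<xi>] A.pos_fun_smult[OF pos_fun_vector_fun[OF \<xi>] a(1), of "t\<^sup>2"] by simp
  have "vector_fun \<xi> a \<le> nrm H (\<pi> a \<xi>) * nrm H \<xi>" unfolding vector_fun_def
    using H.cauchy_schwarz[OF rep_in[OF a(1) \<xi>] \<xi>] complex_Re_le_cmod order_trans by blast
  also have "\<dots> \<le> nrm H \<xi> * nrm H \<xi>" by (intro mult_right_mono * H.nrm_nonneg \<xi>)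
  finally have "(nrm H (\<pi> x \<xi>))\<^sup>2 \<le> t\<^sup>2 * (nrm H \<xi> * nrm H \<xi>)" unfolding eq by (rule mult_left_mono) simp
  then have "(nrm H (\<pi> x \<xi>))\<^sup>2 \<le> (t * nrm H \<xi>)\<^sup>2" by (simp add: power2_eq_square mult_ac)
  then show ?thesis unfolding t_def[symmetric] using t H.nrm_nonneg[OF \<xi>] by (meson power2_le_imp_le mult_nonneg_nonneg less_imp_le)
qed

lemma op_norm_rep_le: "x \<in> carrier A \<Longrightarrow> op_norm H H (\<pi> x) \<le> nrm A x"
  by (intro op_norm_le) (auto intro: A.nrm_nonneg rep_contractive_vec H.cnormed_space_axioms)

text \<open>
  Injectivity says that the functionals \<open>vector_fun \<xi>\<close> form a faithful family, and \<open>s = \<parallel>\<pi>(adj x \<star> x)\<parallel>\<close> is an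
  admissible constant in \<open>nrm_le_if_pos_fun\<close>. Finally \<open>s \<le> \<parallel>x\<parallel> \<parallel>\<pi>(x)\<parallel>\<close> since \<open>\<pi>\<close> is contractive.
\<close>

lemma nrm_le_op_norm_rep:
  assumes inj: "inj_on \<pi> (carrier A)" and x: "x \<in> carrier A"
  shows "nrm A x \<le> op_norm H H (\<pi> x)"
proof -
  let ?a = "star A x \<otimes>\<^bsub>A\<^esub> x"
  have a: "?a \<in> carrier A" "star A ?a = ?a" using x by (simp_all add: A.star_mult A.star_star)
  note opn = bounded_linear_map_op_norm[OF H.cnormed_space_axioms H.cnormed_space_axioms rep_linear]
  let ?s = "op_norm H H (\<pi> ?a)"
  have "nrm A ?a \<le> ?s"
  proof (rule A.nrm_le_if_pos_fun[OF a opn(2)[OF a(1)], where F = "vector_fun ` carrier H"])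
    show "A.pos_fun f" if "f \<in> vector_fun ` carrier H" for f using that pos_fun_vector_fun by blast
  next
    fix z assume z: "z \<in> carrier A" and 0: "\<And>f. f \<in> vector_fun ` carrier H \<Longrightarrow> f (star A z \<otimes>\<^bsub>A\<^esub> z) = 0"
    have "\<pi> z = \<pi> \<zero>\<^bsub>A\<^esub>"
    proof (rule extensionalityI)
      fix \<xi> assume \<xi>: "\<xi> \<in> carrier H"
      have "nrm H (\<pi> z \<xi>) = 0" using 0[of "vector_fun \<xi>"] \<xi> vector_fun_sq[OF z \<xi>] by simp
      then have "\<pi> z \<xi> = \<zero>\<^bsub>H\<^esub>" using H.nrm_eq_0 rep_in[OF z \<xi>] by simp
      moreover have "\<pi> \<zero>\<^bsub>A\<^esub> \<xi> = \<zero>\<^bsub>H\<^esub>" using rep_smult[of "\<zero>\<^bsub>A\<^esub>" \<xi> 0] \<xi> rep_in[of "\<zero>\<^bsub>A\<^esub>" \<xi>] by simp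
      ultimately show "\<pi> z \<xi> = \<pi> \<zero>\<^bsub>A\<^esub> \<xi>" by simp
    qed (use rep_bounded[OF z] rep_bounded[of "\<zero>\<^bsub>A\<^esub>"] in \<open>auto simp: bounded_ops_def\<close>)
    then show "z = \<zero>\<^bsub>A\<^esub>" using inj z by (simp add: inj_on_def)
  next
    fix f z assume f: "f \<in> vector_fun ` carrier H" and z: "z \<in> carrier A"
    then obtain \<xi> where \<xi>: "\<xi> \<in> carrier H" and f: "f = vector_fun \<xi>" by blast
    have "nrm H (\<pi> ?a (\<pi> z \<xi>)) \<le> ?s * nrm H (\<pi> z \<xi>)" by (rule opn(1)[OF a(1) rep_in[OF z \<xi>]])
    then have "(nrm H (\<pi> (?a \<otimes>\<^bsub>A\<^esub> z) \<xi>))\<^sup>2 \<le> (?s * nrm H (\<pi> z \<xi>))\<^sup>2"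
      unfolding rep_mult[OF a(1) z \<xi>] by (intro power_mono H.nrm_nonneg rep_in a z \<xi>)
    then show "f (star A (?a \<otimes>\<^bsub>A\<^esub> z) \<otimes>\<^bsub>A\<^esub> (?a \<otimes>\<^bsub>A\<^esub> z)) \<le> ?s\<^sup>2 * f (star A z \<otimes>\<^bsub>A\<^esub> z)"
      unfolding f vector_fun_sq[OF A.alg_mult_closed[OF a(1) z] \<xi>] vector_fun_sq[OF z \<xi>] by (simp add: power_mult_distrib)
  qed
  also have "?s \<le> nrm A x * op_norm H H (\<pi> x)"
  proof (rule op_norm_le[OF H.cnormed_space_axioms])
    show "0 \<le> nrm A x * op_norm H H (\<pi> x)" by (intro mult_nonneg_nonneg A.nrm_nonneg x opn(2))
    fix \<xi> assume \<xi>: "\<xi> \<in> carrier H"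
    have "nrm H (\<pi> ?a \<xi>) \<le> nrm A (star A x) * nrm H (\<pi> x \<xi>)"
      using x \<xi> by (simp only: rep_mult A.star_closed) (intro rep_contractive_vec A.star_closed rep_in)
    also have "\<dots> \<le> nrm A x * (op_norm H H (\<pi> x) * nrm H \<xi>)"
      using x by (simp add: mult_left_mono A.nrm_nonneg opn(1)[OF x \<xi>])
    finally show "nrm H (\<pi> ?a \<xi>) \<le> nrm A x * op_norm H H (\<pi> x) * nrm H \<xi>" by (simp add: mult_ac)
  qed
  finally have le: "nrm A x * nrm A x \<le> nrm A x * op_norm H H (\<pi> x)"
    by (simp add: A.cstar_identity[OF x] power2_eq_square)
  show ?thesis
  proof (cases "nrm A x = 0")
    case False
    then have "nrm A x > 0" using A.nrm_nonneg[OF x] by simp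
    then show ?thesis using le by simp
  qed (use opn(2)[OF x] in simp)
qed
end

lemma faithful_rep_isometric:
  assumes "cstar_algebra A" "faithful_rep A H \<pi>" "x \<in> carrier A"
  shows "op_norm H H (\<pi> x) = nrm A x"
proof -
  interpret A: cstar_algebra A by fact
  interpret H: chilbert_space H using assms(2) by (simp add: faithful_rep_def)
  interpret cstar_rep A H \<pi> by unfold_locales (use assms(2) in \<open>simp add: faithful_rep_def\<close>)
  show ?thesis using op_norm_rep_le[OF assms(3)] nrm_le_op_norm_rep[OF _ assms(3)] assms(2)
    by (simp add: faithful_rep_def)
qed

section \<open>Subspaces and eigenvectors\<close>

context cnormed_space begin
abbreviation subsp :: "'a set \<Rightarrow> bool" where "subsp W \<equiv> submodule class_ring W V"

lemma subspI:
  assumes "W \<subseteq> carrier V" "\<zero>\<^bsub>V\<^esub> \<in> W" "\<And>x y. x \<in> W \<Longrightarrow> y \<in> W \<Longrightarrow> x \<boxplus> y \<in> W" "\<And>c x. x \<in> W \<Longrightarrow> c \<cdot> x \<in> W"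
  shows "subsp W"
  by (intro submodule.intro module_axioms) (use assms in auto)

lemma cnormed_space_subsp:
  assumes "subsp W" shows "cnormed_space (V\<lparr>carrier := W\<rparr>)"
proof -
  have sub: "W \<subseteq> carrier V" using assms by (rule submodule.subset)
  have vs: "vectorspace class_ring (V\<lparr>carrier := W\<rparr>)"
    by (rule subspace_is_vs) (intro subspace.intro assms vectorspace_axioms)
  show ?thesis
    by (intro cnormed_space.intro cnormed_space_axioms.intro vs)
       (use sub in \<open>auto simp: nrm_nonneg nrm_eq_0 nrm_smult nrm_triangle subsetD\<close>)
qed

lemma sub_subsp:
  assumes W: "subsp W" and x: "x \<in> W" "y \<in> W"
  shows "x \<ominus>\<^bsub>V\<lparr>carrier := W\<rparr>\<^esub> y = x \<boxminus> y"
proof -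
  have sub: "W \<subseteq> carrier V" using W by (rule submodule.subset)
  interpret W: cnormed_space "V\<lparr>carrier := W\<rparr>" by (rule cnormed_space_subsp[OF W])
  have "x \<in> carrier V" "y \<in> carrier V" using x sub by auto
  then show ?thesis using W.sub_eq[of x y] sub_eq[of x y] x by simp
qed

text \<open>
  Linear independence in \<open>W\<close> is the same as in \<open>V\<close>, so a maximal independent subset of \<open>W\<close> exists.
\<close>

lemma subsp_fin_dim:
  assumes fd: "fin_dim" and W: "subsp W"
  shows "vectorspace.fin_dim class_ring (V\<lparr>carrier := W\<rparr>)"
proof -
  have sub: "W \<subseteq> carrier V" using W by (rule submodule.subset)
  interpret W: cnormed_space "V\<lparr>carrier := W\<rparr>" by (rule cnormed_space_subsp[OF W])
  have li: "W.lin_dep S \<longleftrightarrow> lin_dep S" if "S \<subseteq> W" for S using span_li_not_depend(2)[OF that W] .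
  have "\<exists>S. finite S \<and> maximal S (\<lambda>S. S \<subseteq> carrier (V\<lparr>carrier := W\<rparr>) \<and> \<not> W.lin_dep S)"
  proof (rule maximal_exists[where B = "{}" and N = dim])
    fix S assume S: "S \<subseteq> carrier (V\<lparr>carrier := W\<rparr>) \<and> \<not> W.lin_dep S"
    then have "S \<subseteq> W" by simp
    then show "finite S \<and> card S \<le> dim" using li_le_dim[OF fd, of S] li[of S] S sub by auto
  qed (auto simp: W.lin_dep_def)
  then obtain S where S: "finite S" "maximal S (\<lambda>S. S \<subseteq> carrier (V\<lparr>carrier := W\<rparr>) \<and> \<not> W.lin_dep S)" by blast
  from W.max_li_is_basis[OF S(2)] S(1) show ?thesis by (auto simp: W.fin_dim_def W.basis_def)
qed

text \<open>
  A measure for inductions over subspaces of a finite-dimensional space. It is the dimension, in a form in which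
  subspaces need not be viewed as spaces of their own.
\<close>

definition sdim :: "'a set \<Rightarrow> nat" where
  "sdim W = Max {card S | S. S \<subseteq> W \<and> lin_indpt S}"

lemma sdim_less:
  assumes fd: "fin_dim" and W': "subsp W'" and W: "W \<subseteq> carrier V" and less: "W' \<subset> W"
  shows "sdim W' < sdim W"
proof -
  have sub: "W' \<subseteq> carrier V" using W less by auto
  let ?M = "\<lambda>W. {card S | S. S \<subseteq> W \<and> lin_indpt S}"
  have fin: "finite (?M U)" if "U \<subseteq> carrier V" for U
    by (rule finite_subset[of _ "{..dim}"]) (use li_le_dim[OF fd] that in auto)
  have "0 \<in> ?M W'" by (auto intro!: exI[of _ "{}"] simp: lin_dep_def)
  then have "sdim W' \<in> ?M W'" unfolding sdim_def by (intro Max_in fin sub) auto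
  then obtain S where S: "S \<subseteq> W'" "lin_indpt S" "sdim W' = card S" by auto
  have finS: "finite S" using li_le_dim[OF fd, of S] S sub by auto
  obtain w where w: "w \<in> W" "w \<notin> W'" using less by auto
  have "span S \<subseteq> W'" by (rule span_is_subset[OF S(1) W'])
  then have "w \<notin> span S" using w by auto
  then have "lin_indpt (S \<union> {w})"
    using lin_dep_iff_in_span[of S w] S sub w W by auto
  moreover have "w \<notin> S" using w S by auto
  ultimately have "card (S \<union> {w}) \<in> ?M W" using S less w by auto
  then have "card (S \<union> {w}) \<le> sdim W" unfolding sdim_def by (intro Max_ge fin W) auto
  moreover have "card (S \<union> {w}) = Suc (card S)" using finS \<open>w \<notin> S\<close> by simp
  ultimately show ?thesis using S by simp
qed

text \<open>
  Stated for a sequence, repetitions allowed, since it is applied to the iterates of an operator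
  on a vector.
\<close>

lemma sequence_linearly_dependent:
  assumes fd: "fin_dim" and u: "\<And>i. u i \<in> carrier V"
  shows "\<exists>c. (\<exists>i\<le>dim. c i \<noteq> 0) \<and> (\<Oplus>\<^bsub>V\<^esub>i\<in>{..dim}. c i \<cdot> u i) = \<zero>\<^bsub>V\<^esub>"
proof (cases "inj_on u {..dim}")
  case True
  then have "card (u ` {..dim}) = Suc dim" by (simp add: card_image)
  then have "lin_dep (u ` {..dim})" using li_le_dim(2)[OF fd, of "u ` {..dim}"] u by force
  then obtain a v where a: "lincomb a (u ` {..dim}) = \<zero>\<^bsub>V\<^esub>" "v \<in> u ` {..dim}" "a v \<noteq> 0"
    using finite_lin_dep[of "u ` {..dim}"] u by auto
  have "(\<Oplus>\<^bsub>V\<^esub>i\<in>{..dim}. a (u i) \<cdot> u i) = \<zero>\<^bsub>V\<^esub>"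
    using a(1) True u unfolding lincomb_def by (subst (asm) M.finsum_reindex) auto
  then show ?thesis using a by (intro exI[of _ "\<lambda>i. a (u i)"]) auto
next
  case False
  then obtain i j where ij: "i \<le> dim" "j \<le> dim" "u i = u j" "i \<noteq> j" by (auto simp: inj_on_def)
  define c :: "nat \<Rightarrow> complex" where "c k = (if k = i then 1 else if k = j then -1 else 0)" for k
  have split: "{..dim} = insert i (insert j ({..dim} - {i,j}))" using ij by auto
  have "(\<Oplus>\<^bsub>V\<^esub>k\<in>{..dim} - {i,j}. c k \<cdot> u k) = (\<Oplus>\<^bsub>V\<^esub>k\<in>{..dim} - {i,j}. \<zero>\<^bsub>V\<^esub>)"
    by (rule M.finsum_cong') (use u in \<open>auto simp: c_def\<close>)
  then have 0: "(\<Oplus>\<^bsub>V\<^esub>k\<in>{..dim} - {i,j}. c k \<cdot> u k) = \<zero>\<^bsub>V\<^esub>" by simp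
  have "(\<Oplus>\<^bsub>V\<^esub>k\<in>{..dim}. c k \<cdot> u k) = c i \<cdot> u i \<boxplus> (c j \<cdot> u j \<boxplus> (\<Oplus>\<^bsub>V\<^esub>k\<in>{..dim} - {i,j}. c k \<cdot> u k))"
  proof -
    have "(\<Oplus>\<^bsub>V\<^esub>k\<in>{..dim}. c k \<cdot> u k) = c i \<cdot> u i \<boxplus> (\<Oplus>\<^bsub>V\<^esub>k\<in>insert j ({..dim} - {i,j}). c k \<cdot> u k)"
      by (subst split, subst M.finsum_insert) (use u ij in auto)
    also have "(\<Oplus>\<^bsub>V\<^esub>k\<in>insert j ({..dim} - {i,j}). c k \<cdot> u k) = c j \<cdot> u j \<boxplus> (\<Oplus>\<^bsub>V\<^esub>k\<in>{..dim} - {i,j}. c k \<cdot> u k)"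
      by (subst M.finsum_insert) (use u ij in auto)
    finally show ?thesis .
  qed
  also have "\<dots> = u i \<boxminus> u i" unfolding 0 using ij u by (simp add: c_def sub_eq)
  finally show ?thesis using ij u by (intro exI[of _ c]) (auto simp: c_def sub_self)
qed

text \<open>
  If the polynomial \<open>q\<close> in \<open>T\<close> annihilates \<open>v \<noteq> 0\<close>, split off a root, \<open>q = (X - \<mu>) r\<close>. Either \<open>v\<close> is an eigenvector
  for \<open>\<mu>\<close>, or \<open>w = T v - \<mu> v\<close> is a nonzero vector annihilated by \<open>r\<close>, which has smaller degree. The common length \<open>d\<close>
  of the sums decouples them from the degrees.
\<close>

lemma eigenvector_if_annihilated:
  assumes Tin: "\<And>x. x \<in> carrier V \<Longrightarrow> T x \<in> carrier V"
    and Tadd: "\<And>x y. x \<in> carrier V \<Longrightarrow> y \<in> carrier V \<Longrightarrow> T (x \<boxplus> y) = T x \<boxplus> T y"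
    and Tsm: "\<And>c x. x \<in> carrier V \<Longrightarrow> T (c \<cdot> x) = c \<cdot> T x"
    and W: "subsp W" "\<And>x. x \<in> W \<Longrightarrow> T x \<in> W"
    and v: "v \<in> W" "v \<noteq> \<zero>\<^bsub>V\<^esub>"
    and q: "q \<noteq> 0" "(\<Oplus>\<^bsub>V\<^esub>i\<in>{..d}. coeff q i \<cdot> (T ^^ i) v) = \<zero>\<^bsub>V\<^esub>" "degree q \<le> d"
  shows "\<exists>\<mu>. \<exists>w\<in>W. w \<noteq> \<zero>\<^bsub>V\<^esub> \<and> T w = \<mu> \<cdot> w"
  using v q
proof (induction "degree q" arbitrary: q v)
  case 0
  then obtain a where a: "q = [:a:]" by (metis degree_eq_zeroE)
  have sub: "W \<subseteq> carrier V" using W(1) by (rule submodule.subset)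
  have Ti: "(T ^^ i) v \<in> carrier V" for i using 0 sub Tin by (induction i) auto
  have "(\<Oplus>\<^bsub>V\<^esub>i\<in>{..d}. coeff q i \<cdot> (T ^^ i) v) = (\<Oplus>\<^bsub>V\<^esub>i\<in>{..d}. if 0 = i then a \<cdot> (T ^^ i) v else \<zero>\<^bsub>V\<^esub>)"
    by (rule M.finsum_cong') (use Ti Ti[of 0] Tin in \<open>auto simp: a coeff_pCons split: nat.splits\<close>)
  also have "\<dots> = a \<cdot> v"
    using M.finsum_singleton[of 0 "{..d}" "\<lambda>i. a \<cdot> (T ^^ i) v"] Ti by simp
  finally have "a \<cdot> v = \<zero>\<^bsub>V\<^esub>" using "0.prems"(4) by simp
  then have "nrm V (a \<cdot> v) = 0" by (simp only: nrm_zero)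
  then have "a = 0" using nrm_smult[of v a] nrm_eq_0[of v] 0 sub by auto
  then show ?case using 0 a by simp
next
  case (Suc n)
  have sub: "W \<subseteq> carrier V" using W(1) by (rule submodule.subset)
  have vV: "v \<in> carrier V" using Suc sub by auto
  have Ti: "(T ^^ i) x \<in> carrier V" if "x \<in> carrier V" for i x using that Tin by (induction i) auto
  have "\<not> constant (poly q)" using Suc(2) by (simp add: constant_degree)
  then obtain \<mu> where "poly q \<mu> = 0" using fundamental_theorem_of_algebra by blast
  then obtain r where r: "q = [:-\<mu>, 1:] * r" by (auto simp: poly_eq_0_iff_dvd dvd_def)
  have r0: "r \<noteq> 0" using Suc r by auto
  have dr: "degree r = n" proof -
    have "degree q = Suc (degree r)" unfolding r using r0 by (subst degree_mult_eq) auto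
    then show ?thesis using Suc(2) by simp
  qed
  define w where "w = T v \<boxplus> (-\<mu>) \<cdot> v"
  have wW: "w \<in> W" unfolding w_def using W Suc(3) submodule.m_closed[OF W(1)] submodule.smult_closed[OF W(1)] by simp
  show ?case
  proof (cases "w = \<zero>\<^bsub>V\<^esub>")
    case True
    have "T v = w \<boxplus> \<mu> \<cdot> v"
      unfolding w_def using vV Tin smult_add_left[of v "-\<mu>" \<mu>] by (simp add: M.a_assoc)
    then have "T v = \<mu> \<cdot> v" using True vV by simp
    then show ?thesis using Suc by blast
  next
    case False
    have Tw: "(T ^^ i) w = (T ^^ Suc i) v \<boxplus> (-\<mu>) \<cdot> (T ^^ i) v" for i
      by (induction i) (use vV Ti Tin in \<open>auto simp: w_def Tadd Tsm\<close>)
    have S1: "(\<Oplus>\<^bsub>V\<^esub>i\<in>{..d}. coeff r i \<cdot> (T ^^ i) w) = (\<Oplus>\<^bsub>V\<^esub>i\<in>{..d}. coeff r i \<cdot> (T ^^ Suc i) v) \<boxplus> (\<Oplus>\<^bsub>V\<^esub>i\<in>{..d}. (- \<mu> * coeff r i) \<cdot> (T ^^ i) v)"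
    proof -
      have "(\<Oplus>\<^bsub>V\<^esub>i\<in>{..d}. coeff r i \<cdot> (T ^^ i) w) = (\<Oplus>\<^bsub>V\<^esub>i\<in>{..d}. coeff r i \<cdot> (T ^^ Suc i) v \<boxplus> (- \<mu> * coeff r i) \<cdot> (T ^^ i) v)"
        by (rule M.finsum_cong') (use Ti[OF vV] Tin in \<open>auto simp: Tw smult_add_right smult_smult mult.commute\<close>)
      then show ?thesis using Ti[OF vV] Tin by (simp add: M.finsum_addf)
    qed
    have S2: "(\<Oplus>\<^bsub>V\<^esub>i\<in>{..d}. coeff q i \<cdot> (T ^^ i) v) = (\<Oplus>\<^bsub>V\<^esub>i\<in>{..d}. coeff (pCons 0 r) i \<cdot> (T ^^ i) v) \<boxplus> (\<Oplus>\<^bsub>V\<^esub>i\<in>{..d}. (- \<mu> * coeff r i) \<cdot> (T ^^ i) v)"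
    proof -
      have c: "coeff q i = coeff (pCons 0 r) i + (- \<mu> * coeff r i)" for i unfolding r by simp
      have "(\<Oplus>\<^bsub>V\<^esub>i\<in>{..d}. coeff q i \<cdot> (T ^^ i) v) = (\<Oplus>\<^bsub>V\<^esub>i\<in>{..d}. coeff (pCons 0 r) i \<cdot> (T ^^ i) v \<boxplus> (- \<mu> * coeff r i) \<cdot> (T ^^ i) v)"
        by (rule M.finsum_cong') (use Ti[OF vV] in \<open>auto simp only: c smult_add_left smult_in M.add.m_closed\<close>)
      then show ?thesis using Ti[OF vV] by (simp add: M.finsum_addf)
    qed
    have S3: "(\<Oplus>\<^bsub>V\<^esub>i\<in>{..d}. coeff (pCons 0 r) i \<cdot> (T ^^ i) v) = (\<Oplus>\<^bsub>V\<^esub>i\<in>{..d}. coeff r i \<cdot> (T ^^ Suc i) v)"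
    proof -
      have d: "d > 0" using Suc(2,7) by simp
      then obtain d' where d': "d = Suc d'" by (cases d) auto
      have top: "coeff r d = 0" using Suc(2,7) dr by (intro coeff_eq_0) simp
      have c: "(\<Oplus>\<^bsub>V\<^esub>i\<in>{..d'}. coeff r i \<cdot> (T ^^ Suc i) v) \<in> carrier V"
        by (intro M.finsum_closed) (use Ti[OF vV] in \<open>auto simp del: funpow.simps\<close>)
      have "(\<Oplus>\<^bsub>V\<^esub>i\<in>{..d}. coeff (pCons 0 r) i \<cdot> (T ^^ i) v) = (\<Oplus>\<^bsub>V\<^esub>i\<in>{..d'}. coeff r i \<cdot> (T ^^ Suc i) v)"
        unfolding d' by (subst M.finsum_Suc2) (use Ti[OF vV] vV c in \<open>auto simp del: funpow.simps(2)\<close>)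
      also have "\<dots> = (\<Oplus>\<^bsub>V\<^esub>i\<in>{..d}. coeff r i \<cdot> (T ^^ Suc i) v)"
        unfolding d' by (subst M.finsum_Suc) (use Ti[OF vV] vV c top in \<open>auto simp: d' simp del: funpow.simps(2)\<close>)
      finally show ?thesis .
    qed
    have "(\<Oplus>\<^bsub>V\<^esub>i\<in>{..d}. coeff r i \<cdot> (T ^^ i) w) = \<zero>\<^bsub>V\<^esub>" using Suc.prems(4) unfolding S1 S2 S3 .
    then show ?thesis using Suc(1)[OF dr[symmetric] wW False r0] Suc(2,7) dr by simp
  qed
qed

lemma eigenvector_exists:
  assumes fd: "fin_dim" and Tin: "\<And>x. x \<in> carrier V \<Longrightarrow> T x \<in> carrier V"
    and Tadd: "\<And>x y. x \<in> carrier V \<Longrightarrow> y \<in> carrier V \<Longrightarrow> T (x \<boxplus> y) = T x \<boxplus> T y"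
    and Tsm: "\<And>c x. x \<in> carrier V \<Longrightarrow> T (c \<cdot> x) = c \<cdot> T x"
    and W: "subsp W" "\<And>x. x \<in> W \<Longrightarrow> T x \<in> W" and v: "v \<in> W" "v \<noteq> \<zero>\<^bsub>V\<^esub>"
  shows "\<exists>\<mu>. \<exists>w\<in>W. w \<noteq> \<zero>\<^bsub>V\<^esub> \<and> T w = \<mu> \<cdot> w"
proof -
  have vV: "v \<in> carrier V" using v submodule.subset[OF W(1)] by auto
  have Ti: "(T ^^ i) v \<in> carrier V" for i using vV Tin by (induction i) auto
  obtain c where c: "\<exists>i\<le>dim. c i \<noteq> 0" "(\<Oplus>\<^bsub>V\<^esub>i\<in>{..dim}. c i \<cdot> (T ^^ i) v) = \<zero>\<^bsub>V\<^esub>"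
    using sequence_linearly_dependent[OF fd, of "\<lambda>i. (T ^^ i) v"] Ti by blast
  define q where "q = Abs_poly (\<lambda>i. if i \<le> dim then c i else 0)"
  have cq: "coeff q i = (if i \<le> dim then c i else 0)" for i
    unfolding q_def by (subst coeff_Abs_poly[where n = dim]) auto
  have "(\<Oplus>\<^bsub>V\<^esub>i\<in>{..dim}. coeff q i \<cdot> (T ^^ i) v) = (\<Oplus>\<^bsub>V\<^esub>i\<in>{..dim}. c i \<cdot> (T ^^ i) v)"
    by (rule M.finsum_cong') (use Ti in \<open>auto simp: cq\<close>)
  moreover have "q \<noteq> 0" using c(1) cq by (metis coeff_0)
  moreover have "degree q \<le> dim" by (rule degree_le) (simp add: cq)
  ultimately show ?thesis using eigenvector_if_annihilated[OF Tin Tadd Tsm W v, of q dim] c(2) by simp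
qed
end

section \<open>Moments of random signs\<close>

definition signs :: "'i set \<Rightarrow> ('i \<Rightarrow> real) set" where "signs S = PiE S (\<lambda>_. {-1, 1})"

definition words :: "'i set \<Rightarrow> nat \<Rightarrow> 'i list set" where "words S d = {w. set w \<subseteq> S \<and> length w = d}"

abbreviation weight :: "('i \<Rightarrow> real) \<Rightarrow> 'i list \<Rightarrow> real" where "weight \<epsilon> w \<equiv> prod_list (map \<epsilon> w)"

lemma card_signs: "finite S \<Longrightarrow> card (signs S) = 2 ^ card S"
  unfolding signs_def by (simp add: card_PiE numeral_2_eq_2)

lemma sum_words_append:
  fixes f :: "'i list \<Rightarrow> 'i list \<Rightarrow> 'b :: comm_monoid_add"
  shows "(\<Sum>w\<in>words S (d + e). f (take d w) (drop d w)) = (\<Sum>u\<in>words S d. \<Sum>v\<in>words S e. f u v)"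
proof -
  have "bij_betw (\<lambda>(u, v). u @ v) (words S d \<times> words S e) (words S (d + e))"
    by (rule bij_betwI[where g = "\<lambda>w. (take d w, drop d w)"])
       (auto simp: words_def dest: in_set_takeD in_set_dropD)
  from sum.reindex_bij_betw[OF this, of "\<lambda>w. f (take d w) (drop d w)"]
  have "(\<Sum>w\<in>words S (d + e). f (take d w) (drop d w)) = (\<Sum>(u, v)\<in>words S d \<times> words S e. f (take d (u @ v)) (drop d (u @ v)))"
    by (simp add: case_prod_unfold)
  also have "\<dots> = (\<Sum>(u, v)\<in>words S d \<times> words S e. f u v)" by (rule sum.cong) (auto simp: words_def)
  finally show ?thesis by (simp add: sum.cartesian_product)
qed

lemma sum_words_1: "(\<Sum>w\<in>words S 1. f w) = (\<Sum>i\<in>S. f [i])"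
proof -
  have "words S 1 = (\<lambda>i. [i]) ` S" by (auto simp: words_def length_Suc_conv)
  then show ?thesis by (simp add: sum.reindex inj_on_def)
qed

lemma sum_power_words: "(\<Sum>i\<in>S. \<epsilon> i) ^ d = (\<Sum>w\<in>words S d. weight \<epsilon> w)"
proof (induction d)
  case 0
  have "words S 0 = {[]}" by (auto simp: words_def)
  then show ?case by simp
next
  case (Suc d)
  have "(\<Sum>w\<in>words S (1 + d). weight \<epsilon> w) = (\<Sum>w\<in>words S (1 + d). weight \<epsilon> (take 1 w) * weight \<epsilon> (drop 1 w))"
    by (rule sum.cong) (auto simp flip: prod_list.append map_append)
  also have "\<dots> = (\<Sum>u\<in>words S 1. \<Sum>v\<in>words S d. weight \<epsilon> u * weight \<epsilon> v)" by (rule sum_words_append)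
  also have "\<dots> = (\<Sum>i\<in>S. \<epsilon> i) * (\<Sum>v\<in>words S d. weight \<epsilon> v)"
    by (subst sum_words_1) (simp add: sum_product)
  finally show ?case using Suc by simp
qed

lemma weight_eq_prod:
  assumes "finite S" "set w \<subseteq> S" shows "weight \<epsilon> w = (\<Prod>i\<in>S. \<epsilon> i ^ count_list w i)"
  using assms(2)
proof (induction w)
  case (Cons x w)
  have "(\<Prod>i\<in>S. \<epsilon> i ^ count_list (x # w) i) = (\<Prod>i\<in>S. (if i = x then \<epsilon> i else 1) * \<epsilon> i ^ count_list w i)"
    by (rule prod.cong) auto
  also have "\<dots> = \<epsilon> x * (\<Prod>i\<in>S. \<epsilon> i ^ count_list w i)"
    using Cons assms(1) by (simp add: prod.distrib prod.delta)
  finally show ?case using Cons by simp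
qed simp

text \<open>
  By independence the sum factors over the indices, and the factor of an index is zero or two according
  to the parity of its number of occurrences in the word.
\<close>

lemma sum_weight_signs_nonneg:
  assumes "finite S" "set w \<subseteq> S" shows "0 \<le> (\<Sum>\<epsilon>\<in>signs S. weight \<epsilon> w)"
proof -
  have "(\<Sum>\<epsilon>\<in>signs S. weight \<epsilon> w) = (\<Prod>i\<in>S. \<Sum>y\<in>{-1, 1::real}. y ^ count_list w i)"
    unfolding signs_def weight_eq_prod[OF assms] by (rule prod_sum_PiE[symmetric]) (use assms in auto)
  also have "\<dots> \<ge> 0" by (intro prod_nonneg) (auto simp: minus_one_power_iff)
  finally show ?thesis .
qed

text \<open>
  Independence again, now for the exponential moments.
\<close>

lemma sum_exp_signs:
  assumes "finite S"
  shows "(\<Sum>\<epsilon>\<in>signs S. exp (t * (\<Sum>i\<in>S. \<epsilon> i))) = (exp t + exp (- t)) ^ card S"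
proof -
  have "(\<Sum>\<epsilon>\<in>signs S. exp (t * (\<Sum>i\<in>S. \<epsilon> i))) = (\<Sum>\<epsilon>\<in>signs S. \<Prod>i\<in>S. exp (t * \<epsilon> i))"
    using assms by (simp add: sum_distrib_left exp_sum)
  also have "\<dots> = (\<Prod>i\<in>S. \<Sum>y\<in>{-1, 1::real}. exp (t * y))"
    unfolding signs_def by (rule prod_sum_PiE[symmetric]) (use assms in auto)
  also have "\<dots> = (exp t + exp (- t)) ^ card S" by (simp add: add.commute)
  finally show ?thesis .
qed

lemma exp_plus_exp_minus_le:
  fixes t :: real assumes "0 \<le> t" "t \<le> 1" shows "exp t + exp (- t) \<le> 2 * exp (t\<^sup>2)"
proof -
  have 1: "exp t \<le> 1 + t + t\<^sup>2" by (rule exp_bound) fact+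
  have "exp (- t) = 1 / exp t" by (simp add: exp_minus field_simps)
  also have "\<dots> \<le> 1 / (1 + t)" using assms exp_ge_add_one_self[of t] by (intro divide_left_mono) auto
  also have "\<dots> \<le> 1 - t + t\<^sup>2" using assms by (simp add: field_simps power2_eq_square)
  finally have "exp t + exp (- t) \<le> 2 * (1 + t\<^sup>2)" using 1 by simp
  also have "\<dots> \<le> 2 * exp (t\<^sup>2)" by (intro mult_left_mono exp_ge_add_one_self) simp
  finally show ?thesis .
qed

lemma even_power_le_exp:
  fixes y :: real shows "y ^ (2 * d) \<le> fact (2 * d) * (exp y + exp (- y))"
proof -
  have *: "z ^ k / fact k \<le> exp z" if "z \<ge> 0" for z :: real and k
  proof -
    have "(\<Sum>n\<in>{k}. z ^ n /\<^sub>R fact n) \<le> (\<Sum>n. z ^ n /\<^sub>R fact n)"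
      by (rule sum_le_suminf[OF summable_exp_generic]) (use that in auto)
    then show ?thesis by (simp add: exp_def field_simps)
  qed
  have "y ^ (2 * d) = \<bar>y\<bar> ^ (2 * d)" by (simp add: power_even_abs)
  also have "\<dots> \<le> fact (2 * d) * exp \<bar>y\<bar>" using *[of "\<bar>y\<bar>" "2 * d"] by (simp add: field_simps)
  also have "\<dots> \<le> fact (2 * d) * (exp y + exp (- y))" by (intro mult_left_mono) (auto simp: abs_if)
  finally show ?thesis .
qed

text \<open>
  Chernoff's method: a power is dominated by the exponentials \<open>exp (\<plusminus> t y)\<close>, whose
  means are at most \<open>exp (n t\<^sup>2)\<close>; the choice \<open>t\<^sup>2 = 2 d / n\<close> is of the optimal order. The hypothesis
  \<open>2 * d \<le> card S\<close> ensures \<open>t \<le> 1\<close>.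
\<close>

lemma rademacher_moment:
  assumes S: "finite S" and d: "d > 0" "2 * d \<le> card S"
  shows "(\<Sum>\<epsilon>\<in>signs S. (\<Sum>i\<in>S. \<epsilon> i) ^ (2 * d)) \<le> 2 * 2 ^ card S * (2 * real d * real (card S) * exp 2) ^ d"
proof -
  let ?n = "real (card S)" and ?d = "real d"
  \<comment> \<open>up to a constant factor the minimiser of \<open>exp (n t\<^sup>2) / t^(2 d)\<close>\<close>
  define t where "t = sqrt (2 * ?d / ?n)"
  have n: "?n > 0" using d by simp
  have t2: "t\<^sup>2 = 2 * ?d / ?n" using n by (simp add: t_def)
  have t: "0 < t" "t \<le> 1" using d n by (simp_all add: t_def)
  have "t ^ (2 * d) * (\<Sum>\<epsilon>\<in>signs S. (\<Sum>i\<in>S. \<epsilon> i) ^ (2 * d)) = (\<Sum>\<epsilon>\<in>signs S. (t * (\<Sum>i\<in>S. \<epsilon> i)) ^ (2 * d))"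
    by (subst sum_distrib_left) (simp only: power_mult_distrib)
  also have "\<dots> \<le> (\<Sum>\<epsilon>\<in>signs S. fact (2 * d) * (exp (t * (\<Sum>i\<in>S. \<epsilon> i)) + exp ((- t) * (\<Sum>i\<in>S. \<epsilon> i))))"
    by (intro sum_mono order_trans[OF even_power_le_exp]) simp
  also have "\<dots> = fact (2 * d) * (2 * (exp t + exp (- t)) ^ card S)"
    using sum_exp_signs[OF S, of t] sum_exp_signs[OF S, of "- t"]
    by (simp add: sum.distrib add.commute flip: sum_distrib_left)
  also have "\<dots> \<le> (2 * ?d) ^ (2 * d) * (2 * (2 * exp (t\<^sup>2)) ^ card S)"
  proof (intro mult_mono power_mono exp_plus_exp_minus_le)
    show "fact (2 * d) \<le> (2 * ?d) ^ (2 * d)"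
      using fact_le_power[of "2 * d", where 'a = real] by simp
  qed (use t in auto)
  also have "(2 * exp (t\<^sup>2)) ^ card S = 2 ^ card S * exp (2 * ?d)"
    using n by (simp add: power_mult_distrib t2 flip: exp_of_nat_mult)
  finally have le: "t ^ (2 * d) * (\<Sum>\<epsilon>\<in>signs S. (\<Sum>i\<in>S. \<epsilon> i) ^ (2 * d)) \<le> (2 * ?d) ^ (2 * d) * (2 * (2 ^ card S * exp (2 * ?d)))" .
  have eq: "t ^ (2 * d) * (2 * 2 ^ card S * (2 * ?d * ?n * exp 2) ^ d) = (2 * ?d) ^ (2 * d) * (2 * (2 ^ card S * exp (2 * ?d)))"
  proof -
    have e: "exp (2 * ?d) = exp 2 ^ d" by (simp add: mult.commute flip: exp_of_nat_mult)
    have "t ^ (2 * d) * (2 * ?d * ?n * exp 2) ^ d = (t\<^sup>2 * (2 * ?d * ?n * exp 2)) ^ d"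
      by (simp add: power_mult power_mult_distrib)
    also have "t\<^sup>2 * (2 * ?d * ?n * exp 2) = (2 * ?d)\<^sup>2 * exp 2" unfolding t2 using n by (simp add: power2_eq_square)
    also have "((2 * ?d)\<^sup>2 * exp 2) ^ d = (2 * ?d) ^ (2 * d) * exp (2 * ?d)"
      unfolding e by (simp only: power_mult power_mult_distrib[of _ "exp 2"])
    finally have "(t ^ (2 * d) * (2 * ?d * ?n * exp 2) ^ d) * (2 * 2 ^ card S) = ((2 * ?d) ^ (2 * d) * exp (2 * ?d)) * (2 * 2 ^ card S)"
      by (simp only:)
    then show ?thesis by (simp only: mult_ac)
  qed
  have "t ^ (2 * d) * (\<Sum>\<epsilon>\<in>signs S. (\<Sum>i\<in>S. \<epsilon> i) ^ (2 * d)) \<le> t ^ (2 * d) * (2 * 2 ^ card S * (2 * ?d * ?n * exp 2) ^ d)"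
    unfolding eq by (rule le)
  then show ?thesis using t by (simp only: mult_le_cancel_left_pos zero_less_power)
qed

lemma sum_squared_le:
  fixes a :: "'b \<Rightarrow> real"
  shows "(\<Sum>i\<in>I. a i)\<^sup>2 \<le> real (card I) * (\<Sum>i\<in>I. (a i)\<^sup>2)"
proof -
  have "(\<Sum>i\<in>I. a i)\<^sup>2 = (\<Sum>i\<in>I. \<Sum>j\<in>I. a i * a j)" by (simp add: power2_eq_square sum_product)
  also have "\<dots> \<le> (\<Sum>i\<in>I. \<Sum>j\<in>I. ((a i)\<^sup>2 + (a j)\<^sup>2) / 2)"
  proof (intro sum_mono)
    show "a i * a j \<le> ((a i)\<^sup>2 + (a j)\<^sup>2) / 2" for i j
      using zero_le_power2[of "a i - a j"] by (simp add: power2_eq_square algebra_simps)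
  qed
  also have "\<dots> = real (card I) * (\<Sum>i\<in>I. (a i)\<^sup>2)"
    by (simp add: sum.distrib add_divide_distrib sum_distrib_left flip: sum_divide_distrib)
  finally show ?thesis .
qed

text \<open>
  Expanding the square produces the sums over all signs of \<open>weight \<epsilon> (u @ v)\<close>, which are nonnegative. Hence every coefficient
  may be replaced by its bound \<open>M\<close>, and for constant coefficients the sum over the words is a power
  of the scalar sum.
\<close>

lemma chaos_second_moment:
  fixes c :: "'i list \<Rightarrow> complex"
  assumes S: "finite S" and c: "\<And>w. w \<in> words S d \<Longrightarrow> cmod (c w) \<le> M" and M: "M \<ge> 0"
  shows "(\<Sum>\<epsilon>\<in>signs S. (cmod (\<Sum>w\<in>words S d. complex_of_real (weight \<epsilon> w) * c w))\<^sup>2)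
    \<le> M\<^sup>2 * (\<Sum>\<epsilon>\<in>signs S. (\<Sum>i\<in>S. \<epsilon> i) ^ (2 * d))"
proof -
  let ?W = "words S d"
  have sq: "(cmod (\<Sum>w\<in>?W. complex_of_real (weight \<epsilon> w) * c w))\<^sup>2 = (\<Sum>u\<in>?W. \<Sum>v\<in>?W. weight \<epsilon> (u @ v) * Re (c u * cnj (c v)))" for \<epsilon>
  proof -
    let ?z = "\<Sum>w\<in>?W. complex_of_real (weight \<epsilon> w) * c w"
    have R: "Re (complex_of_real a * z) = a * Re z" for a z by simp
    have "?z * cnj ?z = (\<Sum>u\<in>?W. \<Sum>v\<in>?W. complex_of_real (weight \<epsilon> (u @ v)) * (c u * cnj (c v)))"
      by (simp add: sum_product cnj_sum mult_ac)
    then have "Re (?z * cnj ?z) = (\<Sum>u\<in>?W. \<Sum>v\<in>?W. weight \<epsilon> (u @ v) * Re (c u * cnj (c v)))"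
      by (simp only: Re_sum R)
    moreover have "?z * cnj ?z = complex_of_real ((cmod ?z)\<^sup>2)" by (rule complex_norm_square[symmetric])
    ultimately show ?thesis by (metis Re_complex_of_real)
  qed
  have "(\<Sum>\<epsilon>\<in>signs S. (cmod (\<Sum>w\<in>?W. complex_of_real (weight \<epsilon> w) * c w))\<^sup>2)
     = (\<Sum>u\<in>?W. \<Sum>v\<in>?W. (\<Sum>\<epsilon>\<in>signs S. weight \<epsilon> (u @ v)) * Re (c u * cnj (c v)))"
    unfolding sq sum_distrib_right
    by (subst sum.swap, rule sum.cong[OF refl], subst sum.swap, rule refl)
  also have "\<dots> \<le> (\<Sum>u\<in>?W. \<Sum>v\<in>?W. (\<Sum>\<epsilon>\<in>signs S. weight \<epsilon> (u @ v)) * M\<^sup>2)"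
  proof (intro sum_mono mult_left_mono)
    fix u v assume u: "u \<in> ?W" and v: "v \<in> ?W"
    have "Re (c u * cnj (c v)) \<le> cmod (c u) * cmod (c v)" using complex_Re_le_cmod[of "c u * cnj (c v)"] by (simp add: norm_mult)
    also have "\<dots> \<le> M * M" by (intro mult_mono c u v M) auto
    finally show "Re (c u * cnj (c v)) \<le> M\<^sup>2" by (simp add: power2_eq_square)
    show "0 \<le> (\<Sum>\<epsilon>\<in>signs S. weight \<epsilon> (u @ v))" using u v by (intro sum_weight_signs_nonneg[OF S]) (auto simp: words_def)
  qed
  also have "\<dots> = M\<^sup>2 * (\<Sum>\<epsilon>\<in>signs S. \<Sum>u\<in>?W. \<Sum>v\<in>?W. weight \<epsilon> (u @ v))"
  proof -
    have "(\<Sum>\<epsilon>\<in>signs S. \<Sum>u\<in>?W. \<Sum>v\<in>?W. weight \<epsilon> (u @ v)) = (\<Sum>u\<in>?W. \<Sum>v\<in>?W. \<Sum>\<epsilon>\<in>signs S. weight \<epsilon> (u @ v))"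
      by (subst sum.swap, rule sum.cong[OF refl], subst sum.swap, rule refl)
    then show ?thesis by (simp only: sum_distrib_left mult.commute)
  qed
  also have "\<dots> = M\<^sup>2 * (\<Sum>\<epsilon>\<in>signs S. (\<Sum>i\<in>S. \<epsilon> i) ^ (2 * d))"
  proof -
    have "(\<Sum>u\<in>?W. \<Sum>v\<in>?W. weight \<epsilon> (u @ v)) = (\<Sum>i\<in>S. \<epsilon> i) ^ (2 * d)" for \<epsilon>
    proof -
      have "(\<Sum>u\<in>?W. \<Sum>v\<in>?W. weight \<epsilon> (u @ v)) = (\<Sum>w\<in>?W. weight \<epsilon> w) * (\<Sum>w\<in>?W. weight \<epsilon> w)"
        by (simp add: sum_product)
      also have "\<dots> = (\<Sum>i\<in>S. \<epsilon> i) ^ (2 * d)" by (simp add: mult_2 power_add flip: sum_power_words)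
      finally show ?thesis .
    qed
    then show ?thesis by simp
  qed
  finally show ?thesis .
qed

section \<open>Random sums in a C*-algebra\<close>

context cstar_algebra begin
definition lin_fun :: "('a \<Rightarrow> complex) \<Rightarrow> bool" where
  "lin_fun g \<longleftrightarrow> (\<forall>x\<in>carrier A. \<forall>y\<in>carrier A. g (x \<boxplus> y) = g x + g y) \<and> (\<forall>x\<in>carrier A. \<forall>c. g (c \<cdot> x) = c * g x)"

text \<open>
  A homogeneous polynomial of degree \<open>d\<close> in the signs with coefficients in \<open>A\<close> of norm at most \<open>M\<close>, indexed by words
  because the letters do not commute. The equation is required after application of
  linear functionals only: this is how it is used, and products of two
  expansions then reduce to products of scalar sums.
\<close>

definition chaos :: "'i set \<Rightarrow> nat \<Rightarrow> real \<Rightarrow> (('i \<Rightarrow> real) \<Rightarrow> 'a) \<Rightarrow> bool" where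
  "chaos S d M F \<longleftrightarrow> (\<forall>\<epsilon>. F \<epsilon> \<in> carrier A) \<and>
     (\<exists>X. (\<forall>w\<in>words S d. X w \<in> carrier A \<and> nrm A (X w) \<le> M) \<and>
        (\<forall>\<epsilon> g. lin_fun g \<longrightarrow> g (F \<epsilon>) = (\<Sum>w\<in>words S d. complex_of_real (weight \<epsilon> w) * g (X w))))"

text \<open>
  The functionals \<open>x \<mapsto> g (x \<star> G \<epsilon>)\<close> and \<open>x \<mapsto> g (X u \<star> x)\<close> are linear too, so the two expansions can be
  inserted one after the other; the coefficients of a word are the products over its two parts.
\<close>

lemma chaos_mult:
  assumes F: "chaos S d M F" and G: "chaos S e N G" and MN: "M \<ge> 0"
  shows "chaos S (d + e) (M * N) (\<lambda>\<epsilon>. F \<epsilon> \<star> G \<epsilon>)"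
proof -
  have Fin: "F \<epsilon> \<in> carrier A" and Gin: "G \<epsilon> \<in> carrier A" for \<epsilon> using F G by (auto simp: chaos_def)
  from F obtain X where X: "\<And>w. w \<in> words S d \<Longrightarrow> X w \<in> carrier A" "\<And>w. w \<in> words S d \<Longrightarrow> nrm A (X w) \<le> M"
    "\<And>\<epsilon> g. lin_fun g \<Longrightarrow> g (F \<epsilon>) = (\<Sum>w\<in>words S d. complex_of_real (weight \<epsilon> w) * g (X w))"
    unfolding chaos_def by blast
  from G obtain Z where Z: "\<And>w. w \<in> words S e \<Longrightarrow> Z w \<in> carrier A" "\<And>w. w \<in> words S e \<Longrightarrow> nrm A (Z w) \<le> N"
    "\<And>\<epsilon> g. lin_fun g \<Longrightarrow> g (G \<epsilon>) = (\<Sum>w\<in>words S e. complex_of_real (weight \<epsilon> w) * g (Z w))"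
    unfolding chaos_def by blast
  have split: "take d w \<in> words S d" "drop d w \<in> words S e" if "w \<in> words S (d + e)" for w
    using that by (auto simp: words_def dest: in_set_takeD in_set_dropD)
  show ?thesis unfolding chaos_def
  proof (intro conjI allI impI exI[of _ "\<lambda>w. X (take d w) \<star> Z (drop d w)"] ballI)
    fix w assume w: "w \<in> words S (d + e)"
    show "X (take d w) \<star> Z (drop d w) \<in> carrier A" using X Z split[OF w] by simp
    have "nrm A (X (take d w) \<star> Z (drop d w)) \<le> nrm A (X (take d w)) * nrm A (Z (drop d w))"
      using X Z split[OF w] by (intro nrm_mult) auto
    also have "\<dots> \<le> M * N" using X Z split[OF w] MN by (intro mult_mono nrm_nonneg) auto
    finally show "nrm A (X (take d w) \<star> Z (drop d w)) \<le> M * N" .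
  next
    fix \<epsilon> g assume g: "lin_fun g"
    have g1: "lin_fun (\<lambda>x. g (x \<star> G \<epsilon>))" using g Gin by (auto simp: lin_fun_def alg_distr_left alg_smult_left)
    have g2: "lin_fun (\<lambda>x. g (X u \<star> x))" if "u \<in> words S d" for u
      using g X(1)[OF that] by (auto simp: lin_fun_def alg_distr_right alg_smult_right)
    have "g (F \<epsilon> \<star> G \<epsilon>) = (\<Sum>u\<in>words S d. complex_of_real (weight \<epsilon> u) * g (X u \<star> G \<epsilon>))"
      by (rule X(3)[OF g1])
    also have "\<dots> = (\<Sum>u\<in>words S d. complex_of_real (weight \<epsilon> u) * (\<Sum>v\<in>words S e. complex_of_real (weight \<epsilon> v) * g (X u \<star> Z v)))"
      using Z(3)[OF g2] by simp
    also have "\<dots> = (\<Sum>u\<in>words S d. \<Sum>v\<in>words S e. complex_of_real (weight \<epsilon> u * weight \<epsilon> v) * g (X u \<star> Z v))"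
      by (simp add: sum_distrib_left mult.assoc)
    also have "\<dots> = (\<Sum>w\<in>words S (d + e). complex_of_real (weight \<epsilon> (take d w) * weight \<epsilon> (drop d w)) * g (X (take d w) \<star> Z (drop d w)))"
      by (rule sum_words_append[symmetric])
    also have "\<dots> = (\<Sum>w\<in>words S (d + e). complex_of_real (weight \<epsilon> w) * g (X (take d w) \<star> Z (drop d w)))"
      by (simp flip: prod_list.append map_append)
    finally show "g (F \<epsilon> \<star> G \<epsilon>) = (\<Sum>w\<in>words S (d + e). complex_of_real (weight \<epsilon> w) * g (X (take d w) \<star> Z (drop d w)))" .
  qed (use Fin Gin in auto)
qed

definition sign_sum :: "'i set \<Rightarrow> ('i \<Rightarrow> 'a) \<Rightarrow> ('i \<Rightarrow> real) \<Rightarrow> 'a" where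
  "sign_sum S x \<epsilon> = (\<Oplus>\<^bsub>A\<^esub>i\<in>S. complex_of_real (\<epsilon> i) \<cdot> x i)"

lemma sign_sum_in: "(\<And>i. i \<in> S \<Longrightarrow> x i \<in> carrier A) \<Longrightarrow> sign_sum S x \<epsilon> \<in> carrier A"
  unfolding sign_sum_def by (intro M.finsum_closed) auto

lemma adj_sign_sum:
  assumes "finite S" "\<And>i. i \<in> S \<Longrightarrow> x i \<in> carrier A"
  shows "adj (sign_sum S x \<epsilon>) = sign_sum S (\<lambda>i. adj (x i)) \<epsilon>"
  using assms unfolding sign_sum_def
proof (induction S)
  case (insert i S)
  have "(\<Oplus>\<^bsub>A\<^esub>i\<in>S. complex_of_real (\<epsilon> i) \<cdot> x i) \<in> carrier A" using insert by (intro M.finsum_closed) auto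
  then show ?case using insert by (simp add: M.finsum_insert Pi_def star_add star_smult)
qed simp

lemma chaos_sign_sum:
  assumes S: "finite S" "\<And>i. i \<in> S \<Longrightarrow> x i \<in> carrier A" "\<And>i. i \<in> S \<Longrightarrow> nrm A (x i) \<le> C"
  shows "chaos S 1 C (sign_sum S x)"
  unfolding chaos_def
proof (intro conjI allI impI exI[of _ "\<lambda>w. x (hd w)"] ballI)
  show "sign_sum S x \<epsilon> \<in> carrier A" for \<epsilon> using S by (intro sign_sum_in) auto
  fix w assume "w \<in> words S 1"
  then have "hd w \<in> S" by (auto simp: words_def length_Suc_conv)
  then show "x (hd w) \<in> carrier A" "nrm A (x (hd w)) \<le> C" using S by auto
next
  fix \<epsilon> g assume g: "lin_fun g"
  have g0: "g \<zero>\<^bsub>A\<^esub> = 0" using g by (metis lin_fun_def M.zero_closed smult_zero mult_zero_left)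
  have "g (sign_sum S x \<epsilon>) = (\<Sum>i\<in>S. complex_of_real (\<epsilon> i) * g (x i))"
    using S(1,2) unfolding sign_sum_def
  proof (induction S)
    case (insert i S)
    have "(\<Oplus>\<^bsub>A\<^esub>i\<in>S. complex_of_real (\<epsilon> i) \<cdot> x i) \<in> carrier A" using insert by (intro M.finsum_closed) auto
    then show ?case using insert g by (simp add: M.finsum_insert Pi_def lin_fun_def)
  qed (simp add: g0)
  then show "g (sign_sum S x \<epsilon>) = (\<Sum>w\<in>words S 1. complex_of_real (weight \<epsilon> w) * g (x (hd w)))"
    by (simp only: sum_words_1) simp
qed

text \<open>
  The element \<open>(adj x \<star> x)^(2^k)\<close>. Since \<open>A\<close> may lack a unit and the norm of a power is controlled by the
  C*-identity only for repeated squaring, general powers are not introduced.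
\<close>

primrec iter_sq :: "nat \<Rightarrow> 'a \<Rightarrow> 'a" where
  "iter_sq 0 x = adj x \<star> x"
| "iter_sq (Suc k) x = iter_sq k x \<star> iter_sq k x"

lemma iter_sq_props: "x \<in> carrier A \<Longrightarrow> iter_sq k x \<in> carrier A \<and> adj (iter_sq k x) = iter_sq k x \<and> nrm A (iter_sq k x) = nrm A x ^ (2 * 2 ^ k)"
proof (induction k)
  case 0
  then show ?case by (simp add: star_mult star_star cstar_identity)
next
  case (Suc k)
  then have c: "iter_sq k x \<in> carrier A" and a: "adj (iter_sq k x) = iter_sq k x" by auto
  have "nrm A (iter_sq (Suc k) x) = (nrm A (iter_sq k x))\<^sup>2" using cstar_identity[OF c] a by simp
  also have "\<dots> = nrm A x ^ (2 * 2 ^ Suc k)" using Suc by (simp add: mult.commute flip: power_mult)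
  finally show ?case using c a by (simp add: star_mult)
qed

lemma chaos_iter_sq:
  assumes S: "finite S" "\<And>i. i \<in> S \<Longrightarrow> x i \<in> carrier A" "\<And>i. i \<in> S \<Longrightarrow> nrm A (x i) \<le> C" and C: "C \<ge> 0"
  shows "chaos S (2 * 2 ^ k) (C ^ (2 * 2 ^ k)) (\<lambda>\<epsilon>. iter_sq k (sign_sum S x \<epsilon>))"
proof (induction k)
  case 0
  have "chaos S (1 + 1) (C * C) (\<lambda>\<epsilon>. sign_sum S (\<lambda>i. adj (x i)) \<epsilon> \<star> sign_sum S x \<epsilon>)"
    by (intro chaos_mult chaos_sign_sum C) (use S in auto)
  then have "chaos S 2 (C\<^sup>2) (\<lambda>\<epsilon>. sign_sum S (\<lambda>i. adj (x i)) \<epsilon> \<star> sign_sum S x \<epsilon>)"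
    by (simp only: one_add_one power2_eq_square)
  then show ?case using S by (simp add: adj_sign_sum)
next
  case (Suc k)
  have "chaos S (2 * 2 ^ k + 2 * 2 ^ k) (C ^ (2 * 2 ^ k) * C ^ (2 * 2 ^ k)) (\<lambda>\<epsilon>. iter_sq k (sign_sum S x \<epsilon>) \<star> iter_sq k (sign_sum S x \<epsilon>))"
    by (rule chaos_mult[OF Suc Suc]) (use C in simp)
  moreover have "C ^ (2 * 2 ^ k) * C ^ (2 * 2 ^ k) = C ^ (2 * 2 ^ Suc k)" by (simp flip: power_add)
  moreover have "2 * 2 ^ k + 2 * 2 ^ k = (2 * 2 ^ Suc k :: nat)" by simp
  ultimately show ?case by simp
qed

text \<open>
  The second moments of the quantities \<open>f p q (iter_sq k Y)\<close> for a random signed sum \<open>Y\<close> are bounded by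
  \<open>chaos_second_moment\<close> and \<open>rademacher_moment\<close>. As the functionals dominate the norm, some of these moments must be as large as
  \<open>(\<gamma> n)^(4m)\<close> up to powers of \<open>card P\<close>. The occurrence of \<open>m\<close> in the exponent is what
  makes \<open>card P\<close> exponentially large.
\<close>

lemma l1_lower_bound_imp_many_functionals:
  fixes f :: "'p \<Rightarrow> 'p \<Rightarrow> 'a \<Rightarrow> complex" and x :: "'i \<Rightarrow> 'a"
  assumes P: "finite P" and f: "\<And>p q. p \<in> P \<Longrightarrow> q \<in> P \<Longrightarrow> lin_fun (f p q)"
    "\<And>p q b. p \<in> P \<Longrightarrow> q \<in> P \<Longrightarrow> b \<in> carrier A \<Longrightarrow> cmod (f p q b) \<le> nrm A b"
    "\<And>b. b \<in> carrier A \<Longrightarrow> nrm A b \<le> (\<Sum>p\<in>P. \<Sum>q\<in>P. cmod (f p q b))"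
    and S: "finite S" "\<And>i. i \<in> S \<Longrightarrow> x i \<in> carrier A" "\<And>i. i \<in> S \<Longrightarrow> nrm A (x i) \<le> C" and C: "C > 0"
    and \<gamma>: "\<gamma> > 0" and lower: "\<And>\<epsilon>. \<epsilon> \<in> signs S \<Longrightarrow> \<gamma> * real (card S) \<le> nrm A (sign_sum S x \<epsilon>)"
    and m: "m = 2 ^ k" "4 * m \<le> card S"
  shows "(\<gamma>\<^sup>2 * real (card S) / (4 * exp 2 * C\<^sup>2 * real m)) ^ (2 * m) \<le> 2 * real (card P) ^ 4"
proof -
  let ?n = "real (card S)" and ?N = "real (card P)"
  let ?F = "\<lambda>\<epsilon>. iter_sq k (sign_sum S x \<epsilon>)"
  have m0: "m > 0" using m by simp
  have n0: "?n > 0" using m m0 by linarith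
  have Y: "sign_sum S x \<epsilon> \<in> carrier A" for \<epsilon> using S by (intro sign_sum_in) auto
  have F: "?F \<epsilon> \<in> carrier A" "nrm A (?F \<epsilon>) = nrm A (sign_sum S x \<epsilon>) ^ (2 * m)" for \<epsilon>
    using iter_sq_props[OF Y[of \<epsilon>], of k] m by auto
  have ch: "chaos S (2 * m) (C ^ (2 * m)) ?F" using chaos_iter_sq[where k = k, OF S] C m by simp
  let ?R = "\<Sum>\<epsilon>\<in>signs S. (\<Sum>i\<in>S. \<epsilon> i) ^ (2 * (2 * m))"
  have mom: "(\<Sum>\<epsilon>\<in>signs S. (cmod (f p q (?F \<epsilon>)))\<^sup>2) \<le> (C ^ (2 * m))\<^sup>2 * ?R" if p: "p \<in> P" and q: "q \<in> P" for p q
  proof -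
    from ch obtain X where X: "\<And>w. w \<in> words S (2 * m) \<Longrightarrow> X w \<in> carrier A \<and> nrm A (X w) \<le> C ^ (2 * m)"
      "\<And>\<epsilon> g. lin_fun g \<Longrightarrow> g (?F \<epsilon>) = (\<Sum>w\<in>words S (2 * m). complex_of_real (weight \<epsilon> w) * g (X w))"
      unfolding chaos_def by blast
    show ?thesis unfolding X(2)[OF f(1)[OF p q]]
    proof (rule chaos_second_moment[OF S(1)])
      fix w assume "w \<in> words S (2 * m)"
      then show "cmod (f p q (X w)) \<le> C ^ (2 * m)" using X(1)[of w] f(2)[OF p q, of "X w"] by auto
    qed (use C in simp)
  qed
  have pw: "(\<gamma> * ?n) ^ (4 * m) \<le> ?N\<^sup>2 * (\<Sum>p\<in>P. \<Sum>q\<in>P. (cmod (f p q (?F \<epsilon>)))\<^sup>2)" if e: "\<epsilon> \<in> signs S" for \<epsilon>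
  proof -
    have "(\<gamma> * ?n) ^ (2 * m) \<le> nrm A (?F \<epsilon>)"
      unfolding F(2) by (rule power_mono[OF lower[OF e]]) (use \<gamma> in simp)
    also have "\<dots> \<le> (\<Sum>p\<in>P. \<Sum>q\<in>P. cmod (f p q (?F \<epsilon>)))" by (rule f(3)[OF F(1)])
    also have "\<dots> = (\<Sum>z\<in>P \<times> P. cmod (f (fst z) (snd z) (?F \<epsilon>)))" by (simp add: sum.cartesian_product case_prod_unfold)
    finally have "((\<gamma> * ?n) ^ (2 * m))\<^sup>2 \<le> (\<Sum>z\<in>P \<times> P. cmod (f (fst z) (snd z) (?F \<epsilon>)))\<^sup>2"
      by (rule power_mono) (use \<gamma> in simp)
    also have "\<dots> \<le> (\<Sum>z\<in>P \<times> P. (cmod (f (fst z) (snd z) (?F \<epsilon>)))\<^sup>2) * card (P \<times> P)"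
      using sum_squared_le by (simp add: mult.commute)
    also have "\<dots> = ?N\<^sup>2 * (\<Sum>p\<in>P. \<Sum>q\<in>P. (cmod (f p q (?F \<epsilon>)))\<^sup>2)"
      by (simp add: sum.cartesian_product case_prod_unfold card_cartesian_product power2_eq_square)
    finally show ?thesis by (simp flip: power_mult)
  qed
  have "2 ^ card S * (\<gamma> * ?n) ^ (4 * m) = (\<Sum>\<epsilon>\<in>signs S. (\<gamma> * ?n) ^ (4 * m))" by (simp add: card_signs[OF S(1)])
  also have "\<dots> \<le> (\<Sum>\<epsilon>\<in>signs S. ?N\<^sup>2 * (\<Sum>p\<in>P. \<Sum>q\<in>P. (cmod (f p q (?F \<epsilon>)))\<^sup>2))" by (rule sum_mono[OF pw])
  also have "\<dots> = ?N\<^sup>2 * (\<Sum>p\<in>P. \<Sum>q\<in>P. \<Sum>\<epsilon>\<in>signs S. (cmod (f p q (?F \<epsilon>)))\<^sup>2)"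
    unfolding sum_distrib_left[symmetric]
    by (rule arg_cong[where f = "(*) _"], subst sum.swap, rule sum.cong[OF refl], rule sum.swap)
  also have "\<dots> \<le> ?N\<^sup>2 * (\<Sum>p\<in>P. \<Sum>q\<in>P. (C ^ (2 * m))\<^sup>2 * ?R)" by (intro mult_left_mono sum_mono mom) auto
  also have "\<dots> = ?N ^ 4 * ((C ^ (2 * m))\<^sup>2 * ?R)" by (simp add: power2_eq_square power4_eq_xxxx)
  also have "\<dots> \<le> ?N ^ 4 * ((C ^ (2 * m))\<^sup>2 * (2 * 2 ^ card S * (2 * real (2 * m) * ?n * exp 2) ^ (2 * m)))"
    using m m0 by (intro mult_left_mono rademacher_moment S) auto
  finally have "2 ^ card S * (\<gamma> * ?n) ^ (4 * m) \<le> 2 ^ card S * (2 * ?N ^ 4 * ((C\<^sup>2) ^ (2 * m) * (4 * real m * ?n * exp 2) ^ (2 * m)))"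
    by (simp add: mult_ac flip: power_mult)
  then have le: "(\<gamma> * ?n) ^ (4 * m) \<le> 2 * ?N ^ 4 * (C\<^sup>2 * (4 * real m * ?n * exp 2)) ^ (2 * m)"
    by (simp add: power_mult_distrib)
  have "(\<gamma> * ?n) ^ (4 * m) = ((\<gamma> * ?n)\<^sup>2) ^ (2 * m)" by (simp flip: power_mult)
  also have "(\<gamma> * ?n)\<^sup>2 = \<gamma>\<^sup>2 * ?n\<^sup>2" by (rule power_mult_distrib)
  also have "\<gamma>\<^sup>2 * ?n\<^sup>2 = (\<gamma>\<^sup>2 * ?n / (4 * exp 2 * C\<^sup>2 * real m)) * (C\<^sup>2 * (4 * real m * ?n * exp 2))"
    using C m0 by (simp add: field_simps power2_eq_square)
  finally have "(\<gamma> * ?n) ^ (4 * m) = ((\<gamma>\<^sup>2 * ?n / (4 * exp 2 * C\<^sup>2 * real m)) * (C\<^sup>2 * (4 * real m * ?n * exp 2))) ^ (2 * m)" .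
  also have "\<dots> = (\<gamma>\<^sup>2 * ?n / (4 * exp 2 * C\<^sup>2 * real m)) ^ (2 * m) * (C\<^sup>2 * (4 * real m * ?n * exp 2)) ^ (2 * m)"
    by (rule power_mult_distrib)
  finally have "(\<gamma>\<^sup>2 * ?n / (4 * exp 2 * C\<^sup>2 * real m)) ^ (2 * m) * (C\<^sup>2 * (4 * real m * ?n * exp 2)) ^ (2 * m)
      \<le> 2 * ?N ^ 4 * (C\<^sup>2 * (4 * real m * ?n * exp 2)) ^ (2 * m)" using le by (simp only:)
  moreover have "(C\<^sup>2 * (4 * real m * ?n * exp 2)) ^ (2 * m) > 0" using C m0 n0 by simp
  ultimately show ?thesis by (simp only: mult_le_cancel_right_pos)
qed
end

section \<open>Maximal commutative subalgebras\<close>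

context cstar_algebra begin

lemma vlim_commute:
  assumes lim: "vlim s l" and c: "c \<in> carrier A" "\<And>n. s n \<star> c = c \<star> s n"
  shows "l \<star> c = c \<star> l"
proof (rule vlim_unique)
  have "vlim (\<lambda>n. s n \<star> c) (l \<star> c)"
    by (rule vlim_bounded_map[OF lim, where K = "nrm A c"])
       (use c(1) nrm_mult[of _ c] in \<open>auto simp: mul_sub_left mult.commute\<close>)
  then show "vlim (\<lambda>n. c \<star> s n) (l \<star> c)" by (simp add: c(2))
  show "vlim (\<lambda>n. c \<star> s n) (c \<star> l)" by (rule vlim_mul_left[OF lim c(1)])
qed

definition commutant :: "'a set \<Rightarrow> 'a set" where
  "commutant S = {y \<in> carrier A. \<forall>s\<in>S. y \<star> s = s \<star> y}"

text \<open>
  Completeness of \<open>W\<close> comes from that of \<open>A\<close> together with closedness; the algebraic laws are inherited.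
\<close>

lemma cstar_subalgebraI:
  assumes W: "submodule class_ring W A"
    and mult: "\<And>x y. x \<in> W \<Longrightarrow> y \<in> W \<Longrightarrow> x \<star> y \<in> W" and st: "\<And>x. x \<in> W \<Longrightarrow> adj x \<in> W"
    and closed: "\<And>s l. vlim s l \<Longrightarrow> (\<And>n. s n \<in> W) \<Longrightarrow> l \<in> W"
  shows "cstar_subalgebra W A"
proof -
  have sub: "W \<subseteq> carrier A" using W by (rule submodule.subset)
  then have sub': "x \<in> carrier A" if "x \<in> W" for x using that by auto
  interpret W: cnormed_space "A\<lparr>carrier := W\<rparr>" by (rule cnormed_space_subsp[OF W])
  have "cstar_algebra (A\<lparr>carrier := W\<rparr>)"
  proof (intro cstar_algebra.intro cbanach_space.intro W.cnormed_space_axioms cbanach_space_axioms.intro cstar_algebra_axioms.intro)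
    fix s :: "nat \<Rightarrow> 'a"
    assume s: "\<And>n. s n \<in> carrier (A\<lparr>carrier := W\<rparr>)"
      and cau: "\<And>e. e > 0 \<Longrightarrow> \<exists>N. \<forall>m\<ge>N. \<forall>n\<ge>N. nrm (A\<lparr>carrier := W\<rparr>) (s m \<ominus>\<^bsub>A\<lparr>carrier := W\<rparr>\<^esub> s n) < e"
    have s': "s n \<in> W" for n using s by simp
    have "\<exists>l\<in>carrier A. (\<lambda>n. nrm A (s n \<boxminus> l)) \<longlonglongrightarrow> 0"
    proof (rule nrm_complete)
      show "\<exists>N. \<forall>m\<ge>N. \<forall>n\<ge>N. nrm A (s m \<boxminus> s n) < e" if "e > 0" for e
        using cau[OF that] s' by (simp add: sub_subsp[OF W])
    qed (use s' sub in auto)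
    then obtain l where l: "l \<in> carrier A" "(\<lambda>n. nrm A (s n \<boxminus> l)) \<longlonglongrightarrow> 0" by blast
    then have "vlim s l" using s' sub by (auto simp: vlim_def)
    then have "l \<in> W" using s' by (rule closed)
    then show "\<exists>l\<in>carrier (A\<lparr>carrier := W\<rparr>). (\<lambda>n. nrm (A\<lparr>carrier := W\<rparr>) (s n \<ominus>\<^bsub>A\<lparr>carrier := W\<rparr>\<^esub> l)) \<longlonglongrightarrow> 0"
      using l s' by (auto simp: sub_subsp[OF W])
  qed (use mult st in \<open>simp_all add: sub' alg_mult_assoc alg_distr_left alg_distr_right alg_smult_left alg_smult_right
      nrm_mult star_star star_add star_smult star_mult cstar_identity\<close>)
  then show ?thesis using sub by (simp add: cstar_subalgebra_def)
qed

lemma commutant_subalgebra: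
  assumes S: "S \<subseteq> carrier A" "\<And>s. s \<in> S \<Longrightarrow> adj s \<in> S"
  shows "cstar_subalgebra (commutant S) A"
proof (rule cstar_subalgebraI)
  have Sin: "s \<in> carrier A" if "s \<in> S" for s using that S by auto
  show "submodule class_ring (commutant S) A"
    by (rule subspI) (auto simp: commutant_def Sin alg_distr_left alg_distr_right alg_smult_left alg_smult_right)
  show "x \<star> y \<in> commutant S" if "x \<in> commutant S" "y \<in> commutant S" for x y
  proof -
    have xy: "x \<in> carrier A" "y \<in> carrier A" using that by (auto simp: commutant_def)
    have "(x \<star> y) \<star> s = s \<star> (x \<star> y)" if s: "s \<in> S" for s
    proof -
      have "(x \<star> y) \<star> s = x \<star> (y \<star> s)" using xy Sin[OF s] by (simp add: alg_mult_assoc)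
      also have "y \<star> s = s \<star> y" using \<open>y \<in> commutant S\<close> s by (simp add: commutant_def)
      also have "x \<star> (s \<star> y) = (x \<star> s) \<star> y" using xy Sin[OF s] by (simp add: alg_mult_assoc)
      also have "x \<star> s = s \<star> x" using \<open>x \<in> commutant S\<close> s by (simp add: commutant_def)
      finally show ?thesis using xy Sin[OF s] by (simp add: alg_mult_assoc)
    qed
    then show ?thesis using xy by (simp add: commutant_def)
  qed
  show "adj x \<in> commutant S" if x: "x \<in> commutant S" for x
  proof -
    have xc: "x \<in> carrier A" using x by (simp add: commutant_def)
    have "adj x \<star> s = s \<star> adj x" if s: "s \<in> S" for s
    proof -
      have "x \<star> adj s = adj s \<star> x" using x S(2)[OF s] by (simp add: commutant_def)
      then have "adj (x \<star> adj s) = adj (adj s \<star> x)" by simp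
      then show ?thesis using xc Sin[OF s] by (simp add: star_mult star_star)
    qed
    then show ?thesis using xc by (simp add: commutant_def)
  qed
  show "l \<in> commutant S" if "vlim s l" "\<And>n. s n \<in> commutant S" for s l
    using that by (auto simp: commutant_def vlim_def[of s l] intro!: vlim_commute[OF that(1)] Sin)
qed

text \<open>
  \<open>S\<close> lies in its commutant, so the bicommutant lies in the commutant as well, and it commutes with the commutant. Taking
  the bicommutant replaces generating a closed subalgebra by \<open>S\<close>.
\<close>

lemma bicommutant_commutative:
  assumes S: "S \<subseteq> carrier A" "\<And>s. s \<in> S \<Longrightarrow> adj s \<in> S" "\<And>s t. s \<in> S \<Longrightarrow> t \<in> S \<Longrightarrow> s \<star> t = t \<star> s"
  shows "commutative_subalgebra (commutant (commutant S)) A" "S \<subseteq> commutant (commutant S)"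
proof -
  have 1: "cstar_subalgebra (commutant S) A" by (rule commutant_subalgebra[OF S(1,2)])
  have c: "commutant S \<subseteq> carrier A" by (auto simp: commutant_def)
  have star1: "adj s \<in> commutant S" if "s \<in> commutant S" for s
    using cstar_algebra.star_closed[of "A\<lparr>carrier := commutant S\<rparr>" s] 1 that by (simp add: cstar_subalgebra_def)
  have 2: "cstar_subalgebra (commutant (commutant S)) A" by (rule commutant_subalgebra[OF c star1])
  have SS: "S \<subseteq> commutant S" using S by (auto simp: commutant_def)
  have "commutant (commutant S) \<subseteq> commutant S" using SS by (auto simp: commutant_def)
  then have "x \<star> y = y \<star> x" if "x \<in> commutant (commutant S)" "y \<in> commutant (commutant S)" for x y
    using that unfolding commutant_def[of "commutant S"] by blast
  with 2 show "commutative_subalgebra (commutant (commutant S)) A" by (auto simp: commutative_subalgebra_def)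
  show "S \<subseteq> commutant (commutant S)" using S by (auto simp: commutant_def)
qed

text \<open>
  Zorn's lemma is applied to commuting star-closed sets, for which unions of chains cause no
  closure problem. A maximal one equals its bicommutant and hence is a C*-subalgebra.
\<close>

lemma maximal_commutative_subalgebra_exists: "\<exists>C. maximal_commutative_subalgebra C A"
proof -
  define \<S> where "\<S> = {S. S \<subseteq> carrier A \<and> (\<forall>s\<in>S. adj s \<in> S) \<and> (\<forall>s\<in>S. \<forall>t\<in>S. s \<star> t = t \<star> s)}"
  have comm: "C \<in> \<S>" if "commutative_subalgebra C A" for C
  proof -
    have "adj s \<in> C" if "s \<in> C" for s
      using cstar_algebra.star_closed[of "A\<lparr>carrier := C\<rparr>" s] that \<open>commutative_subalgebra C A\<close>
      by (simp add: cstar_subalgebra_def commutative_subalgebra_def)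
    then show ?thesis using that by (auto simp: \<S>_def cstar_subalgebra_def commutative_subalgebra_def)
  qed
  have "\<exists>M\<in>\<S>. \<forall>X\<in>\<S>. M \<subseteq> X \<longrightarrow> X = M"
  proof (rule subset_Zorn')
    fix K assume K: "subset.chain \<S> K"
    have KS: "K \<subseteq> \<S>" and tot: "\<And>X Y. X \<in> K \<Longrightarrow> Y \<in> K \<Longrightarrow> X \<subseteq> Y \<or> Y \<subseteq> X"
      using K by (auto simp: subset_chain_def)
    have "s \<star> t = t \<star> s" if "s \<in> \<Union>K" "t \<in> \<Union>K" for s t
    proof -
      obtain X Y where XY: "X \<in> K" "Y \<in> K" "s \<in> X" "t \<in> Y" using \<open>s \<in> \<Union>K\<close> \<open>t \<in> \<Union>K\<close> by blast
      then obtain Z where "Z \<in> K" "s \<in> Z" "t \<in> Z" using tot[OF XY(1,2)] by blast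
      then have "Z \<in> \<S>" "s \<in> Z" "t \<in> Z" using KS by blast+
      then show ?thesis unfolding \<S>_def by blast
    qed
    moreover have "\<Union>K \<subseteq> carrier A" using KS unfolding \<S>_def by blast
    moreover have "adj s \<in> \<Union>K" if "s \<in> \<Union>K" for s using that KS unfolding \<S>_def by blast
    ultimately show "\<Union>K \<in> \<S>" unfolding \<S>_def by blast
  qed
  then obtain M where M: "M \<in> \<S>" "\<And>X. X \<in> \<S> \<Longrightarrow> M \<subseteq> X \<Longrightarrow> X = M" by blast
  have b: "commutative_subalgebra (commutant (commutant M)) A" "M \<subseteq> commutant (commutant M)"
    by (rule bicommutant_commutative; use M(1) in \<open>unfold \<S>_def, blast\<close>)+
  have "commutant (commutant M) = M" by (rule M(2)[OF comm[OF b(1)] b(2)])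
  then have "commutative_subalgebra M A" using b by simp
  then have "maximal_commutative_subalgebra M A"
    using M(2) comm by (auto simp: maximal_commutative_subalgebra_def)
  then show ?thesis by blast
qed

text \<open>
  Otherwise the bicommutant of \<open>insert x C\<close> would be a larger commutative subalgebra.
\<close>

lemma mem_maximal_commutative:
  assumes C: "maximal_commutative_subalgebra C A" and x: "x \<in> carrier A" "adj x = x"
    and comm: "\<And>c. c \<in> C \<Longrightarrow> x \<star> c = c \<star> x"
  shows "x \<in> C"
proof -
  have C': "C \<subseteq> carrier A" "\<And>s t. s \<in> C \<Longrightarrow> t \<in> C \<Longrightarrow> s \<star> t = t \<star> s"
    using C by (auto simp: maximal_commutative_subalgebra_def commutative_subalgebra_def cstar_subalgebra_def)
  have Cstar: "adj s \<in> C" if "s \<in> C" for s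
    using cstar_algebra.star_closed[of "A\<lparr>carrier := C\<rparr>" s] that C
    by (simp add: maximal_commutative_subalgebra_def cstar_subalgebra_def commutative_subalgebra_def)
  let ?S = "insert x C"
  have S1: "?S \<subseteq> carrier A" using C' x by blast
  have S2: "adj s \<in> ?S" if "s \<in> ?S" for s using that Cstar x(2) by (metis insert_iff)
  have S3: "s \<star> t = t \<star> s" if "s \<in> ?S" "t \<in> ?S" for s t using that comm C'(2) by (metis insert_iff)
  note bicommutant_commutative[OF S1 S2 S3]
  then have b: "commutative_subalgebra (commutant (commutant ?S)) A" "?S \<subseteq> commutant (commutant ?S)" by blast+
  then have "commutant (commutant ?S) = C" using C unfolding maximal_commutative_subalgebra_def by blast
  then show ?thesis using b(2) by blast
qed
end

locale maximal_commutative = cstar_algebra A for A :: "('a, 'm) cstar_scheme" +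
  fixes C :: "'a set"
  assumes fd: fin_dim and max: "maximal_commutative_subalgebra C A"
begin

lemma C_in [simp]: "c \<in> C \<Longrightarrow> c \<in> carrier A"
  using max by (auto simp: maximal_commutative_subalgebra_def commutative_subalgebra_def cstar_subalgebra_def)

lemma C_sub: "submodule class_ring C A" and C_mult: "c \<in> C \<Longrightarrow> d \<in> C \<Longrightarrow> c \<otimes>\<^bsub>A\<^esub> d \<in> C"
  and C_star: "c \<in> C \<Longrightarrow> star A c \<in> C"
proof -
  interpret C: cstar_algebra "A\<lparr>carrier := C\<rparr>"
    using max by (simp add: maximal_commutative_subalgebra_def commutative_subalgebra_def cstar_subalgebra_def)
  have z: "\<zero>\<^bsub>A\<^esub> \<in> C" using C.M.zero_closed by simp
  show "submodule class_ring C A"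
    by (rule subspI) (use C.M.add.m_closed C.smult_in z in auto)
  show "c \<in> C \<Longrightarrow> d \<in> C \<Longrightarrow> c \<otimes>\<^bsub>A\<^esub> d \<in> C" using C.alg_mult_closed by simp
  show "c \<in> C \<Longrightarrow> star A c \<in> C" using C.star_closed by simp
qed

lemma C_comm: "c \<in> C \<Longrightarrow> d \<in> C \<Longrightarrow> c \<otimes>\<^bsub>A\<^esub> d = d \<otimes>\<^bsub>A\<^esub> c"
  using max by (auto simp: maximal_commutative_subalgebra_def commutative_subalgebra_def)
end

section \<open>Minimal projections and matrix coefficients\<close>

context cnormed_space begin
lemma smult_cancel:
  assumes "a \<in> carrier V" "a \<noteq> \<zero>\<^bsub>V\<^esub>" "k \<cdot> a = l \<cdot> a" shows "k = l"
proof -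
  have "(k - l) \<cdot> a = k \<cdot> a \<boxminus> l \<cdot> a"
    using assms(1) smult_add_left[of a k "- l"] by (simp add: sub_eq smult_smult)
  then have "nrm V ((k - l) \<cdot> a) = 0" using assms by (simp add: sub_self)
  then show ?thesis using assms nrm_smult[of a "k - l"] nrm_eq_0[of a] by simp
qed

lemma smult_eq_0: "a \<in> carrier V \<Longrightarrow> k \<cdot> a = \<zero>\<^bsub>V\<^esub> \<Longrightarrow> k = 0 \<or> a = \<zero>\<^bsub>V\<^esub>"
  using smult_cancel[of a k 0] by auto

lemma finsum_subsp:
  assumes "subsp W" "finite I" "\<And>i. i \<in> I \<Longrightarrow> f i \<in> W" shows "(\<Oplus>\<^bsub>V\<^esub>i\<in>I. f i) \<in> W"
  using assms(2,3)
proof (induction I)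
  case empty
  then show ?case using submodule.zero_closed[OF assms(1)] by simp
next
  case (insert i I)
  have "f j \<in> carrier V" if "j \<in> insert i I" for j using insert that submodule.subset[OF assms(1)] by blast
  then show ?case using insert submodule.m_closed[OF assms(1)] by (simp add: Pi_def)
qed
end

context cstar_algebra begin
lemma finsum_mul_right:
  assumes "finite I" "\<And>i. i \<in> I \<Longrightarrow> f i \<in> carrier A" "y \<in> carrier A"
  shows "(\<Oplus>\<^bsub>A\<^esub>i\<in>I. f i) \<star> y = (\<Oplus>\<^bsub>A\<^esub>i\<in>I. f i \<star> y)"
  using assms(1,2)
proof (induction I)
  case (insert i I)
  then have "(\<Oplus>\<^bsub>A\<^esub>i\<in>I. f i) \<in> carrier A" by (intro M.finsum_closed) auto
  then show ?case using insert assms(3) by (simp add: Pi_def alg_distr_left)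
qed (use assms(3) in simp)

lemma finsum_mul_left:
  assumes "finite I" "\<And>i. i \<in> I \<Longrightarrow> f i \<in> carrier A" "y \<in> carrier A"
  shows "y \<star> (\<Oplus>\<^bsub>A\<^esub>i\<in>I. f i) = (\<Oplus>\<^bsub>A\<^esub>i\<in>I. y \<star> f i)"
  using assms(1,2)
proof (induction I)
  case (insert i I)
  then have "(\<Oplus>\<^bsub>A\<^esub>i\<in>I. f i) \<in> carrier A" by (intro M.finsum_closed) auto
  then show ?case using insert assms(3) by (simp add: Pi_def alg_distr_right)
qed (use assms(3) in simp)
end

context maximal_commutative begin
abbreviation mzero (\<open>\<o>\<close>) where "\<o> \<equiv> \<zero>\<^bsub>A\<^esub>"

definition ideal_of_C :: "'a set \<Rightarrow> bool" where
  "ideal_of_C J \<longleftrightarrow> submodule class_ring J A \<and> J \<subseteq> C \<and> (\<forall>c\<in>C. \<forall>j\<in>J. c \<star> j \<in> J)"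

text \<open>
  Descend through ideals: as long as some \<open>c\<close> in \<open>C\<close> does not act on the ideal as a scalar, one of its
  eigenspaces is a smaller nonzero ideal, because \<open>C\<close> is commutative.
\<close>

lemma common_eigenvector:
  assumes "ideal_of_C J" "v \<in> J" "v \<noteq> \<o>"
  shows "\<exists>w\<in>J. w \<noteq> \<o> \<and> (\<forall>c\<in>C. \<exists>k. c \<star> w = k \<cdot> w)"
  using assms
proof (induction "sdim J" arbitrary: J v rule: less_induct)
  case less
  have J: "submodule class_ring J A" "\<And>j. j \<in> J \<Longrightarrow> j \<in> C" "\<And>c j. c \<in> C \<Longrightarrow> j \<in> J \<Longrightarrow> c \<star> j \<in> J"
    using less.prems(1) by (auto simp: ideal_of_C_def)
  show ?case
  proof (cases "\<forall>c\<in>C. \<exists>k. \<forall>j\<in>J. c \<star> j = k \<cdot> j")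
    case True
    then show ?thesis using less.prems by blast
  next
    case False
    then obtain c where c: "c \<in> C" "\<And>k. \<exists>j\<in>J. c \<star> j \<noteq> k \<cdot> j" by blast
    have cA: "c \<in> carrier A" using c by simp
    obtain \<mu> w where w: "w \<in> J" "w \<noteq> \<o>" "c \<star> w = \<mu> \<cdot> w"
      using eigenvector_exists[OF fd _ _ _ J(1) _ less.prems(2,3), of "\<lambda>x. c \<star> x"] cA J(3)[OF c(1)]
      by (auto simp: alg_distr_right alg_smult_right)
    define J' where "J' = {j\<in>J. c \<star> j = \<mu> \<cdot> j}"
    have sub: "submodule class_ring J' A"
    proof (rule subspI)
      show "J' \<subseteq> carrier A" using J(2) C_in by (auto simp: J'_def)
      show "\<o> \<in> J'" using submodule.zero_closed[OF J(1)] cA by (simp add: J'_def)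
      show "x \<boxplus> y \<in> J'" if "x \<in> J'" "y \<in> J'" for x y
        using that J(2) cA submodule.m_closed[OF J(1)] by (simp add: J'_def alg_distr_right smult_add_right)
      show "k \<cdot> x \<in> J'" if "x \<in> J'" for k x
        using that J(2) cA submodule.smult_closed[OF J(1)] by (simp add: J'_def alg_smult_right smult_smult mult.commute)
    qed
    have "d \<star> j \<in> J'" if d: "d \<in> C" and j: "j \<in> J'" for d j
    proof -
      have jA: "j \<in> carrier A" "j \<in> J" and dA: "d \<in> carrier A" using j d J(2) by (auto simp: J'_def)
      have "c \<star> (d \<star> j) = (c \<star> d) \<star> j" using cA dA jA by (simp add: alg_mult_assoc)
      also have "c \<star> d = d \<star> c" by (rule C_comm[OF c(1) d])
      also have "(d \<star> c) \<star> j = d \<star> (\<mu> \<cdot> j)" using cA dA jA j by (simp add: alg_mult_assoc J'_def)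
      finally have "c \<star> (d \<star> j) = \<mu> \<cdot> (d \<star> j)" using dA jA by (simp add: alg_smult_right)
      then show ?thesis using J(3)[OF d jA(2)] by (simp add: J'_def)
    qed
    then have id: "ideal_of_C J'" using sub J(2) by (auto simp: ideal_of_C_def J'_def)
    have "J' \<subset> J" using c(2)[of \<mu>] by (auto simp: J'_def)
    then have "sdim J' < sdim J" by (intro sdim_less[OF fd sub]) (use J(2) in auto)
    from less.hyps[OF this id, of w] w obtain w' where "w' \<in> J'" "w' \<noteq> \<o>" "\<forall>c\<in>C. \<exists>k. c \<star> w' = k \<cdot> w'"
      by (auto simp: J'_def)
    then show ?thesis by (auto simp: J'_def)
  qed
qed

text \<open>
  The minimal projections of \<open>C\<close>: multiplication by \<open>C\<close> acts on each of them by scalars.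
\<close>

definition MinProj :: "'a set" where
  "MinProj = {p\<in>C. p \<noteq> \<o> \<and> p \<star> p = p \<and> adj p = p \<and> (\<forall>c\<in>C. \<exists>k. c \<star> p = k \<cdot> p)}"

lemma MinProj_C: "p \<in> MinProj \<Longrightarrow> p \<in> C" and MinProj_in: "p \<in> MinProj \<Longrightarrow> p \<in> carrier A" and MinProj_nz: "p \<in> MinProj \<Longrightarrow> p \<noteq> \<o>"
  and MinProj_idem: "p \<in> MinProj \<Longrightarrow> p \<star> p = p" and MinProj_star: "p \<in> MinProj \<Longrightarrow> adj p = p"
  and MinProj_scalar: "p \<in> MinProj \<Longrightarrow> c \<in> C \<Longrightarrow> \<exists>k. c \<star> p = k \<cdot> p"
  by (auto simp: MinProj_def)

text \<open>
  If \<open>w\<close> is a common eigenvector, so is \<open>a = adj w \<star> w\<close>, and \<open>a \<star> a = k \<cdot> a\<close> where \<open>k\<close> is nonzero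
  by the C*-identity and real since \<open>a\<close> is self-adjoint; a multiple of \<open>a\<close> is the projection.
\<close>

lemma minimal_projection_exists:
  assumes J: "ideal_of_C J" "v \<in> J" "v \<noteq> \<o>"
  shows "\<exists>p\<in>MinProj. p \<in> J"
proof -
  obtain w where w: "w \<in> J" "w \<noteq> \<o>" "\<And>c. c \<in> C \<Longrightarrow> \<exists>k. c \<star> w = k \<cdot> w"
    using common_eigenvector[OF J] by blast
  have wC: "w \<in> C" "w \<in> carrier A" using w(1) J(1) by (auto simp: ideal_of_C_def)
  define a where "a = adj w \<star> w"
  have aJ: "a \<in> J" using w(1) J(1) C_star[OF wC(1)] by (auto simp: ideal_of_C_def a_def)
  have aC: "a \<in> C" "a \<in> carrier A" using aJ J(1) by (auto simp: ideal_of_C_def)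
  have sa: "adj a = a" using wC by (simp add: a_def star_mult star_star)
  have anz: "a \<noteq> \<o>" using star_mul_self_eq_0[of w] w(2) wC by (auto simp: a_def)
  have scal: "\<exists>k. c \<star> a = k \<cdot> a" if c: "c \<in> C" for c
  proof -
    obtain k where k: "c \<star> w = k \<cdot> w" using w(3)[OF c] by blast
    have "c \<star> a = (c \<star> adj w) \<star> w" using c wC by (simp add: a_def alg_mult_assoc)
    also have "c \<star> adj w = adj w \<star> c" by (rule C_comm[OF c C_star[OF wC(1)]])
    also have "(adj w \<star> c) \<star> w = k \<cdot> a" using c wC k by (simp add: a_def alg_mult_assoc alg_smult_right)
    finally show ?thesis by blast
  qed
  obtain k where k: "a \<star> a = k \<cdot> a" using scal[OF aC(1)] by blast
  have aa: "a \<star> a \<noteq> \<o>" using star_mul_self_eq_0[OF aC(2)] anz sa by auto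
  have k0: "k \<noteq> 0" using aa k aC by auto
  have "adj (a \<star> a) = a \<star> a" using aC sa by (simp add: star_mult)
  then have "cnj k \<cdot> a = k \<cdot> a" unfolding k using aC sa by (simp add: star_smult)
  then have kr: "cnj k = k" by (rule smult_cancel[OF aC(2) anz])
  let ?p = "(1 / k) \<cdot> a"
  have "?p \<in> J" using aJ J(1) submodule.smult_closed[of class_ring J A "1 / k" a] by (auto simp: ideal_of_C_def)
  moreover have "?p \<in> MinProj" unfolding MinProj_def
  proof (intro CollectI conjI ballI)
    show "?p \<in> C" using \<open>?p \<in> J\<close> J(1) by (auto simp: ideal_of_C_def)
    show "?p \<noteq> \<o>" using smult_eq_0[OF aC(2), of "1 / k"] k0 anz by auto
    show "?p \<star> ?p = ?p" using aC k0 by (simp add: alg_smult_left alg_smult_right k smult_smult)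
    show "adj ?p = ?p" using aC sa kr by (simp add: star_smult)
    fix c assume c: "c \<in> C"
    obtain l where "c \<star> a = l \<cdot> a" using scal[OF c] by blast
    then have "c \<star> ?p = l \<cdot> ?p" using c aC by (simp add: alg_smult_right smult_smult mult.commute)
    then show "\<exists>l. c \<star> ?p = l \<cdot> ?p" by blast
  qed
  ultimately show ?thesis by blast
qed

text \<open>
  The product \<open>p \<star> q\<close> is a multiple of \<open>p\<close> and of \<open>q\<close>, and idempotence forces the factors to be zero or one.
\<close>

lemma MinProj_orth:
  assumes p: "p \<in> MinProj" and q: "q \<in> MinProj" and ne: "p \<noteq> q" shows "p \<star> q = \<o>"
proof (rule ccontr)
  assume nz: "p \<star> q \<noteq> \<o>"
  have *: "p \<star> q = q" if p: "p \<in> MinProj" and q: "q \<in> MinProj" and nz: "p \<star> q \<noteq> \<o>" for p q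
  proof -
    obtain k where k: "p \<star> q = k \<cdot> q" using MinProj_scalar[OF q MinProj_C[OF p]] by blast
    have "p \<star> (p \<star> q) = p \<star> q" using MinProj_in[OF p] MinProj_in[OF q] MinProj_idem[OF p] by (simp flip: alg_mult_assoc)
    then have "k \<cdot> (k \<cdot> q) = k \<cdot> q" unfolding k using MinProj_in[OF p] MinProj_in[OF q] by (simp add: alg_smult_right k)
    then have "(k * k) \<cdot> q = k \<cdot> q" using MinProj_in[OF q] by (simp add: smult_smult)
    then have "k * k = k" by (rule smult_cancel[OF MinProj_in[OF q] MinProj_nz[OF q]])
    moreover have "k \<noteq> 0" using nz k MinProj_in[OF q] by auto
    ultimately show ?thesis using k MinProj_in[OF q] by simp
  qed
  have comm: "p \<star> q = q \<star> p" by (rule C_comm[OF MinProj_C[OF p] MinProj_C[OF q]])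
  have "q = p" using *[OF p q nz] *[OF q p] nz comm by simp
  then show False using ne by simp
qed

lemma MinProj_sum_mul:
  assumes "finite S" "S \<subseteq> MinProj" "q \<in> S"
  shows "(\<Oplus>\<^bsub>A\<^esub>p\<in>S. a p \<cdot> p) \<star> q = a q \<cdot> q"
proof -
  have S: "p \<in> MinProj" "p \<in> carrier A" if "p \<in> S" for p using that assms(2) MinProj_in by auto
  have "(\<Oplus>\<^bsub>A\<^esub>p\<in>S. a p \<cdot> p) \<star> q = (\<Oplus>\<^bsub>A\<^esub>p\<in>S. (a p \<cdot> p) \<star> q)"
    by (rule finsum_mul_right) (use S assms in auto)
  also have "\<dots> = (\<Oplus>\<^bsub>A\<^esub>p\<in>S. if q = p then a p \<cdot> p else \<o>)"
    by (rule M.finsum_cong') (use S assms MinProj_orth MinProj_idem in \<open>auto simp: alg_smult_left\<close>)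
  also have "\<dots> = a q \<cdot> q" by (rule M.finsum_singleton) (use S assms in auto)
  finally show ?thesis .
qed

text \<open>
  Orthogonal projections are independent: multiplication by one of them isolates its coefficient.
\<close>

lemma MinProj_card: "finite MinProj" "card MinProj \<le> vectorspace.dim class_ring (A\<lparr>carrier := C\<rparr>)"
proof -
  interpret W: cnormed_space "A\<lparr>carrier := C\<rparr>" by (rule cnormed_space_subsp[OF C_sub])
  have "\<not> lin_dep MinProj"
  proof
    assume "lin_dep MinProj"
    then obtain S a v where S: "finite S" "S \<subseteq> MinProj" "lincomb a S = \<o>" "v \<in> S" "a v \<noteq> 0"
      by (auto simp: lin_dep_def)
    have "a v \<cdot> v = \<o> \<star> v" using MinProj_sum_mul[OF S(1,2,4), of a] S(3) by (simp add: lincomb_def)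
    then have "a v \<cdot> v = \<o>" using S MinProj_in by auto
    then show False using smult_eq_0[of v "a v"] S MinProj_in[of v] MinProj_nz[of v] by auto
  qed
  moreover have PC: "MinProj \<subseteq> C" using MinProj_C by blast
  ultimately have "\<not> W.lin_dep MinProj" using span_li_not_depend(2)[OF PC C_sub] by simp
  then show "finite MinProj" "card MinProj \<le> W.dim" using W.li_le_dim[OF subsp_fin_dim[OF fd C_sub], of MinProj] PC by auto
qed

definition unit_C :: 'a where "unit_C = (\<Oplus>\<^bsub>A\<^esub>p\<in>MinProj. p)"

lemma unit_C_in_C: "unit_C \<in> C" unfolding unit_C_def by (rule finsum_subsp[OF C_sub MinProj_card(1) MinProj_C])

lemma unit_C_in: "unit_C \<in> carrier A" using unit_C_in_C by simp

lemma unit_C_mul: assumes q: "q \<in> MinProj" shows "unit_C \<star> q = q"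
proof -
  have "unit_C = (\<Oplus>\<^bsub>A\<^esub>p\<in>MinProj. 1 \<cdot> p)" unfolding unit_C_def by (rule M.finsum_cong') (use MinProj_in in auto)
  then show ?thesis using MinProj_sum_mul[OF MinProj_card(1) subset_refl q, of "\<lambda>_. 1"] MinProj_in[OF q] by simp
qed

text \<open>
  The elements of \<open>C\<close> that are orthogonal to all minimal projections form an ideal. It contains no minimal
  projection, so it is zero.
\<close>

lemma C_mul_unit_C: assumes x: "x \<in> C" shows "x \<star> unit_C = x"
proof -
  have xA: "x \<in> carrier A" using x by simp
  define J where "J = {y\<in>C. \<forall>q\<in>MinProj. y \<star> q = \<o>}"
  have "submodule class_ring J A"
    by (rule subspI) (use submodule.zero_closed[OF C_sub] submodule.m_closed[OF C_sub] submodule.smult_closed[OF C_sub] MinProj_in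
        in \<open>auto simp: J_def alg_distr_left alg_smult_left\<close>)
  moreover have "c \<star> j \<in> J" if "c \<in> C" "j \<in> J" for c j
    using that MinProj_in C_mult by (auto simp: J_def alg_mult_assoc)
  ultimately have J: "ideal_of_C J" by (auto simp: ideal_of_C_def J_def)
  \<comment> \<open>such a projection would be orthogonal to itself\<close>
  have noP: "\<not> (\<exists>p\<in>MinProj. p \<in> J)"
  proof
    assume "\<exists>p\<in>MinProj. p \<in> J"
    then obtain p where p: "p \<in> MinProj" "p \<star> p = \<o>" by (auto simp: J_def)
    then show False using MinProj_idem[OF p(1)] MinProj_nz[OF p(1)] by simp
  qed
  let ?y = "x \<boxminus> x \<star> unit_C"
  have yC: "?y \<in> C"
  proof -
    have xe: "x \<star> unit_C \<in> carrier A" using xA unit_C_in by simp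
    have "(-1) \<cdot> (x \<star> unit_C) \<in> C" using C_mult[OF x unit_C_in_C] submodule.smult_closed[OF C_sub] by simp
    then show ?thesis unfolding sub_eq[OF xA xe] using x submodule.m_closed[OF C_sub] by simp
  qed
  have "?y \<star> q = \<o>" if q: "q \<in> MinProj" for q
    using xA unit_C_in MinProj_in[OF q] by (simp add: mul_sub_left alg_mult_assoc unit_C_mul[OF q] sub_self)
  then have "?y \<in> J" using yC by (simp add: J_def)
  then have "?y = \<o>" using minimal_projection_exists[OF J] noP by blast
  then show ?thesis using sub_eq_0_iff[of x "x \<star> unit_C"] xA unit_C_in by simp
qed

text \<open>
  For \<open>y = b - b e\<close>, where \<open>e\<close> denotes \<open>unit_C\<close>, the element \<open>adj y \<star> y\<close> annihilates \<open>C\<close> from both sides. In particular it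
  commutes with \<open>C\<close>, so it belongs to \<open>C\<close> by maximality and annihilates itself.
\<close>

lemma mul_unit_C: assumes b: "b \<in> carrier A" shows "b \<star> unit_C = b"
proof -
  let ?y = "b \<boxminus> b \<star> unit_C"
  have y: "?y \<in> carrier A" using b unit_C_in by simp
  have yc: "?y \<star> c = \<o>" if c: "c \<in> C" for c
  proof -
    have "unit_C \<star> c = c" using C_comm[OF unit_C_in_C c] C_mul_unit_C[OF c] by simp
    then show ?thesis using b unit_C_in c by (simp add: mul_sub_left alg_mult_assoc sub_self)
  qed
  let ?z = "adj ?y \<star> ?y"
  have z: "?z \<in> carrier A" "adj ?z = ?z" using y by (simp_all add: star_mult star_star)
  have zc: "?z \<star> c = \<o>" if c: "c \<in> C" for c
  proof -
    have "?z \<star> c = adj ?y \<star> (?y \<star> c)" using y c by (intro alg_mult_assoc) auto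
    then show ?thesis using yc[OF c] y by simp
  qed
  have cz: "c \<star> ?z = \<o>" if c: "c \<in> C" for c
  proof -
    have "adj (?z \<star> adj c) = \<o>" using zc[OF C_star[OF c]] by simp
    then show ?thesis using z c by (simp add: star_mult star_star)
  qed
  have "?z \<in> C" by (rule mem_maximal_commutative[OF max z]) (use zc cz in simp)
  then have "adj ?z \<star> ?z = \<o>" using zc z by simp
  then have "?z = \<o>" by (rule star_mul_self_eq_0[OF z(1)])
  then have "?y = \<o>" by (rule star_mul_self_eq_0[OF y])
  then show ?thesis using sub_eq_0_iff[of b "b \<star> unit_C"] b unit_C_in by simp
qed

lemma unit_C_star: "adj unit_C = unit_C"
proof -
  have 1: "adj unit_C \<star> unit_C = adj unit_C" using mul_unit_C unit_C_in by simp
  have "adj (adj unit_C \<star> unit_C) = adj unit_C \<star> unit_C" using unit_C_in by (simp add: star_mult star_star)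
  then show ?thesis unfolding 1 using unit_C_in by (simp add: star_star)
qed

lemma unit_C_mul_left: assumes b: "b \<in> carrier A" shows "unit_C \<star> b = b"
proof -
  have "adj (adj b \<star> unit_C) = b" using mul_unit_C[of "adj b"] b by (simp add: star_star)
  then show ?thesis using b unit_C_in unit_C_star by (simp add: star_mult star_star)
qed

text \<open>
  The corner element commutes with \<open>C\<close>, which acts on \<open>p\<close> from both sides by the same scalar, so
  it lies in \<open>C\<close> by maximality.
\<close>

lemma corner_sa:
  assumes p: "p \<in> MinProj" and b: "b \<in> carrier A" "adj b = b" shows "\<exists>k. p \<star> b \<star> p = k \<cdot> p"
proof -
  note pA = MinProj_in[OF p]
  let ?x = "p \<star> b \<star> p"
  have x: "?x \<in> carrier A" "adj ?x = ?x" using pA b MinProj_star[OF p] by (simp_all add: star_mult alg_mult_assoc)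
  have "?x \<star> c = c \<star> ?x" if c: "c \<in> C" for c
  proof -
    obtain k where k: "c \<star> p = k \<cdot> p" using MinProj_scalar[OF p c] by blast
    have k': "p \<star> c = k \<cdot> p" using C_comm[OF MinProj_C[OF p] c] k by simp
    have "?x \<star> c = p \<star> b \<star> (p \<star> c)" using pA b c by (intro alg_mult_assoc) auto
    also have "\<dots> = k \<cdot> ?x" unfolding k' using pA b by (simp add: alg_smult_right)
    also have "\<dots> = (c \<star> p) \<star> (b \<star> p)" unfolding k using pA b by (simp add: alg_smult_left alg_mult_assoc)
    also have "\<dots> = c \<star> ?x" using pA b c by (simp add: alg_mult_assoc)
    finally show ?thesis .
  qed
  then have "?x \<in> C" by (rule mem_maximal_commutative[OF max x])
  then obtain k where "?x \<star> p = k \<cdot> p" using MinProj_scalar[OF p] by blast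
  moreover have "?x \<star> p = ?x" using pA b by (simp add: alg_mult_assoc MinProj_idem[OF p])
  ultimately show ?thesis by metis
qed

text \<open>
  The general case reduces to the self-adjoint one by real and imaginary parts.
\<close>

lemma corner:
  assumes p: "p \<in> MinProj" and b: "b \<in> carrier A" shows "\<exists>k. p \<star> b \<star> p = k \<cdot> p"
proof -
  note pA = MinProj_in[OF p]
  let ?h = "b \<boxplus> adj b" and ?g = "\<i> \<cdot> b \<boxplus> (- \<i>) \<cdot> adj b"
  have h: "?h \<in> carrier A" "adj ?h = ?h" using b by (simp_all add: star_add star_star M.a_comm)
  have g: "?g \<in> carrier A" "adj ?g = ?g" using b by (simp_all add: star_add star_star star_smult M.a_comm)
  obtain k l where k: "p \<star> ?h \<star> p = k \<cdot> p" and l: "p \<star> ?g \<star> p = l \<cdot> p"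
    using corner_sa[OF p h] corner_sa[OF p g] by blast
  have "2 \<cdot> b = ?h \<boxplus> (- \<i>) \<cdot> ?g"
  proof -
    have "?h \<boxplus> (- \<i>) \<cdot> ?g = (b \<boxplus> b) \<boxplus> (adj b \<boxplus> (-1) \<cdot> adj b)"
      using b by (simp add: smult_add_right smult_smult M.a_assoc M.a_lcomm[of "adj b" b])
    also have "\<dots> = 2 \<cdot> b" using b smult_add_left[of b 1 1] smult_add_left[of "adj b" 1 "-1"] by simp
    finally show ?thesis by simp
  qed
  then have "b = (1/2) \<cdot> (?h \<boxplus> (- \<i>) \<cdot> ?g)" using b smult_smult[of b "1/2" 2] by simp
  then have "p \<star> b \<star> p = p \<star> ((1/2) \<cdot> (?h \<boxplus> (- \<i>) \<cdot> ?g)) \<star> p" by simp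
  also have "\<dots> = (1/2) \<cdot> (p \<star> ?h \<star> p \<boxplus> (- \<i>) \<cdot> (p \<star> ?g \<star> p))"
  proof -
    have "p \<star> (c \<cdot> (x \<boxplus> d \<cdot> y)) \<star> p = c \<cdot> (p \<star> x \<star> p \<boxplus> d \<cdot> (p \<star> y \<star> p))"
      if "x \<in> carrier A" "y \<in> carrier A" for c d x y
      using that pA by (simp add: alg_smult_left alg_smult_right alg_distr_left alg_distr_right)
    from this[OF h(1) g(1)] show ?thesis .
  qed
  also have "\<dots> = ((1/2) * (k + (- \<i>) * l)) \<cdot> p"
    unfolding k l using pA by (simp add: smult_smult smult_add_left flip: smult_add_left)
  finally show ?thesis by blast
qed

text \<open>
  If \<open>u\<close> is a nonzero element of the corner \<open>p A q\<close>, then for every \<open>y\<close> in that corner \<open>y \<star> adj u\<close> is a multiple of \<open>p\<close> and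
  \<open>adj u \<star> u\<close> a nonzero multiple of \<open>q\<close>; evaluating \<open>y \<star> adj u \<star> u\<close> in two ways shows that \<open>y\<close> is a multiple of \<open>u\<close>.
\<close>

lemma off_diagonal:
  assumes p: "p \<in> MinProj" and q: "q \<in> MinProj"
  shows "\<exists>u\<in>carrier A. \<forall>b\<in>carrier A. \<exists>k. p \<star> b \<star> q = k \<cdot> u"
proof (cases "\<forall>b\<in>carrier A. p \<star> b \<star> q = \<o>")
  case True
  then show ?thesis by (intro bexI[of _ \<o>]) auto
next
  case False
  then obtain c where c: "c \<in> carrier A" "p \<star> c \<star> q \<noteq> \<o>" by blast
  note pA = MinProj_in[OF p] and qA = MinProj_in[OF q]
  let ?u = "p \<star> c \<star> q"
  have u: "?u \<in> carrier A" using pA qA c by simp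
  have su: "adj ?u = q \<star> (adj c \<star> p)" using pA qA c by (simp add: star_mult MinProj_star[OF p] MinProj_star[OF q] alg_mult_assoc)
  obtain m where m: "q \<star> (adj c \<star> p \<star> p \<star> c) \<star> q = m \<cdot> q" using corner[OF q, of "adj c \<star> p \<star> p \<star> c"] pA c by auto
  have uu: "adj ?u \<star> ?u = m \<cdot> q" unfolding su m[symmetric] using pA qA c by (simp add: alg_mult_assoc)
  have m0: "m \<noteq> 0" using uu star_mul_self_eq_0[OF u] c(2) qA by auto
  have "\<exists>k. p \<star> b \<star> q = k \<cdot> ?u" if b: "b \<in> carrier A" for b
  proof -
    obtain l where l: "p \<star> (b \<star> q \<star> q \<star> adj c) \<star> p = l \<cdot> p" using corner[OF p, of "b \<star> q \<star> q \<star> adj c"] qA b c by auto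
    have bu: "(p \<star> b \<star> q) \<star> adj ?u = l \<cdot> p" unfolding su l[symmetric] using pA qA b c by (simp add: alg_mult_assoc)
    have "m \<cdot> (p \<star> b \<star> q) = (p \<star> b \<star> q) \<star> (adj ?u \<star> ?u)"
      unfolding uu using pA qA b by (simp add: alg_smult_right alg_mult_assoc MinProj_idem[OF q])
    also have "\<dots> = (p \<star> b \<star> q) \<star> adj ?u \<star> ?u"
      by (rule alg_mult_assoc[symmetric]) (use pA qA b u in auto)
    also have "\<dots> = l \<cdot> (p \<star> ?u)" unfolding bu using pA u by (simp add: alg_smult_left)
    also have "p \<star> ?u = ?u" using pA qA c by (simp add: MinProj_idem[OF p] flip: alg_mult_assoc)
    finally have "(1 / m) \<cdot> (m \<cdot> (p \<star> b \<star> q)) = (1 / m) \<cdot> (l \<cdot> ?u)" by simp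
    then have "p \<star> b \<star> q = (1 / m * l) \<cdot> ?u" using m0 pA qA b u by (simp add: smult_smult)
    then show ?thesis by blast
  qed
  then show ?thesis using u by blast
qed

lemma nrm_MinProj: "p \<in> MinProj \<Longrightarrow> nrm A p \<le> 1"
proof -
  assume p: "p \<in> MinProj"
  have "(nrm A p)\<^sup>2 = nrm A p" using cstar_identity[OF MinProj_in[OF p]] MinProj_star[OF p] MinProj_idem[OF p] by simp
  then show ?thesis by (cases "nrm A p = 0") (auto simp: power2_eq_square)
qed

text \<open>
  The coordinate in the at most one-dimensional corner, scaled so that its absolute value is the norm.
\<close>

lemma matrix_coefficient:
  assumes p: "p \<in> MinProj" and q: "q \<in> MinProj"
  shows "\<exists>f. lin_fun f \<and> (\<forall>b\<in>carrier A. cmod (f b) = nrm A (p \<star> b \<star> q))"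
proof -
  note pA = MinProj_in[OF p] and qA = MinProj_in[OF q]
  obtain u where u: "u \<in> carrier A" "\<And>b. b \<in> carrier A \<Longrightarrow> \<exists>k. p \<star> b \<star> q = k \<cdot> u" using off_diagonal[OF p q] by blast
  then obtain k where k: "\<And>b. b \<in> carrier A \<Longrightarrow> p \<star> b \<star> q = k b \<cdot> u" by metis
  define f where "f b = k b * complex_of_real (nrm A u)" for b
  have n: "cmod (f b) = nrm A (p \<star> b \<star> q)" if b: "b \<in> carrier A" for b
    using u(1) by (simp add: k[OF b] nrm_smult f_def norm_mult nrm_nonneg)
  have "lin_fun f"
  proof (cases "u = \<o>")
    case True
    then show ?thesis by (simp add: lin_fun_def f_def)
  next
    case False
    have "k (x \<boxplus> y) = k x + k y" if xy: "x \<in> carrier A" "y \<in> carrier A" for x y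
    proof (rule smult_cancel[OF u(1) False])
      have "k (x \<boxplus> y) \<cdot> u = p \<star> (x \<boxplus> y) \<star> q" using k[of "x \<boxplus> y"] xy by simp
      also have "\<dots> = p \<star> x \<star> q \<boxplus> p \<star> y \<star> q" using xy pA qA by (simp add: alg_distr_left alg_distr_right)
      also have "\<dots> = (k x + k y) \<cdot> u" using k xy u(1) by (simp add: smult_add_left)
      finally show "k (x \<boxplus> y) \<cdot> u = (k x + k y) \<cdot> u" .
    qed
    moreover have "k (c \<cdot> x) = c * k x" if x: "x \<in> carrier A" for c x
    proof (rule smult_cancel[OF u(1) False])
      have "k (c \<cdot> x) \<cdot> u = p \<star> (c \<cdot> x) \<star> q" using k[of "c \<cdot> x"] x by simp
      also have "\<dots> = c \<cdot> (p \<star> x \<star> q)" using x pA qA by (simp add: alg_smult_left alg_smult_right)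
      also have "\<dots> = (c * k x) \<cdot> u" using k[OF x] u(1) by (simp add: smult_smult)
      finally show "k (c \<cdot> x) \<cdot> u = (c * k x) \<cdot> u" .
    qed
    ultimately show ?thesis by (auto simp: lin_fun_def f_def algebra_simps)
  qed
  then show ?thesis using n by blast
qed

lemma nrm_le_sum_corners:
  assumes b: "b \<in> carrier A" shows "nrm A b \<le> (\<Sum>p\<in>MinProj. \<Sum>q\<in>MinProj. nrm A (p \<star> b \<star> q))"
proof -
  have "b = unit_C \<star> b" using unit_C_mul_left[OF b] by simp
  also have "\<dots> = (\<Oplus>\<^bsub>A\<^esub>p\<in>MinProj. p \<star> b)" unfolding unit_C_def by (rule finsum_mul_right) (use MinProj_card MinProj_in b in auto)
  finally have 1: "nrm A b \<le> (\<Sum>p\<in>MinProj. nrm A (p \<star> b))"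
    using nrm_finsum_le[OF MinProj_card(1), of "\<lambda>p. p \<star> b"] MinProj_in b by auto
  have 2: "nrm A (p \<star> b) \<le> (\<Sum>q\<in>MinProj. nrm A (p \<star> b \<star> q))" if p: "p \<in> MinProj" for p
  proof -
    have "p \<star> b = (p \<star> b) \<star> unit_C" using mul_unit_C[of "p \<star> b"] b MinProj_in[OF p] by simp
    also have "\<dots> = (\<Oplus>\<^bsub>A\<^esub>q\<in>MinProj. (p \<star> b) \<star> q)" unfolding unit_C_def by (rule finsum_mul_left) (use MinProj_card MinProj_in b p in auto)
    finally show ?thesis
      using nrm_finsum_le[OF MinProj_card(1), of "\<lambda>q. (p \<star> b) \<star> q"] MinProj_in b p by auto
  qed
  show ?thesis using 1 sum_mono[OF 2] by (rule order_trans)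
qed
end

text \<open>
  For a full matrix algebra and its diagonal subalgebra these functionals are the matrix entries.
\<close>

lemma rank_many_functionals:
  assumes "finite_dim_cstar_algebra B"
  shows "\<exists>(P :: 'b set) f. finite P \<and> card P \<le> cstar_rank (B :: ('b, 'm) cstar_scheme) \<and>
    (\<forall>p\<in>P. \<forall>q\<in>P. cstar_algebra.lin_fun B (f p q) \<and> (\<forall>b\<in>carrier B. cmod (f p q b) \<le> nrm B b)) \<and>
    (\<forall>b\<in>carrier B. nrm B b \<le> (\<Sum>p\<in>P. \<Sum>q\<in>P. cmod (f p q b)))"
proof -
  interpret B: cstar_algebra B using assms by (simp add: finite_dim_cstar_algebra_def)
  define C where "C = (SOME C. maximal_commutative_subalgebra C B)"
  have "maximal_commutative_subalgebra C B"
    unfolding C_def by (rule someI_ex[OF B.maximal_commutative_subalgebra_exists])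
  then interpret maximal_commutative B C
    by unfold_locales (use assms in \<open>simp_all add: finite_dim_cstar_algebra_def\<close>)
  have "\<exists>f. \<forall>p\<in>MinProj. \<forall>q\<in>MinProj. B.lin_fun (f p q) \<and> (\<forall>b\<in>carrier B. cmod (f p q b) = nrm B (p \<otimes>\<^bsub>B\<^esub> b \<otimes>\<^bsub>B\<^esub> q))"
    using matrix_coefficient by metis
  then obtain f where f: "\<And>p q. p \<in> MinProj \<Longrightarrow> q \<in> MinProj \<Longrightarrow> B.lin_fun (f p q)"
    "\<And>p q b. p \<in> MinProj \<Longrightarrow> q \<in> MinProj \<Longrightarrow> b \<in> carrier B \<Longrightarrow> cmod (f p q b) = nrm B (p \<otimes>\<^bsub>B\<^esub> b \<otimes>\<^bsub>B\<^esub> q)" by blast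
  have "nrm B (p \<otimes>\<^bsub>B\<^esub> b \<otimes>\<^bsub>B\<^esub> q) \<le> nrm B b" if "p \<in> MinProj" "q \<in> MinProj" "b \<in> carrier B" for p q b
  proof -
    have "nrm B (p \<otimes>\<^bsub>B\<^esub> b \<otimes>\<^bsub>B\<^esub> q) \<le> nrm B (p \<otimes>\<^bsub>B\<^esub> b) * nrm B q" using that MinProj_in by (intro B.nrm_mult) auto
    also have "\<dots> \<le> (nrm B p * nrm B b) * nrm B q" using that MinProj_in by (intro mult_right_mono B.nrm_mult B.nrm_nonneg)
    also have "\<dots> \<le> (1 * nrm B b) * 1" using that MinProj_in nrm_MinProj by (intro mult_mono mult_nonneg_nonneg B.nrm_nonneg) auto
    finally show ?thesis by simp
  qed
  moreover have "nrm B b \<le> (\<Sum>p\<in>MinProj. \<Sum>q\<in>MinProj. cmod (f p q b))" if "b \<in> carrier B" for b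
    using nrm_le_sum_corners[OF that] f(2)[OF _ _ that] by simp
  moreover have "card MinProj \<le> cstar_rank B" using MinProj_card(2) by (simp add: cstar_rank_def C_def)
  ultimately show ?thesis using MinProj_card(1) f by (intro exI[of _ MinProj] exI[of _ f]) auto
qed

section \<open>From almost isometric copies of finite-dimensional l1 spaces to large rank\<close>

lemma linear_mapD:
  assumes "linear_map class_ring V W f"
  shows "x \<in> carrier V \<Longrightarrow> f x \<in> carrier W"
    and "x \<in> carrier V \<Longrightarrow> y \<in> carrier V \<Longrightarrow> f (x \<oplus>\<^bsub>V\<^esub> y) = f x \<oplus>\<^bsub>W\<^esub> f y"
    and "x \<in> carrier V \<Longrightarrow> f (c \<odot>\<^bsub>V\<^esub> x) = (c :: complex) \<odot>\<^bsub>W\<^esub> f x"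
    and "vectorspace class_ring V" "vectorspace class_ring W"
proof -
  interpret f: linear_map class_ring V W f by fact
  show "x \<in> carrier V \<Longrightarrow> f x \<in> carrier W" by (rule f.f_im)
  show "x \<in> carrier V \<Longrightarrow> y \<in> carrier V \<Longrightarrow> f (x \<oplus>\<^bsub>V\<^esub> y) = f x \<oplus>\<^bsub>W\<^esub> f y" by (rule f.f_add)
  show "x \<in> carrier V \<Longrightarrow> f (c \<odot>\<^bsub>V\<^esub> x) = c \<odot>\<^bsub>W\<^esub> f x" by (rule f.f_smult) auto
  show "vectorspace class_ring V" "vectorspace class_ring W" by unfold_locales
qed

lemma linear_mapI:
  assumes "vectorspace (class_ring :: complex ring) V" "vectorspace (class_ring :: complex ring) W"
    "\<And>x. x \<in> carrier V \<Longrightarrow> f x \<in> carrier W"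
    "\<And>x y. x \<in> carrier V \<Longrightarrow> y \<in> carrier V \<Longrightarrow> f (x \<oplus>\<^bsub>V\<^esub> y) = f x \<oplus>\<^bsub>W\<^esub> f y"
    "\<And>c x. x \<in> carrier V \<Longrightarrow> f (c \<odot>\<^bsub>V\<^esub> x) = c \<odot>\<^bsub>W\<^esub> f x"
  shows "linear_map class_ring V W f"
  by (intro linear_map.intro mod_hom.intro mod_hom_axioms.intro assms(1,2) vectorspace.axioms(1))
     (use assms in \<open>auto simp: module_hom_def\<close>)

lemma star_hom_comp:
  assumes f: "star_hom A B f" and g: "star_hom B C g" shows "star_hom A C (\<lambda>x. g (f x))"
proof -
  have lf: "linear_map class_ring A B f" and lg: "linear_map class_ring B C g"
    using f g by (auto simp: star_hom_def)
  note F = linear_mapD[OF lf] and G = linear_mapD[OF lg]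
  have "linear_map class_ring A C (\<lambda>x. g (f x))"
    by (rule linear_mapI) (use F G in auto)
  then show ?thesis using f g F(1) by (auto simp: star_hom_def)
qed

lemma faithful_rep_funpow:
  assumes rep: "faithful_rep A H \<pi>" and aut: "cstar_automorphism A \<alpha>"
  shows "faithful_rep A H (\<lambda>x. \<pi> ((\<alpha> ^^ k) x)) \<and> (\<forall>x\<in>carrier A. (\<alpha> ^^ k) x \<in> carrier A)"
proof (induction k)
  case 0
  then show ?case using rep by simp
next
  case (Suc k)
  have a: "star_hom A A \<alpha>" "bij_betw \<alpha> (carrier A) (carrier A)" using aut by (auto simp: cstar_automorphism_def)
  have \<alpha>in: "\<alpha> x \<in> carrier A" if "x \<in> carrier A" for x using a(2) that by (auto simp: bij_betw_def)
  have h: "star_hom A (op_algebra H) (\<lambda>x. \<pi> ((\<alpha> ^^ k) x))" and i: "inj_on (\<lambda>x. \<pi> ((\<alpha> ^^ k) x)) (carrier A)"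
    using Suc by (auto simp: faithful_rep_def)
  have "star_hom A (op_algebra H) (\<lambda>x. \<pi> ((\<alpha> ^^ k) (\<alpha> x)))" by (rule star_hom_comp[OF a(1) h])
  moreover have "inj_on (\<lambda>x. \<pi> ((\<alpha> ^^ k) (\<alpha> x))) (carrier A)"
    using comp_inj_on[of \<alpha> "carrier A" "\<lambda>x. \<pi> ((\<alpha> ^^ k) x)"] a(2) i by (simp add: bij_betw_def o_def)
  ultimately show ?case using Suc \<alpha>in rep by (simp add: faithful_rep_def funpow_Suc_right del: funpow.simps)
qed

text \<open>
  Both \<open>\<pi>\<close> and its composition with the power of \<open>\<alpha>\<close> are faithful representations, hence isometric.
\<close>

lemma nrm_automorphism_funpow:
  assumes "cstar_algebra A" and rep: "faithful_rep A H \<pi>" and aut: "cstar_automorphism A \<alpha>" and x: "x \<in> carrier A"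
  shows "nrm A ((\<alpha> ^^ k) x) = nrm A x"
  using faithful_rep_isometric[OF assms(1) conjunct1[OF faithful_rep_funpow[OF rep aut]] x]
    faithful_rep_isometric[OF assms(1) rep, of "(\<alpha> ^^ k) x"] faithful_rep_funpow[OF rep aut, of k] x by simp

lemma cnormed_space_op_algebra:
  assumes H: "chilbert_space H" and vs: "vectorspace class_ring (op_algebra H)"
  shows "cnormed_space (op_algebra H)"
proof (intro cnormed_space.intro cnormed_space_axioms.intro vs)
  interpret H: chilbert_space H by (rule H)
  have lin: "bounded_linear_map H H T" if "T \<in> carrier (op_algebra H)" for T
    using that by (simp add: op_algebra_def bounded_ops_def)
  note opn = bounded_linear_map_op_norm[OF H.cnormed_space_axioms H.cnormed_space_axioms lin]
  have Tin: "T \<xi> \<in> carrier H" if T: "T \<in> carrier (op_algebra H)" and "\<xi> \<in> carrier H" for T \<xi>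
    using linear_mapD(1)[of H H T \<xi>] lin[OF T] that by (simp add: bounded_linear_map_def)
  fix T assume T: "T \<in> carrier (op_algebra H)"
  show nn: "0 \<le> nrm (op_algebra H) T" using opn(2)[OF T] by (simp add: op_algebra_def)
  show "nrm (op_algebra H) T = 0 \<longleftrightarrow> T = \<zero>\<^bsub>op_algebra H\<^esub>"
  proof
    assume 0: "nrm (op_algebra H) T = 0"
    show "T = \<zero>\<^bsub>op_algebra H\<^esub>"
    proof (rule extensionalityI)
      show "T \<in> extensional (carrier H)" using T by (simp add: op_algebra_def bounded_ops_def)
      show "\<zero>\<^bsub>op_algebra H\<^esub> \<in> extensional (carrier H)" by (simp add: op_algebra_def)
      fix \<xi> assume \<xi>: "\<xi> \<in> carrier H"
      have "nrm H (T \<xi>) \<le> 0" using opn(1)[OF T \<xi>] 0 by (simp add: op_algebra_def)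
      then have "T \<xi> = \<zero>\<^bsub>H\<^esub>" using H.nrm_eq_0[OF Tin[OF T \<xi>]] H.nrm_nonneg[OF Tin[OF T \<xi>]] by simp
      then show "T \<xi> = \<zero>\<^bsub>op_algebra H\<^esub> \<xi>" using \<xi> by (simp add: op_algebra_def)
    qed
  next
    assume 0: "T = \<zero>\<^bsub>op_algebra H\<^esub>"
    have "op_norm H H T \<le> 0"
      by (rule op_norm_le[OF H.cnormed_space_axioms]) (simp_all add: 0 op_algebra_def)
    then show "nrm (op_algebra H) T = 0" using nn by (simp add: op_algebra_def)
  qed
  show "nrm (op_algebra H) (c \<odot>\<^bsub>op_algebra H\<^esub> T) = cmod c * nrm (op_algebra H) T" for c
  proof -
    have le: "op_norm H H (d \<odot>\<^bsub>op_algebra H\<^esub> S) \<le> cmod d * op_norm H H S" if S: "S \<in> carrier (op_algebra H)" for d S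
      by (rule op_norm_le[OF H.cnormed_space_axioms])
         (use opn[OF S] Tin[OF S] in \<open>auto simp: op_algebra_def H.nrm_smult mult.assoc intro!: mult_left_mono mult_nonneg_nonneg\<close>)
    have cT: "c \<odot>\<^bsub>op_algebra H\<^esub> T \<in> carrier (op_algebra H)"
    proof -
      interpret vectorspace class_ring "op_algebra H" by (rule vs)
      show ?thesis using T by simp
    qed
    show ?thesis
    proof (cases "c = 0")
      case True
      then show ?thesis using le[OF T, of 0] opn(2)[OF cT] by (simp add: op_algebra_def)
    next
      case False
      have "inverse c \<odot>\<^bsub>op_algebra H\<^esub> (c \<odot>\<^bsub>op_algebra H\<^esub> T) = T"
      proof -
        interpret vectorspace class_ring "op_algebra H" by (rule vs)
        show ?thesis using smult_assoc1[of "inverse c" c T] smult_one[of T] T False by simp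
      qed
      then have "op_norm H H T \<le> cmod (inverse c) * op_norm H H (c \<odot>\<^bsub>op_algebra H\<^esub> T)"
        using le[OF cT, of "inverse c"] by simp
      then have "cmod c * op_norm H H T \<le> op_norm H H (c \<odot>\<^bsub>op_algebra H\<^esub> T)"
        using False by (simp add: norm_inverse norm_divide field_simps)
      then show ?thesis using le[OF T, of c] by (simp add: op_algebra_def)
    qed
  qed
  fix S assume S: "S \<in> carrier (op_algebra H)"
  have "op_norm H H (T \<oplus>\<^bsub>op_algebra H\<^esub> S) \<le> op_norm H H T + op_norm H H S"
  proof (rule op_norm_le[OF H.cnormed_space_axioms])
    show "0 \<le> op_norm H H T + op_norm H H S" using opn(2)[OF T] opn(2)[OF S] by simp
    fix \<xi> assume \<xi>: "\<xi> \<in> carrier H"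
    have "nrm H ((T \<oplus>\<^bsub>op_algebra H\<^esub> S) \<xi>) \<le> nrm H (T \<xi>) + nrm H (S \<xi>)"
      using H.nrm_triangle[OF Tin[OF T \<xi>] Tin[OF S \<xi>]] \<xi> by (simp add: op_algebra_def)
    also have "\<dots> \<le> (op_norm H H T + op_norm H H S) * nrm H \<xi>"
      using opn(1)[OF T \<xi>] opn(1)[OF S \<xi>] by (simp add: algebra_simps)
    finally show "nrm H ((T \<oplus>\<^bsub>op_algebra H\<^esub> S) \<xi>) \<le> (op_norm H H T + op_norm H H S) * nrm H \<xi>" .
  qed
  then show "nrm (op_algebra H) (T \<oplus>\<^bsub>op_algebra H\<^esub> S) \<le> nrm (op_algebra H) T + nrm (op_algebra H) S"
    by (simp add: op_algebra_def)
qed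

lemma cnormed_space_l1_space:
  assumes "finite I" "vectorspace class_ring (l1_space I)" shows "cnormed_space (l1_space I)"
proof (intro cnormed_space.intro cnormed_space_axioms.intro assms(2))
  fix x :: "'a \<Rightarrow> complex" assume x: "x \<in> carrier (l1_space I)"
  show "0 \<le> nrm (l1_space I) x" by (simp add: l1_space_def sum_nonneg)
  show "nrm (l1_space I) x = 0 \<longleftrightarrow> x = \<zero>\<^bsub>l1_space I\<^esub>"
    using x assms(1) by (auto simp: l1_space_def sum_nonneg_eq_0_iff fun_eq_iff)
  show "nrm (l1_space I) (c \<odot>\<^bsub>l1_space I\<^esub> x) = cmod c * nrm (l1_space I) x" for c
    by (simp add: l1_space_def norm_mult sum_distrib_left)
  show "nrm (l1_space I) (x \<oplus>\<^bsub>l1_space I\<^esub> y) \<le> nrm (l1_space I) x + nrm (l1_space I) y" for y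
  proof -
    have "(\<Sum>i\<in>I. cmod (x i + y i)) \<le> (\<Sum>i\<in>I. cmod (x i) + cmod (y i))"
      by (intro sum_mono norm_triangle_ineq)
    then show ?thesis by (simp add: l1_space_def sum.distrib)
  qed
qed

context cstar_algebra begin

lemma linear_map_sign_sum:
  assumes B: "cstar_algebra B" and lin: "linear_map class_ring A B f"
    and S: "finite S" "\<And>i. i \<in> S \<Longrightarrow> x i \<in> carrier A"
  shows "f (sign_sum S x \<epsilon>) = cstar_algebra.sign_sum B S (\<lambda>i. f (x i)) \<epsilon>"
proof -
  interpret B: cstar_algebra B by (rule B)
  note f = linear_mapD[OF lin]
  have f0: "f \<zero>\<^bsub>A\<^esub> = \<zero>\<^bsub>B\<^esub>" using f(3)[of "\<zero>\<^bsub>A\<^esub>" 0] f(1)[of "\<zero>\<^bsub>A\<^esub>"] by simp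
  show ?thesis using S unfolding sign_sum_def B.sign_sum_def
  proof (induction S)
    case (insert i S)
    have "(\<Oplus>\<^bsub>A\<^esub>i\<in>S. complex_of_real (\<epsilon> i) \<cdot> x i) \<in> carrier A" using insert by (intro M.finsum_closed) auto
    then show ?case using insert f by (simp add: Pi_def)
  qed (simp add: f0)
qed

text \<open>
  The two operator norms of the isomorphism are kept apart, since the tolerance of the
  approximation has to be compared with the second one alone. A sign vector is the image of a vector of
  \<open>l\<^sub>1\<close>-norm \<open>card S\<close>; the index set may be taken to be \<open>S\<close> itself because \<open>\<Gamma>\<close> identifies it with the basis.
\<close>

lemma D_isomorphism_l1:
  assumes I: "finite I" and S: "S \<subseteq> carrier A"
    and bij: "bij_betw \<Gamma> (std_basis I) S" and iso: "D_isomorphism D (l1_space I) (span_space A S) \<Gamma>"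
  obtains K1 K2 where "K1 \<ge> 0" "K2 \<ge> 0" "K1 * K2 \<le> D" "\<And>s. s \<in> S \<Longrightarrow> nrm A s \<le> K1"
    "\<And>\<epsilon>. \<epsilon> \<in> signs S \<Longrightarrow> real (card S) \<le> K2 * nrm A (sign_sum S (\<lambda>s. s) \<epsilon>)"
    "\<And>s. s \<in> S \<Longrightarrow> 1 \<le> K2 * nrm A s" "card S = card I"
proof -
  let ?L = "l1_space I" and ?W = "span_space A S"
  let ?e = "\<lambda>i j. if j = i then 1 else 0 :: complex"
  have W: "?W = A\<lparr>carrier := span S\<rparr>" by (simp add: span_space_def)
  have bl: "bounded_linear_map ?L ?W \<Gamma>" and bl': "bounded_linear_map ?W ?L (inv_into (carrier ?L) \<Gamma>)"
    and bijL: "bij_betw \<Gamma> (carrier ?L) (carrier ?W)"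
    and D: "op_norm ?L ?W \<Gamma> * op_norm ?W ?L (inv_into (carrier ?L) \<Gamma>) \<le> D"
    using iso by (auto simp: D_isomorphism_def)
  have lin: "linear_map class_ring ?L ?W \<Gamma>" using bl by (simp add: bounded_linear_map_def)
  note G = linear_mapD[OF lin]
  have L: "cnormed_space ?L" by (rule cnormed_space_l1_space[OF I G(4)])
  have Wn: "cnormed_space ?W" unfolding W by (rule cnormed_space_subsp[OF span_is_submodule[OF S]])
  define K1 where "K1 = op_norm ?L ?W \<Gamma>"
  define K2 where "K2 = op_norm ?W ?L (inv_into (carrier ?L) \<Gamma>)"
  have K1: "nrm A (\<Gamma> f) \<le> K1 * nrm ?L f" if "f \<in> carrier ?L" for f
    using bounded_linear_map_op_norm(1)[OF L Wn bl that] by (simp add: K1_def W)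
  have K2: "nrm ?L f \<le> K2 * nrm A (\<Gamma> f)" if f: "f \<in> carrier ?L" for f
  proof -
    have "inv_into (carrier ?L) \<Gamma> (\<Gamma> f) = f" using bijL f by (simp add: bij_betw_def)
    moreover have "\<Gamma> f \<in> carrier ?W" by (rule G(1)[OF f])
    ultimately show ?thesis using bounded_linear_map_op_norm(1)[OF Wn L bl', of "\<Gamma> f"] by (simp add: K2_def W)
  qed
  have e_in: "?e i \<in> carrier ?L" if "i \<in> I" for i using that by (auto simp: l1_space_def)
  have e_nrm: "nrm ?L (?e i) = 1" if "i \<in> I" for i
  proof -
    have "nrm ?L (?e i) = (\<Sum>j\<in>I. if j = i then 1 else 0)" by (simp add: l1_space_def if_distrib cong: if_cong)
    then show ?thesis using that I by simp
  qed
  have inj_e: "inj_on ?e I" by (rule inj_onI) (metis zero_neq_one)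
  have bijg: "bij_betw (\<lambda>i. \<Gamma> (?e i)) I S"
  proof -
    have "bij_betw ?e I (std_basis I)" unfolding std_basis_def by (rule inj_on_imp_bij_betw[OF inj_e])
    from bij_betw_trans[OF this bij] show ?thesis by (simp add: o_def)
  qed
  have img: "\<exists>i\<in>I. s = \<Gamma> (?e i)" if "s \<in> S" for s using bijg that by (auto simp: bij_betw_def)
  show ?thesis
  proof (rule that[of K1 K2])
    show "K1 \<ge> 0" unfolding K1_def by (rule bounded_linear_map_op_norm(2)[OF L Wn bl])
    show "K2 \<ge> 0" unfolding K2_def by (rule bounded_linear_map_op_norm(2)[OF Wn L bl'])
    show "K1 * K2 \<le> D" using D by (simp add: K1_def K2_def)
    show "nrm A s \<le> K1" if s: "s \<in> S" for s
    proof -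
      obtain i where i: "i \<in> I" "s = \<Gamma> (?e i)" using img[OF s] by blast
      then show ?thesis using K1[OF e_in[OF i(1)]] e_nrm[OF i(1)] by simp
    qed
    show "1 \<le> K2 * nrm A s" if s: "s \<in> S" for s
    proof -
      obtain i where i: "i \<in> I" "s = \<Gamma> (?e i)" using img[OF s] by blast
      then show ?thesis using K2[OF e_in[OF i(1)]] e_nrm[OF i(1)] by simp
    qed
    show cards: "card S = card I" using bij_betw_same_card[OF bijg] by simp
    fix \<epsilon> assume \<epsilon>: "\<epsilon> \<in> signs S"
    define f where "f J = (\<lambda>i. if i \<in> J then complex_of_real (\<epsilon> (\<Gamma> (?e i))) else 0)" for J
    have fin: "f J \<in> carrier ?L" if "J \<subseteq> I" for J using that by (auto simp: f_def l1_space_def)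
    have gin: "\<Gamma> (?e i) \<in> carrier A" if "i \<in> I" for i using bijg S that by (auto simp: bij_betw_def)
    have "\<Gamma> (f J) = (\<Oplus>\<^bsub>A\<^esub>i\<in>J. complex_of_real (\<epsilon> (\<Gamma> (?e i))) \<cdot> \<Gamma> (?e i))" if "finite J" "J \<subseteq> I" for J
      using that
    proof (induction J)
      case empty
      have "f {} = 0 \<odot>\<^bsub>?L\<^esub> f {}" by (simp add: f_def l1_space_def)
      then have "\<Gamma> (f {}) = 0 \<cdot> \<Gamma> (f {})" using G(3)[OF fin[of "{}"], of 0] by (simp add: W)
      moreover have "\<Gamma> (f {}) \<in> carrier A"
        using G(1)[OF fin[of "{}"]] span_is_subset2[OF S] by (auto simp: W)
      ultimately show ?case by simp
    next
      case (insert i J)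
      have "f (insert i J) = complex_of_real (\<epsilon> (\<Gamma> (?e i))) \<odot>\<^bsub>?L\<^esub> ?e i \<oplus>\<^bsub>?L\<^esub> f J"
        using insert by (auto simp: f_def l1_space_def fun_eq_iff)
      moreover have "complex_of_real (\<epsilon> (\<Gamma> (?e i))) \<odot>\<^bsub>?L\<^esub> ?e i \<in> carrier ?L"
        using insert by (auto simp: l1_space_def)
      ultimately have "\<Gamma> (f (insert i J)) = complex_of_real (\<epsilon> (\<Gamma> (?e i))) \<cdot> \<Gamma> (?e i) \<boxplus> \<Gamma> (f J)"
        using insert G(2) G(3)[OF e_in] fin[of J] by (simp add: W)
      then show ?case using insert gin by (subst M.finsum_insert) auto
    qed
    from this[OF I subset_refl]
    have "\<Gamma> (f I) = (\<Oplus>\<^bsub>A\<^esub>i\<in>I. complex_of_real (\<epsilon> (\<Gamma> (?e i))) \<cdot> \<Gamma> (?e i))" .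
    also have "\<dots> = (\<Oplus>\<^bsub>A\<^esub>s\<in>(\<lambda>i. \<Gamma> (?e i)) ` I. complex_of_real (\<epsilon> s) \<cdot> s)"
      by (rule M.finsum_reindex[symmetric]) (use bijg gin in \<open>auto simp: bij_betw_def\<close>)
    also have "(\<lambda>i. \<Gamma> (?e i)) ` I = S" using bijg by (simp add: bij_betw_def)
    finally have y: "\<Gamma> (f I) = sign_sum S (\<lambda>s. s) \<epsilon>" by (simp add: sign_sum_def)
    have "nrm ?L (f I) = (\<Sum>i\<in>I. 1)"
    proof -
      have "cmod (complex_of_real (\<epsilon> (\<Gamma> (?e i)))) = 1" if "i \<in> I" for i
      proof -
        have "\<Gamma> (?e i) \<in> S" using bijg that by (auto simp: bij_betw_def)
        then have "\<epsilon> (\<Gamma> (?e i)) \<in> {-1, 1}" using \<epsilon> by (auto simp: signs_def PiE_def Pi_def)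
        then show ?thesis by auto
      qed
      then show ?thesis by (simp add: l1_space_def f_def)
    qed
    then show "real (card S) \<le> K2 * nrm A (sign_sum S (\<lambda>s. s) \<epsilon>)"
      using K2[OF fin[of I]] y cards by simp
  qed
qed

text \<open>
  The map \<open>\<psi> \<circ> \<phi> - \<pi>\<close> is linear, so its size on a signed sum is at most \<open>card S\<close> times the tolerance.
\<close>

lemma CPA_lower_bound:
  assumes H: "chilbert_space H" and iso: "\<And>x. x \<in> carrier A \<Longrightarrow> op_norm H H (\<pi> x) = nrm A x"
    and \<pi>: "linear_map class_ring A (op_algebra H) \<pi>"
    and cpa: "(\<phi>, \<psi>, B) \<in> CPA A H \<pi> \<Omega> \<delta>" and S: "finite S" "S \<subseteq> \<Omega>" "S \<subseteq> carrier A" and \<epsilon>: "\<epsilon> \<in> signs S"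
  shows "nrm A (sign_sum S (\<lambda>s. s) \<epsilon>) \<le> nrm B (\<phi> (sign_sum S (\<lambda>s. s) \<epsilon>)) + real (card S) * \<delta>"
proof -
  let ?O = "op_algebra H"
  from cpa have lin: "linear_map class_ring A B \<phi>" "linear_map class_ring B ?O \<psi>"
    and contr: "\<And>b. b \<in> carrier B \<Longrightarrow> nrm ?O (\<psi> b) \<le> nrm B b"
    and approx: "\<And>x. x \<in> \<Omega> \<Longrightarrow> nrm ?O (\<psi> (\<phi> x) \<ominus>\<^bsub>?O\<^esub> \<pi> x) < \<delta>"
    by (auto simp: CPA_def cp_contraction_def completely_positive_def)
  note p = linear_mapD[OF \<pi>] and f = linear_mapD[OF lin(1)] and g = linear_mapD[OF lin(2)]
  interpret O: cnormed_space ?O by (rule cnormed_space_op_algebra[OF H p(5)])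
  let ?N = "\<lambda>x. nrm ?O (\<psi> (\<phi> x) \<ominus>\<^bsub>?O\<^esub> \<pi> x)"
  have c: "\<psi> (\<phi> x) \<in> carrier ?O" "\<pi> x \<in> carrier ?O" if "x \<in> carrier A" for x using that f g p by auto
  have Nadd: "?N (x \<boxplus> y) \<le> ?N x + ?N y" if "x \<in> carrier A" "y \<in> carrier A" for x y
  proof -
    have "\<psi> (\<phi> (x \<boxplus> y)) \<ominus>\<^bsub>?O\<^esub> \<pi> (x \<boxplus> y) = (\<psi> (\<phi> x) \<ominus>\<^bsub>?O\<^esub> \<pi> x) \<oplus>\<^bsub>?O\<^esub> (\<psi> (\<phi> y) \<ominus>\<^bsub>?O\<^esub> \<pi> y)"
      using that f g p c by (simp add: a_minus_def O.M.a_ac O.M.minus_add)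
    then show ?thesis using O.nrm_triangle[of "\<psi> (\<phi> x) \<ominus>\<^bsub>?O\<^esub> \<pi> x" "\<psi> (\<phi> y) \<ominus>\<^bsub>?O\<^esub> \<pi> y"] c that by simp
  qed
  have Nsm: "?N (k \<cdot> x) = cmod k * ?N x" if "x \<in> carrier A" for k x
    using that f g p c O.nrm_smult[of "\<psi> (\<phi> x) \<ominus>\<^bsub>?O\<^esub> \<pi> x" k] by (simp add: O.smult_sub)
  have sum: "?N (sign_sum S' (\<lambda>s. s) \<epsilon>) \<le> (\<Sum>s\<in>S'. \<bar>\<epsilon> s\<bar> * ?N s)" if "finite S'" "S' \<subseteq> carrier A" for S'
    using that unfolding sign_sum_def
  proof (induction S')
    case empty
    show ?case using Nsm[of "\<zero>\<^bsub>A\<^esub>" 0] by simp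
  next
    case (insert s S')
    have y: "(\<Oplus>\<^bsub>A\<^esub>s\<in>S'. complex_of_real (\<epsilon> s) \<cdot> s) \<in> carrier A" using insert by (intro M.finsum_closed) auto
    have eq: "(\<Oplus>\<^bsub>A\<^esub>s\<in>insert s S'. complex_of_real (\<epsilon> s) \<cdot> s) = complex_of_real (\<epsilon> s) \<cdot> s \<boxplus> (\<Oplus>\<^bsub>A\<^esub>s\<in>S'. complex_of_real (\<epsilon> s) \<cdot> s)"
      using insert by (subst M.finsum_insert) auto
    have "?N (\<Oplus>\<^bsub>A\<^esub>s\<in>insert s S'. complex_of_real (\<epsilon> s) \<cdot> s) \<le> ?N (complex_of_real (\<epsilon> s) \<cdot> s) + ?N (\<Oplus>\<^bsub>A\<^esub>s\<in>S'. complex_of_real (\<epsilon> s) \<cdot> s)"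
      unfolding eq by (rule Nadd) (use insert y in auto)
    also have "?N (complex_of_real (\<epsilon> s) \<cdot> s) = \<bar>\<epsilon> s\<bar> * ?N s" using Nsm[of s "complex_of_real (\<epsilon> s)"] insert by simp
    finally show ?case using insert by simp
  qed
  let ?y = "sign_sum S (\<lambda>s. s) \<epsilon>"
  have y: "?y \<in> carrier A" using S by (intro sign_sum_in) auto
  have "?N ?y \<le> (\<Sum>s\<in>S. \<bar>\<epsilon> s\<bar> * ?N s)" by (rule sum[OF S(1,3)])
  also have "\<dots> \<le> (\<Sum>s\<in>S. \<delta>)"
  proof (rule sum_mono)
    fix s assume s: "s \<in> S"
    have "\<bar>\<epsilon> s\<bar> = 1" using \<epsilon> s by (auto simp: signs_def PiE_def Pi_def)
    then show "\<bar>\<epsilon> s\<bar> * ?N s \<le> \<delta>" using approx[of s] s S by auto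
  qed
  finally have N: "?N ?y \<le> real (card S) * \<delta>" by simp
  have "nrm A ?y = nrm ?O (\<pi> ?y)" using iso[OF y] by (simp add: op_algebra_def)
  also have "\<dots> \<le> nrm ?O (\<psi> (\<phi> ?y)) + ?N ?y" using O.nrm_diff_le[OF c[OF y]] by simp
  also have "\<dots> \<le> nrm B (\<phi> ?y) + real (card S) * \<delta>" using contr[OF f(1)[OF y]] N by simp
  finally show ?thesis .
qed
end

lemma power_of_two_between:
  fixes t :: real assumes "t \<ge> 1" shows "\<exists>k. 2 ^ k \<le> t \<and> t < 2 * 2 ^ k"
proof -
  obtain n where n: "t < 2 ^ n" using real_arch_pow[of 2 t] by auto
  define k where "k = (LEAST k. t < 2 ^ Suc k)"
  have ex: "t < 2 ^ Suc n" using n by (rule less_le_trans) simp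
  have 1: "t < 2 ^ Suc k" unfolding k_def by (rule LeastI[of "\<lambda>k. t < 2 ^ Suc k", OF ex])
  have "2 ^ k \<le> t"
  proof (cases k)
    case (Suc j)
    then show ?thesis using not_less_Least[of j "\<lambda>k. t < 2 ^ Suc k"] by (simp add: k_def not_less)
  qed (use assms in simp)
  then show ?thesis using 1 by auto
qed

context cstar_algebra begin
text \<open>
  The tolerance \<open>\<rho> / (2 D)\<close> costs at most half of the lower bound: some element of \<open>S\<close> has norm at least \<open>\<rho>\<close>, so
  \<open>K1 \<ge> \<rho>\<close> and \<open>1 / K2 \<ge> \<rho> / D\<close>. With \<open>\<gamma> = 1 / (2 K2)\<close> the ratio \<open>\<gamma> / K1\<close> is at least \<open>1 / (2 D)\<close>, and \<open>m\<close> is chosen so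
  that the base of the power in \<open>l1_lower_bound_imp_many_functionals\<close> is at least two.
\<close>

lemma ln_rank_lower_bound:
  fixes B :: "(nat \<Rightarrow> complex) cstar"
  assumes H: "chilbert_space H" and iso: "\<And>x. x \<in> carrier A \<Longrightarrow> op_norm H H (\<pi> x) = nrm A x"
    and \<pi>: "linear_map class_ring A (op_algebra H) \<pi>"
    and D: "D \<ge> 1" and \<rho>: "\<rho> > 0"
    and cpa: "(\<phi>, \<psi>, B) \<in> CPA A H \<pi> \<Omega> (\<rho> / (2 * D))"
    and S: "finite S" "S \<subseteq> \<Omega>" "S \<subseteq> carrier A" "\<And>s. s \<in> S \<Longrightarrow> \<rho> \<le> nrm A s"
    and K: "K1 \<ge> 0" "K2 \<ge> 0" "K1 * K2 \<le> D" "\<And>s. s \<in> S \<Longrightarrow> nrm A s \<le> K1"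
      "\<And>\<epsilon>. \<epsilon> \<in> signs S \<Longrightarrow> real (card S) \<le> K2 * nrm A (sign_sum S (\<lambda>s. s) \<epsilon>)"
    and big: "32 * exp 2 * D\<^sup>2 \<le> real (card S)"
  shows "1 \<le> cstar_rank B" "real (card S) * ln 2 / (256 * exp 2 * D\<^sup>2) \<le> ln (real (cstar_rank B))"
proof -
  let ?n = "real (card S)"
  define E where "E = 32 * exp 2 * D\<^sup>2"
  have D2: "D\<^sup>2 \<ge> 1" using D by simp
  have e2: "exp (2::real) \<ge> 1" by simp
  have E: "E \<ge> 32" using mult_mono[OF e2 D2] by (simp add: E_def)
  have n: "?n \<ge> E" using big by (simp add: E_def)
  from cpa have fd: "finite_dim_cstar_algebra B" and lin: "linear_map class_ring A B \<phi>"
    and contr: "\<And>x. x \<in> carrier A \<Longrightarrow> nrm B (\<phi> x) \<le> nrm A x"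
    by (auto simp: CPA_def cp_contraction_def completely_positive_def)
  then interpret B: cstar_algebra B by (simp add: finite_dim_cstar_algebra_def)
  obtain P :: "(nat \<Rightarrow> complex) set" and f where P: "finite P" "card P \<le> cstar_rank B"
    and f: "\<And>p q. p \<in> P \<Longrightarrow> q \<in> P \<Longrightarrow> B.lin_fun (f p q)"
    "\<And>p q b. p \<in> P \<Longrightarrow> q \<in> P \<Longrightarrow> b \<in> carrier B \<Longrightarrow> cmod (f p q b) \<le> nrm B b"
    "\<And>b. b \<in> carrier B \<Longrightarrow> nrm B b \<le> (\<Sum>p\<in>P. \<Sum>q\<in>P. cmod (f p q b))"
    using rank_many_functionals[OF fd] by metis
  have "S \<noteq> {}" using n E by auto
  then obtain s where s: "s \<in> S" by blast
  have K1: "K1 \<ge> \<rho>" using K(4)[OF s] S(4)[OF s] by simp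
  have K2: "K2 > 0"
  proof (rule ccontr)
    assume "\<not> K2 > 0"
    then have "K2 = 0" using K(2) by simp
    moreover have "(\<lambda>s\<in>S. 1) \<in> signs S" by (auto simp: signs_def)
    ultimately show False using K(5)[of "\<lambda>s\<in>S. 1"] n E by simp
  qed
  define \<gamma> where "\<gamma> = 1 / (2 * K2)"
  have "K2 * \<rho> \<le> D" using mult_left_mono[OF K1 K(2)] K(3) by (simp add: mult.commute)
  then have \<delta>: "\<rho> / (2 * D) \<le> \<gamma>" using K2 D by (simp add: \<gamma>_def field_simps)
  \<comment> \<open>the number \<open>m\<close> of factors must be a power of two; this costs a factor two in the exponent\<close>
  obtain k where k: "2 ^ k \<le> ?n / E" "?n / E < 2 * 2 ^ k"
    using power_of_two_between[of "?n / E"] n E by auto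
  define m :: nat where "m = 2 ^ k"
  have m: "real m \<le> ?n / E" "?n / E < 2 * real m" "m \<ge> 1" using k by (simp_all add: m_def)
  have "4 * real m \<le> 4 * (?n / E)" using m(1) by simp
  also have "\<dots> \<le> ?n" using E n by (simp add: field_simps)
  finally have m4: "4 * m \<le> card S" by linarith
  have main: "(\<gamma>\<^sup>2 * ?n / (4 * exp 2 * K1\<^sup>2 * real m)) ^ (2 * m) \<le> 2 * real (card P) ^ 4"
  proof (rule B.l1_lower_bound_imp_many_functionals[OF P(1) f S(1)])
    fix i assume i: "i \<in> S"
    show "\<phi> i \<in> carrier B" using linear_mapD(1)[OF lin] i S by auto
    show "nrm B (\<phi> i) \<le> K1" using contr[of i] K(4)[OF i] i S by force
  next
    fix \<epsilon> assume \<epsilon>: "\<epsilon> \<in> signs S"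
    let ?y = "sign_sum S (\<lambda>s. s) \<epsilon>"
    have "?n * (2 * \<gamma>) \<le> nrm A ?y" using K(5)[OF \<epsilon>] K2 by (simp add: \<gamma>_def field_simps)
    also have "\<dots> \<le> nrm B (\<phi> ?y) + ?n * (\<rho> / (2 * D))" by (rule CPA_lower_bound[OF H iso \<pi> cpa S(1-3) \<epsilon>])
    also have "\<dots> \<le> nrm B (\<phi> ?y) + ?n * \<gamma>" using \<delta> by (intro add_left_mono mult_left_mono) auto
    finally have "\<gamma> * ?n \<le> nrm B (\<phi> ?y)" by (simp add: algebra_simps)
    also have "\<phi> ?y = B.sign_sum S \<phi> \<epsilon>"
      using linear_map_sign_sum[OF B.cstar_algebra_axioms lin S(1), of "\<lambda>s. s" \<epsilon>] S(3) by auto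
    finally show "\<gamma> * ?n \<le> nrm B (B.sign_sum S \<phi> \<epsilon>)" .
  qed (use K1 \<rho> K2 m_def m4 in \<open>auto simp: \<gamma>_def\<close>)
  have K1p: "K1 > 0" using K1 \<rho> by simp
  have two: "2 \<le> \<gamma>\<^sup>2 * ?n / (4 * exp 2 * K1\<^sup>2 * real m)"
  proof -
    have "(K1 * K2)\<^sup>2 \<le> D\<^sup>2" using K by (intro power_mono) auto
    then have "real m * (32 * exp 2 * (K1 * K2)\<^sup>2) \<le> real m * E" unfolding E_def by (intro mult_left_mono) auto
    also have "\<dots> \<le> ?n" using m(1) E by (simp add: field_simps)
    finally have "real m * (32 * exp 2 * (K1 * K2)\<^sup>2) \<le> ?n" .
    then show ?thesis using K1p K2 m(3) by (simp add: \<gamma>_def field_simps power2_eq_square)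
  qed
  let ?r = "cstar_rank B"
  have "2 ^ m * 2 ^ m = (2::real) ^ (2 * m)" by (simp add: mult_2 power_add)
  also have "\<dots> \<le> (\<gamma>\<^sup>2 * ?n / (4 * exp 2 * K1\<^sup>2 * real m)) ^ (2 * m)" by (rule power_mono[OF two]) simp
  also have "\<dots> \<le> 2 * real (card P) ^ 4" by (rule main)
  also have "\<dots> \<le> 2 * real ?r ^ 4" using P(2) by (intro mult_left_mono power_mono) auto
  finally have 1: "2 ^ m * 2 ^ m \<le> 2 * real ?r ^ 4" .
  have "(2::real) * 2 ^ m \<le> 2 ^ m * 2 ^ m" using m(3) power_increasing[of 1 m "2::real"] by (intro mult_right_mono) auto
  with 1 have r4: "2 ^ m \<le> real ?r ^ 4" by linarith
  have "?r \<noteq> 0"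
  proof
    assume "?r = 0"
    then have "(2::real) ^ m \<le> 0" using r4 by simp
    then show False using zero_less_power[of "2::real" m] by linarith
  qed
  then show r1: "1 \<le> ?r" by simp
  have "ln (2 ^ m) \<le> ln (real ?r ^ 4)" using r4 by (intro ln_mono) auto
  then have "real m * ln 2 \<le> 4 * ln (real ?r)" using r1 by (simp add: ln_realpow)
  moreover have "?n / (2 * E) * ln 2 \<le> real m * ln 2" using m(2) E by (intro mult_right_mono) (auto simp: field_simps)
  ultimately have "?n / (2 * E) * ln 2 \<le> 4 * ln (real ?r)" by linarith
  then show "?n * ln 2 / (256 * exp 2 * D\<^sup>2) \<le> ln (real ?r)" by (simp add: E_def field_simps)
qed
end

section \<open>Positivity of the entropy\<close>

text \<open>
  If there are approximations, the infimum defining \<^const>\<open>rcp\<close> is attained, as extended natural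
  numbers are well-ordered; otherwise it is infinite.
\<close>

lemma eln_rcp_lower_bound:
  assumes "\<And>\<phi> \<psi> B. (\<phi>, \<psi>, B) \<in> CPA A H \<pi> \<Omega> \<delta> \<Longrightarrow> 1 \<le> cstar_rank B \<and> c \<le> ln (real (cstar_rank B))"
  shows "ereal c \<le> eln (rcp A H \<pi> \<Omega> \<delta>)"
proof (cases "CPA A H \<pi> \<Omega> \<delta> = {}")
  case True
  then show ?thesis by (simp add: rcp_def eln_def top_enat_def)
next
  case False
  let ?R = "(\<lambda>(\<phi>, \<psi>, B). enat (cstar_rank B)) ` CPA A H \<pi> \<Omega> \<delta>"
  obtain r where "r \<in> ?R" using False by blast
  then have "Inf ?R \<in> ?R" by (rule wellorder_InfI)
  then obtain \<phi> \<psi> B where B: "(\<phi>, \<psi>, B) \<in> CPA A H \<pi> \<Omega> \<delta>" "rcp A H \<pi> \<Omega> \<delta> = enat (cstar_rank B)"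
    unfolding rcp_def by auto
  then show ?thesis using assms[OF B(1)] by (simp add: eln_def)
qed

theorem proposition2p2:
  fixes A :: "'a cstar" and \<alpha> :: "'a \<Rightarrow> 'a"
    and H :: "'h chilbert" and \<pi> :: "'a \<Rightarrow> 'h \<Rightarrow> 'h"
    and \<Omega> :: "'a set" and D :: real and I :: "nat \<Rightarrow> (nat \<times> 'a) set"
  assumes "exact_cstar_algebra A"
    and "faithful_rep A H \<pi>"
    and "cstar_automorphism A \<alpha>"
    and "finite \<Omega>" and "\<Omega> \<subseteq> carrier A"
    and "D \<ge> 1"
    and "\<And>n. I n \<subseteq> {..<n} \<times> \<Omega>"
    and "limsup (\<lambda>n. ereal (real (card (I n)) / real n)) > 0"
    and "\<And>n. \<exists>\<Gamma>.
           bij_betw \<Gamma> (std_basis (I n)) ((\<lambda>(k, x). (\<alpha> ^^ k) x) ` I n) \<and>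
           D_isomorphism D (l1_space (I n)) (span_space A ((\<lambda>(k, x). (\<alpha> ^^ k) x) ` I n)) \<Gamma>"
  shows "ht A H \<pi> \<alpha> > 0"
proof -
  interpret A: cstar_algebra A using assms(1) by (simp add: exact_cstar_algebra_def)
  have H: "chilbert_space H" and lin: "linear_map class_ring A (op_algebra H) \<pi>"
    using assms(2) by (auto simp: faithful_rep_def star_hom_def)
  note iso = faithful_rep_isometric[OF A.cstar_algebra_axioms assms(2)]
  have \<alpha>in: "(\<alpha> ^^ k) x \<in> carrier A" if "x \<in> carrier A" for k x
    using faithful_rep_funpow[OF assms(2,3), of k] that by blast
  note \<alpha>iso = nrm_automorphism_funpow[OF A.cstar_algebra_axioms assms(2,3)]
  \<comment> \<open>a lower bound for all nonzero elements \<open>\<alpha>^k(x)\<close>, because automorphisms are isometric; the one serves the case that \<open>\<Omega>\<close> has no nonzero element\<close>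
  define \<rho> where "\<rho> = Min (insert 1 (nrm A ` (\<Omega> - {\<zero>\<^bsub>A\<^esub>})))"
  have fin\<Omega>: "finite (insert 1 (nrm A ` (\<Omega> - {\<zero>\<^bsub>A\<^esub>})))" using assms(4) by simp
  have \<rho>: "\<rho> > 0"
    unfolding \<rho>_def using fin\<Omega> assms(5) A.nrm_eq_0 A.nrm_nonneg by (subst Min_gr_iff) (auto simp: less_le)
  have \<rho>_le: "\<rho> \<le> nrm A x" if "x \<in> \<Omega>" "x \<noteq> \<zero>\<^bsub>A\<^esub>" for x
    unfolding \<rho>_def using fin\<Omega> that by (intro Min_le) auto
  define \<delta> where "\<delta> = \<rho> / (2 * D)"
  have \<delta>: "\<delta> > 0" using \<rho> assms(6) by (simp add: \<delta>_def)
  let ?\<Omega> = "\<lambda>n. \<Union>k<n. (\<alpha> ^^ k) ` \<Omega>" and ?S = "\<lambda>n. (\<lambda>(k, x). (\<alpha> ^^ k) x) ` I n"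
  have rank: "1 \<le> cstar_rank B \<and> real (card (I n)) * ln 2 / (256 * exp 2 * D\<^sup>2) \<le> ln (real (cstar_rank B))"
    if cpa: "(\<phi>, \<psi>, B) \<in> CPA A H \<pi> (?\<Omega> n) \<delta>" and big: "32 * exp 2 * D\<^sup>2 \<le> real (card (I n))" for n \<phi> \<psi> B
  proof -
    have finI: "finite (I n)" by (rule finite_subset[OF assms(7)]) (use assms(4) in simp)
    have S: "?S n \<subseteq> ?\<Omega> n" "?S n \<subseteq> carrier A"
    proof -
      have *: "(\<alpha> ^^ k) x \<in> ?\<Omega> n \<and> (\<alpha> ^^ k) x \<in> carrier A" if "(k, x) \<in> I n" for k x
      proof -
        have "k < n" "x \<in> \<Omega>" using that assms(7)[of n] by auto
        then show ?thesis using \<alpha>in assms(5) by blast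
      qed
      then show "?S n \<subseteq> ?\<Omega> n" "?S n \<subseteq> carrier A" by auto
    qed
    obtain \<Gamma> where \<Gamma>: "bij_betw \<Gamma> (std_basis (I n)) (?S n)" "D_isomorphism D (l1_space (I n)) (span_space A (?S n)) \<Gamma>"
      using assms(9)[of n] by blast
    obtain K1 K2 where K: "K1 \<ge> 0" "K2 \<ge> 0" "K1 * K2 \<le> D" "\<And>s. s \<in> ?S n \<Longrightarrow> nrm A s \<le> K1"
      "\<And>\<epsilon>. \<epsilon> \<in> signs (?S n) \<Longrightarrow> real (card (?S n)) \<le> K2 * nrm A (A.sign_sum (?S n) (\<lambda>s. s) \<epsilon>)"
      and nz: "\<And>s. s \<in> ?S n \<Longrightarrow> 1 \<le> K2 * nrm A s" and card: "card (?S n) = card (I n)"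
      using A.D_isomorphism_l1[OF finI S(2) \<Gamma>] by blast
    have low: "\<rho> \<le> nrm A s" if s: "s \<in> ?S n" for s
    proof -
      obtain k x where kx: "s = (\<alpha> ^^ k) x" "x \<in> \<Omega>"
      proof -
        obtain z where z: "z \<in> I n" "s = (\<lambda>(k, x). (\<alpha> ^^ k) x) z" using s by blast
        then have "snd z \<in> \<Omega>" using assms(7)[of n] by auto
        then show ?thesis using z(2) that[of "fst z" "snd z"] by (simp add: case_prod_unfold)
      qed
      have ns: "nrm A s = nrm A x" using \<alpha>iso[of x k] kx assms(5) by auto
      have "x \<noteq> \<zero>\<^bsub>A\<^esub>" using nz[OF s] ns by auto
      then show ?thesis using \<rho>_le[OF kx(2)] ns by simp
    qed
    show ?thesis
      using A.ln_rank_lower_bound[OF H iso lin assms(6) \<rho> cpa[unfolded \<delta>_def] _ S low K] finI big card by simp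
  qed
  \<comment> \<open>the density of infinitely many index sets exceeds \<open>c\<close>\<close>
  obtain c where c: "0 < c" "ereal c < limsup (\<lambda>n. ereal (real (card (I n)) / real n))"
  proof -
    obtain z where "0 < z" "z < limsup (\<lambda>n. ereal (real (card (I n)) / real n))" using dense[OF assms(8)] by blast
    then show ?thesis using that by (cases z) auto
  qed
  define \<kappa> where "\<kappa> = c * ln 2 / (256 * exp 2 * D\<^sup>2)"
  have D2: "D\<^sup>2 > 0" using assms(6) by simp
  have \<kappa>: "\<kappa> > 0" using c D2 by (simp add: \<kappa>_def)
  let ?h = "\<lambda>n. eln (rcp A H \<pi> (?\<Omega> n) \<delta>) / ereal (real n)"
  have good: "ereal \<kappa> \<le> ?h n" if n: "n > 0" "32 * exp 2 * D\<^sup>2 \<le> c * real n" "c < real (card (I n)) / real n" for n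
  proof -
    have cn: "c * real n \<le> real (card (I n))" using n by (simp add: field_simps)
    have "ereal (\<kappa> * real n) \<le> eln (rcp A H \<pi> (?\<Omega> n) \<delta>)"
    proof (rule eln_rcp_lower_bound)
      fix \<phi> \<psi> B assume cpa: "(\<phi>, \<psi>, B) \<in> CPA A H \<pi> (?\<Omega> n) \<delta>"
      have "\<kappa> * real n = (c * real n) * (ln 2 / (256 * exp 2 * D\<^sup>2))" by (simp add: \<kappa>_def)
      also have "\<dots> \<le> real (card (I n)) * (ln 2 / (256 * exp 2 * D\<^sup>2))" using cn by (intro mult_right_mono) auto
      finally show "1 \<le> cstar_rank B \<and> \<kappa> * real n \<le> ln (real (cstar_rank B))"
        using rank[OF cpa] n(2) cn by simp
    qed
    then have "ereal (\<kappa> * real n) / ereal (real n) \<le> ?h n" using n(1) by (intro ereal_divide_right_mono) auto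
    then show ?thesis using n(1) by simp
  qed
  have "ereal \<kappa> \<le> limsup ?h"
  proof (rule ccontr)
    assume "\<not> ereal \<kappa> \<le> limsup ?h"
    then have "\<forall>\<^sub>F n in sequentially. ?h n < ereal \<kappa>" by (intro Limsup_lessD) simp
    moreover have "\<forall>\<^sub>F n in sequentially. 32 * exp 2 * D\<^sup>2 / c \<le> real n"
      using filterlim_real_sequentially by (simp add: filterlim_at_top)
    moreover have "\<forall>\<^sub>F n in sequentially. n > 0" by (rule eventually_gt_at_top)
    ultimately have "\<forall>\<^sub>F n in sequentially. ereal (real (card (I n)) / real n) \<le> ereal c"
    proof eventually_elim
      case (elim n)
      have "32 * exp 2 * D\<^sup>2 \<le> c * real n" using elim(2) c(1) by (simp add: field_simps)
      then show ?case using good[of n] elim(1,3) by force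
    qed
    then have "limsup (\<lambda>n. ereal (real (card (I n)) / real n)) \<le> ereal c" by (rule Limsup_bounded)
    then show False using c(2) by simp
  qed
  then have "ereal \<kappa> \<le> ht_at A H \<pi> \<alpha> \<Omega> \<delta>" unfolding ht_at_def .
  moreover have "0 < ereal \<kappa>" using \<kappa> by simp
  ultimately have "0 < ht_at A H \<pi> \<alpha> \<Omega> \<delta>" by (rule less_le_trans[rotated])
  also have "\<dots> \<le> ht_on A H \<pi> \<alpha> \<Omega>" unfolding ht_on_def by (rule SUP_upper) (use \<delta> in simp)
  also have "\<dots> \<le> ht A H \<pi> \<alpha>" unfolding ht_def by (rule SUP_upper) (use assms(4,5) in simp)
  finally show ?thesis .
qed

end
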